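(* Let $k$ be a field, $\Gamma$ an abelian group, and $R$ a PDCF $\Gamma$-graded $k$-algebra which is an integral domain, with image monoid $Q$. There is an isomorphism of abelian groups $K^{\mathrm{BDF}}_{\Gamma,0}(R)\overset{\sim}{\to}\mathbb{Z}[[Q]]\{\Gamma\}$ given by sending $[F]\mapsto\mathcal{K}_\Gamma(F)$ for each projective BDF $\Gamma$-graded $R$-module $F$.
   Context: Abelian groups and monoids are written additively. A $\Gamma$-graded $k$-algebra is a commutative $k$-algebra $R$ with $k$-subspaces $R_g$ ($g\in\Gamma$) such that $R=\bigoplus_{g\in\Gamma}R_g$ and $R_gR_h\subseteq R_{g+h}$. A $\Gamma$-graded $R$-module is an $R$-module $M$ with $k$-subspaces $M_g$ such that $M=\bigoplus_{g\in\Gamma}M_g$ and $R_gM_h\subseteq M_{g+h}$. An $R$-linear map $\varphi:M\to N$ is graded if $\varphi(M_g)\subseteq N_g$ for all $g$. Write $\mathrm{Supp}_\Gamma(M)=\{g\in\Gamma\mid M_g\neq 0\}$. Since $R$ is a domain, $Q:=\mathrm{Supp}_\Gamma(R)$ is a submonoid of $\Gamma$ (the image monoid). $Q$ is pointed if $p+q=0$ with $p,q\in Q$ implies $p=q=0$; then $g\le_Q h :\iff h-g\in Q$ is a partial order on $\Gamma$. A subset $U\subseteq\Gamma$ is downward finite if for every $g\in\Gamma$ the set $\{u\in U\mid u\le_Q g\}$ is finite; it is finitely bounded below if there are finitely many $p_1,\dots,p_n\in\Gamma$ such that every $u\in U$ satisfies $p_i\le_Q u$ for some $i$. $R$ is PDCF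 if $Q$ is pointed and downward finite, $R$ is connected ($R_0=k$), and $\dim_k R_g<\infty$ for all $g\in\Gamma$. A $\Gamma$-graded $R$-module $M$ is BDF if $\mathrm{Supp}_\Gamma(M)$ is finitely bounded below and downward finite and $\dim_k M_g<\infty$ for all $g\in\Gamma$. $\mathbb{Z}[[Q]]\{\Gamma\}$ is the set of functions $a:\Gamma\to\mathbb{Z}$, written $a=\sum_{g\in\Gamma}a_g\mathbf{t}^g$, whose support $\{g\mid a_g\ne0\}$ is downward finite and finitely bounded below; it is a commutative ring under pointwise addition and the product with coefficients $(ab)_u=\sum_{g+h=u}a_gb_h$ (a sum with finitely many nonzero terms), with $1=\mathbf{t}^0$. The Hilbert series of a BDF module $M$ is $\mathcal{H}_\Gamma(M)=\sum_{g\in\Gamma}\dim_k(M_g)\mathbf{t}^g\in\mathbb{Z}[[Q]]\{\Gamma\}$. $\mathcal{H}_\Gamma(R)$ is a unit in $\mathbb{Z}[[Q]]\{\Gamma\}$, and the $K$-series of $M$ is $\mathcal{K}_\Gamma(M)=\mathcal{H}_\Gamma(M)\cdot\mathcal{H}_\Gamma(R)^{-1}$. $K^{\mathrm{BDF}}_{\Gamma,0}(R)$ is the Grothendieck group (group completion) of the commutative monoid of graded isomorphism classes of BDF $\Gamma$-graded $R$-modules that are projective as $R$-modules (all such modules are in fact free), with operation $[M]+[N]=[M\oplus N]$. *)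

theory Defs
  imports "HOL-Algebra.Module"
begin

record ('a, 'm, 'g) gmodule = "('a, 'm) module" +
  grade :: "'g \<Rightarrow> 'm set"

text \<open>As with \<^locale>\<open>module\<close> itself, the fields \<open>mult\<close> and \<open>one\<close> of the record are
  irrelevant when it is used as a module; they matter only for algebras.\<close>

definition graded_space ::
  "('k, 'x) ring_scheme \<Rightarrow> ('k, 'm, 'g) gmodule \<Rightarrow> bool" where
  "graded_space K V \<longleftrightarrow>
     module K V \<and>
     (\<forall>g. submodule (grade V g) K V) \<and>
     (\<forall>x\<in>carrier V. \<exists>!f. (\<forall>g. f g \<in> grade V g) \<and> finite {g. f g \<noteq> \<zero>\<^bsub>V\<^esub>} \<and>
        x = (\<Oplus>\<^bsub>V\<^esub>g\<in>{g. f g \<noteq> \<zero>\<^bsub>V\<^esub>}. f g))"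

definition graded_algebra ::
  "('k, 'x) ring_scheme \<Rightarrow> ('k, 'r, 'g::ab_group_add) gmodule \<Rightarrow> bool" where
  "graded_algebra K R \<longleftrightarrow>
     algebra K R \<and> graded_space K R \<and>
     (\<forall>g h. \<forall>r\<in>grade R g. \<forall>s\<in>grade R h. r \<otimes>\<^bsub>R\<^esub> s \<in> grade R (g + h))"

text \<open>Restriction of scalars along \<open>K \<rightarrow> R\<close>, \<open>c \<mapsto> c \<odot> 1\<close>.\<close>

definition restrict_scalars ::
  "('k, 'r, 'g) gmodule \<Rightarrow> ('r, 'm, 'g) gmodule \<Rightarrow> ('k, 'm, 'g) gmodule" where
  "restrict_scalars R M =
     \<lparr>carrier = carrier M, mult = mult M, one = one M, zero = zero M, add = add M,
      smult = (\<lambda>c m. (c \<odot>\<^bsub>R\<^esub> \<one>\<^bsub>R\<^esub>) \<odot>\<^bsub>M\<^esub> m), grade = grade M\<rparr>"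

definition graded_module ::
  "('k, 'x) ring_scheme \<Rightarrow> ('k, 'r, 'g::ab_group_add) gmodule \<Rightarrow> ('r, 'm, 'g) gmodule \<Rightarrow> bool" where
  "graded_module K R M \<longleftrightarrow>
     module R M \<and> graded_space K (restrict_scalars R M) \<and>
     (\<forall>g h. \<forall>r\<in>grade R g. \<forall>m\<in>grade M h. r \<odot>\<^bsub>M\<^esub> m \<in> grade M (g + h))"

definition Supp :: "('a, 'm, 'g) gmodule \<Rightarrow> 'g set" where
  "Supp M = {g. grade M g \<noteq> {\<zero>\<^bsub>M\<^esub>}}"

definition linear_maps ::
  "('r, 'x) ring_scheme \<Rightarrow> ('r, 'm, 'y) module_scheme \<Rightarrow> ('r, 'n, 'z) module_scheme
     \<Rightarrow> ('m \<Rightarrow> 'n) set" where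
  "linear_maps R M N =
     {f \<in> carrier M \<rightarrow> carrier N.
        (\<forall>x\<in>carrier M. \<forall>y\<in>carrier M. f (x \<oplus>\<^bsub>M\<^esub> y) = f x \<oplus>\<^bsub>N\<^esub> f y) \<and>
        (\<forall>r\<in>carrier R. \<forall>x\<in>carrier M. f (r \<odot>\<^bsub>M\<^esub> x) = r \<odot>\<^bsub>N\<^esub> f x)}"

definition graded_iso ::
  "('k, 'r, 'g) gmodule \<Rightarrow> ('r, 'm, 'g) gmodule \<Rightarrow> ('r, 'n, 'g) gmodule \<Rightarrow> bool" where
  "graded_iso R M N \<longleftrightarrow>
     (\<exists>f\<in>linear_maps R M N. bij_betw f (carrier M) (carrier N) \<and>
        (\<forall>g. f ` grade M g = grade N g))"

definition zero_gmodule :: "('r, unit, 'g) gmodule" where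
  "zero_gmodule =
     \<lparr>carrier = UNIV, mult = (\<lambda>_ _. ()), one = (), zero = (), add = (\<lambda>_ _. ()),
      smult = (\<lambda>_ _. ()), grade = (\<lambda>_. UNIV)\<rparr>"

definition gmodule_sum ::
  "('r, 'm, 'g) gmodule \<Rightarrow> ('r, 'n, 'g) gmodule \<Rightarrow> ('r, 'm \<times> 'n, 'g) gmodule" where
  "gmodule_sum M N =
     \<lparr>carrier = carrier M \<times> carrier N,
      mult = (\<lambda>(x, y) (x', y'). (x \<otimes>\<^bsub>M\<^esub> x', y \<otimes>\<^bsub>N\<^esub> y')),
      one = (\<one>\<^bsub>M\<^esub>, \<one>\<^bsub>N\<^esub>),
      zero = (\<zero>\<^bsub>M\<^esub>, \<zero>\<^bsub>N\<^esub>),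
      add = (\<lambda>(x, y) (x', y'). (x \<oplus>\<^bsub>M\<^esub> x', y \<oplus>\<^bsub>N\<^esub> y')),
      smult = (\<lambda>r (x, y). (r \<odot>\<^bsub>M\<^esub> x, r \<odot>\<^bsub>N\<^esub> y)),
      grade = (\<lambda>g. grade M g \<times> grade N g)\<rparr>"

definition finite_basis ::
  "('k, 'x) ring_scheme \<Rightarrow> ('k, 'm, 'y) module_scheme \<Rightarrow> 'm set \<Rightarrow> 'm set \<Rightarrow> bool" where
  "finite_basis K V W B \<longleftrightarrow>
     finite B \<and> B \<subseteq> W \<and>
     (\<forall>w\<in>W. \<exists>!c. c \<in> B \<rightarrow>\<^sub>E carrier K \<and> w = (\<Oplus>\<^bsub>V\<^esub>b\<in>B. c b \<odot>\<^bsub>V\<^esub> b))"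

definition finite_dim ::
  "('k, 'x) ring_scheme \<Rightarrow> ('k, 'm, 'y) module_scheme \<Rightarrow> 'm set \<Rightarrow> bool" where
  "finite_dim K V W \<longleftrightarrow> (\<exists>B. finite_basis K V W B)"

definition dim_over ::
  "('k, 'x) ring_scheme \<Rightarrow> ('k, 'm, 'y) module_scheme \<Rightarrow> 'm set \<Rightarrow> nat" where
  "dim_over K V W = (THE n. \<exists>B. finite_basis K V W B \<and> card B = n)"

definition le_monoid :: "'g::ab_group_add set \<Rightarrow> 'g \<Rightarrow> 'g \<Rightarrow> bool" where
  "le_monoid Q g h \<longleftrightarrow> h - g \<in> Q"

definition pointed :: "'g::ab_group_add set \<Rightarrow> bool" where
  "pointed Q \<longleftrightarrow> (\<forall>p\<in>Q. \<forall>q\<in>Q. p + q = 0 \<longrightarrow> p = 0 \<and> q = 0)"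

definition downward_finite :: "'g::ab_group_add set \<Rightarrow> 'g set \<Rightarrow> bool" where
  "downward_finite Q U \<longleftrightarrow> (\<forall>g. finite {u\<in>U. le_monoid Q u g})"

definition finitely_bounded_below :: "'g::ab_group_add set \<Rightarrow> 'g set \<Rightarrow> bool" where
  "finitely_bounded_below Q U \<longleftrightarrow> (\<exists>P. finite P \<and> (\<forall>u\<in>U. \<exists>p\<in>P. le_monoid Q p u))"

definition PDCF ::
  "('k, 'x) ring_scheme \<Rightarrow> ('k, 'r, 'g::ab_group_add) gmodule \<Rightarrow> bool" where
  "PDCF K R \<longleftrightarrow>
     pointed (Supp R) \<and> downward_finite (Supp R) (Supp R) \<and>
     grade R 0 = (\<lambda>c. c \<odot>\<^bsub>R\<^esub> \<one>\<^bsub>R\<^esub>) ` carrier K \<and>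
     (\<forall>g. finite_dim K R (grade R g))"

definition BDF ::
  "('k, 'x) ring_scheme \<Rightarrow> ('k, 'r, 'g::ab_group_add) gmodule \<Rightarrow> ('r, 'm, 'g) gmodule \<Rightarrow> bool" where
  "BDF K R M \<longleftrightarrow>
     finitely_bounded_below (Supp R) (Supp M) \<and> downward_finite (Supp R) (Supp M) \<and>
     (\<forall>g. finite_dim K (restrict_scalars R M) (grade M g))"

text \<open>For \<open>a\<close>, \<open>b\<close> in the carrier, and \<open>Q\<close> a pointed submonoid, the index set of the sum
  defining the product is finite.\<close>

definition series_ring :: "'g::ab_group_add set \<Rightarrow> ('g \<Rightarrow> int) ring" where
  "series_ring Q =
     \<lparr>carrier = {a. downward_finite Q {g. a g \<noteq> 0} \<and> finitely_bounded_below Q {g. a g \<noteq> 0}},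
      mult = (\<lambda>a b u. \<Sum>(g, h)\<in>{(g, h). g + h = u \<and> a g * b h \<noteq> 0}. a g * b h),
      one = (\<lambda>g. if g = 0 then 1 else 0),
      zero = (\<lambda>_. 0),
      add = (\<lambda>a b g. a g + b g)\<rparr>"

definition hilbert_series ::
  "('k, 'x) ring_scheme \<Rightarrow> ('k, 'm, 'g) gmodule \<Rightarrow> 'g \<Rightarrow> int" where
  "hilbert_series K V = (\<lambda>g. int (dim_over K V (grade V g)))"

definition K_series ::
  "('k, 'x) ring_scheme \<Rightarrow> ('k, 'r, 'g::ab_group_add) gmodule \<Rightarrow> ('r, 'm, 'g) gmodule
     \<Rightarrow> 'g \<Rightarrow> int" where
  "K_series K R M =
     hilbert_series K (restrict_scalars R M)
       \<otimes>\<^bsub>series_ring (Supp R)\<^esub> inv\<^bsub>series_ring (Supp R)\<^esub> (hilbert_series K R)"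

text \<open>The lifting property against surjections \<open>q : N \<rightarrow> N'\<close>. A definition cannot quantify over
  types, so the test modules have elements in the fixed types \<open>'m \<Rightarrow> 'r\<close> and \<open>'m\<close>. This
  suffices: the free module on the set \<open>carrier M\<close> lives in \<open>'m \<Rightarrow> 'r\<close>, and lifting the identity
  of \<open>M\<close> along its canonical surjection onto \<open>M\<close> gives the lifting property against modules
  over all types, see \<open>projective_lift\<close> below.\<close>

definition projective ::
  "('r, 'x) ring_scheme \<Rightarrow> ('r, 'm, 'y) module_scheme \<Rightarrow> bool" where
  "projective R M \<longleftrightarrow>
     (\<forall>(N :: ('r, 'm \<Rightarrow> 'r) module) (N' :: ('r, 'm) module) q f.
        module R N \<and> module R N' \<and>
        q \<in> linear_maps R N N' \<and> q ` carrier N = carrier N' \<and> f \<in> linear_maps R M N' \<longrightarrow>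
        (\<exists>h\<in>linear_maps R M N. \<forall>x\<in>carrier M. q (h x) = f x))"

definition free_module ::
  "('r, 'x) ring_scheme \<Rightarrow> 'm set \<Rightarrow> ('r, 'm \<Rightarrow> 'r) module" where
  "free_module R X =
     \<lparr>carrier = {c. (\<forall>x. c x \<in> carrier R) \<and> finite {x. c x \<noteq> \<zero>\<^bsub>R\<^esub>} \<and> {x. c x \<noteq> \<zero>\<^bsub>R\<^esub>} \<subseteq> X},
      mult = (\<lambda>c d x. c x \<otimes>\<^bsub>R\<^esub> d x), one = (\<lambda>_. \<one>\<^bsub>R\<^esub>),
      zero = (\<lambda>_. \<zero>\<^bsub>R\<^esub>), add = (\<lambda>c d x. c x \<oplus>\<^bsub>R\<^esub> d x),
      smult = (\<lambda>r c x. r \<otimes>\<^bsub>R\<^esub> c x)\<rparr>"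

lemma free_module_module:
  assumes "cring R"
  shows "module R (free_module R X)"
proof -
  interpret R: cring R by fact
  have ag: "abelian_group (free_module R X)"
  proof (rule abelian_groupI)
    fix c d assume c: "c \<in> carrier (free_module R X)" and d: "d \<in> carrier (free_module R X)"
    have "{x. c x \<oplus>\<^bsub>R\<^esub> d x \<noteq> \<zero>\<^bsub>R\<^esub>} \<subseteq> {x. c x \<noteq> \<zero>\<^bsub>R\<^esub>} \<union> {x. d x \<noteq> \<zero>\<^bsub>R\<^esub>}" by auto
    then show "c \<oplus>\<^bsub>free_module R X\<^esub> d \<in> carrier (free_module R X)"
      using c d by (auto simp: free_module_def intro: finite_subset)
  next
    fix c assume c: "c \<in> carrier (free_module R X)"
    have "{x. \<ominus>\<^bsub>R\<^esub> c x \<noteq> \<zero>\<^bsub>R\<^esub>} \<subseteq> {x. c x \<noteq> \<zero>\<^bsub>R\<^esub>}" by auto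
    then have "(\<lambda>x. \<ominus>\<^bsub>R\<^esub> c x) \<in> carrier (free_module R X)"
      using c by (auto simp: free_module_def intro: finite_subset)
    moreover have "(\<lambda>x. \<ominus>\<^bsub>R\<^esub> c x) \<oplus>\<^bsub>free_module R X\<^esub> c = \<zero>\<^bsub>free_module R X\<^esub>"
      using c by (auto simp: free_module_def R.l_neg)
    ultimately show "\<exists>y\<in>carrier (free_module R X).
        y \<oplus>\<^bsub>free_module R X\<^esub> c = \<zero>\<^bsub>free_module R X\<^esub>" by blast
  qed (auto simp: free_module_def R.a_ac)
  show ?thesis
  proof (rule moduleI)
    fix r c assume r: "r \<in> carrier R" and c: "c \<in> carrier (free_module R X)"
    have "{x. r \<otimes>\<^bsub>R\<^esub> c x \<noteq> \<zero>\<^bsub>R\<^esub>} \<subseteq> {x. c x \<noteq> \<zero>\<^bsub>R\<^esub>}" using r by auto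
    then show "r \<odot>\<^bsub>free_module R X\<^esub> c \<in> carrier (free_module R X)"
      using r c by (auto simp: free_module_def intro: finite_subset)
  qed (auto simp: assms ag, auto simp: free_module_def R.l_distr R.r_distr R.m_assoc)
qed

text \<open>The linear extension of \<open>n\<close> from the basis of the free module on a set to all of it.\<close>

definition free_ext ::
  "('r, 'x) ring_scheme \<Rightarrow> ('r, 'n, 'z) module_scheme \<Rightarrow> ('m \<Rightarrow> 'n) \<Rightarrow> ('m \<Rightarrow> 'r) \<Rightarrow> 'n" where
  "free_ext R N n c = (\<Oplus>\<^bsub>N\<^esub>x\<in>{x. c x \<noteq> \<zero>\<^bsub>R\<^esub>}. c x \<odot>\<^bsub>N\<^esub> n x)"

lemma free_ext_superset:
  assumes "module R N" "c \<in> carrier (free_module R X)" "n \<in> X \<rightarrow> carrier N"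
    "finite A" "A \<subseteq> X" "{x. c x \<noteq> \<zero>\<^bsub>R\<^esub>} \<subseteq> A"
  shows "free_ext R N n c = (\<Oplus>\<^bsub>N\<^esub>x\<in>A. c x \<odot>\<^bsub>N\<^esub> n x)"
proof -
  interpret N: module R N by fact
  show ?thesis
    unfolding free_ext_def
    by (rule N.add.finprod_mono_neutral_cong_left)
      (use assms in \<open>auto simp: free_module_def Pi_iff\<close>)
qed

lemma free_ext_linear:
  assumes "module R N" "n \<in> X \<rightarrow> carrier N"
  shows "free_ext R N n \<in> linear_maps R (free_module R X) N"
proof -
  interpret N: module R N by fact
  interpret F: module R "free_module R X" by (rule free_module_module) (rule N.R.is_cring)
  let ?F = "free_module R X"
  have fin: "finite {x. c x \<noteq> \<zero>\<^bsub>R\<^esub>}" "{x. c x \<noteq> \<zero>\<^bsub>R\<^esub>} \<subseteq> X" "\<And>x. c x \<in> carrier R"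
    if "c \<in> carrier ?F" for c using that by (auto simp: free_module_def)
  have n: "n x \<in> carrier N" if "x \<in> X" for x using assms that by auto
  have "free_ext R N n c \<in> carrier N" if c: "c \<in> carrier ?F" for c
    unfolding free_ext_def by (rule N.finsum_closed) (use fin[OF c] n in auto)
  moreover have "free_ext R N n (c \<oplus>\<^bsub>?F\<^esub> d) = free_ext R N n c \<oplus>\<^bsub>N\<^esub> free_ext R N n d"
    if c: "c \<in> carrier ?F" and d: "d \<in> carrier ?F" for c d
  proof -
    let ?A = "{x. c x \<noteq> \<zero>\<^bsub>R\<^esub>} \<union> {x. d x \<noteq> \<zero>\<^bsub>R\<^esub>}"
    have A: "finite ?A" "?A \<subseteq> X" using fin[OF c] fin[OF d] by auto
    have cd: "(c \<oplus>\<^bsub>?F\<^esub> d) x = c x \<oplus>\<^bsub>R\<^esub> d x" for x by (simp add: free_module_def)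
    have sub: "{x. (c \<oplus>\<^bsub>?F\<^esub> d) x \<noteq> \<zero>\<^bsub>R\<^esub>} \<subseteq> ?A" by (auto simp: cd)
    have "free_ext R N n (c \<oplus>\<^bsub>?F\<^esub> d) = (\<Oplus>\<^bsub>N\<^esub>x\<in>?A. (c \<oplus>\<^bsub>?F\<^esub> d) x \<odot>\<^bsub>N\<^esub> n x)"
      by (rule free_ext_superset[OF assms(1) F.a_closed[OF c d] assms(2) A sub])
    also have "\<dots> = (\<Oplus>\<^bsub>N\<^esub>x\<in>?A. c x \<odot>\<^bsub>N\<^esub> n x \<oplus>\<^bsub>N\<^esub> d x \<odot>\<^bsub>N\<^esub> n x)"
      by (rule N.add.finprod_cong')
        (use fin[OF c] fin[OF d] n in \<open>auto simp: cd N.smult_l_distr subset_iff\<close>)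
    also have "\<dots> = (\<Oplus>\<^bsub>N\<^esub>x\<in>?A. c x \<odot>\<^bsub>N\<^esub> n x) \<oplus>\<^bsub>N\<^esub> (\<Oplus>\<^bsub>N\<^esub>x\<in>?A. d x \<odot>\<^bsub>N\<^esub> n x)"
      by (rule N.finsum_addf) (use fin[OF c] fin[OF d] n in \<open>auto simp: subset_iff\<close>)
    also have "(\<Oplus>\<^bsub>N\<^esub>x\<in>?A. c x \<odot>\<^bsub>N\<^esub> n x) = free_ext R N n c"
      by (rule free_ext_superset[symmetric, OF assms(1) c assms(2) A]) auto
    also have "(\<Oplus>\<^bsub>N\<^esub>x\<in>?A. d x \<odot>\<^bsub>N\<^esub> n x) = free_ext R N n d"
      by (rule free_ext_superset[symmetric, OF assms(1) d assms(2) A]) auto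
    finally show ?thesis .
  qed
  moreover have "free_ext R N n (r \<odot>\<^bsub>?F\<^esub> c) = r \<odot>\<^bsub>N\<^esub> free_ext R N n c"
    if r: "r \<in> carrier R" and c: "c \<in> carrier ?F" for r c
  proof -
    let ?A = "{x. c x \<noteq> \<zero>\<^bsub>R\<^esub>}"
    have rc: "(r \<odot>\<^bsub>?F\<^esub> c) x = r \<otimes>\<^bsub>R\<^esub> c x" for x by (simp add: free_module_def)
    have sub: "{x. (r \<odot>\<^bsub>?F\<^esub> c) x \<noteq> \<zero>\<^bsub>R\<^esub>} \<subseteq> ?A" using r by (auto simp: rc)
    have "free_ext R N n (r \<odot>\<^bsub>?F\<^esub> c) = (\<Oplus>\<^bsub>N\<^esub>x\<in>?A. (r \<odot>\<^bsub>?F\<^esub> c) x \<odot>\<^bsub>N\<^esub> n x)"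
      by (rule free_ext_superset[OF assms(1) F.smult_closed[OF r c] assms(2) fin(1,2)[OF c] sub])
    also have "\<dots> = (\<Oplus>\<^bsub>N\<^esub>x\<in>?A. r \<odot>\<^bsub>N\<^esub> (c x \<odot>\<^bsub>N\<^esub> n x))"
      by (rule N.add.finprod_cong')
        (use r fin[OF c] n in \<open>auto simp: rc N.smult_assoc1 subset_iff\<close>)
    also have "\<dots> = r \<odot>\<^bsub>N\<^esub> (\<Oplus>\<^bsub>N\<^esub>x\<in>?A. c x \<odot>\<^bsub>N\<^esub> n x)"
      by (rule N.finsum_smult_ldistr[symmetric])
        (use r fin[OF c] n in \<open>auto simp: subset_iff\<close>)
    finally show ?thesis by (simp add: free_ext_def)
  qed
  ultimately show ?thesis by (auto simp: linear_maps_def)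
qed

lemma linear_maps_finsum:
  assumes "module R N" "module R N'" "q \<in> linear_maps R N N'" "finite A" "f \<in> A \<rightarrow> carrier N"
  shows "q (\<Oplus>\<^bsub>N\<^esub>x\<in>A. f x) = (\<Oplus>\<^bsub>N'\<^esub>x\<in>A. q (f x))"
proof -
  interpret N: module R N by fact
  interpret N': module R N' by fact
  have cl: "q y \<in> carrier N'" if "y \<in> carrier N" for y
    using assms(3) that by (auto simp: linear_maps_def)
  have "q (\<zero>\<^bsub>R\<^esub> \<odot>\<^bsub>N\<^esub> \<zero>\<^bsub>N\<^esub>) = \<zero>\<^bsub>R\<^esub> \<odot>\<^bsub>N'\<^esub> q \<zero>\<^bsub>N\<^esub>"
    using assms(3) N.R.zero_closed N.zero_closed unfolding linear_maps_def by blast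
  then have zero: "q \<zero>\<^bsub>N\<^esub> = \<zero>\<^bsub>N'\<^esub>" by (simp add: cl)
  from assms(4,5) show ?thesis
  proof (induction rule: finite_induct)
    case empty
    then show ?case by (simp add: zero)
  next
    case (insert a A)
    then have "(\<Oplus>\<^bsub>N\<^esub>x\<in>A. f x) \<in> carrier N" by (auto intro: N.finsum_closed)
    then have "q (f a \<oplus>\<^bsub>N\<^esub> (\<Oplus>\<^bsub>N\<^esub>x\<in>A. f x)) = q (f a) \<oplus>\<^bsub>N'\<^esub> q (\<Oplus>\<^bsub>N\<^esub>x\<in>A. f x)"
      using assms(3) insert.prems by (simp add: linear_maps_def)
    with insert show ?case
      by (simp add: N.finsum_insert N'.finsum_insert cl Pi_iff)
  qed
qed

lemma linear_maps_free_ext: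
  assumes "module R N" "module R N'" "q \<in> linear_maps R N N'" "n \<in> X \<rightarrow> carrier N"
    "c \<in> carrier (free_module R X)"
  shows "q (free_ext R N n c) = free_ext R N' (\<lambda>x. q (n x)) c"
proof -
  interpret N: module R N by fact
  interpret N': module R N' by fact
  have c: "finite {x. c x \<noteq> \<zero>\<^bsub>R\<^esub>}" "{x. c x \<noteq> \<zero>\<^bsub>R\<^esub>} \<subseteq> X" "\<And>x. c x \<in> carrier R"
    using assms(5) by (auto simp: free_module_def)
  have cn: "n x \<in> carrier N" if "x \<in> X" for x using assms(4) that by auto
  have cl: "q y \<in> carrier N'" if "y \<in> carrier N" for y
    using assms(3) that by (auto simp: linear_maps_def)
  have "q (free_ext R N n c) = (\<Oplus>\<^bsub>N'\<^esub>x\<in>{x. c x \<noteq> \<zero>\<^bsub>R\<^esub>}. q (c x \<odot>\<^bsub>N\<^esub> n x))"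
    unfolding free_ext_def by (rule linear_maps_finsum[OF assms(1-3)]) (use c cn in auto)
  also have "\<dots> = (\<Oplus>\<^bsub>N'\<^esub>x\<in>{x. c x \<noteq> \<zero>\<^bsub>R\<^esub>}. c x \<odot>\<^bsub>N'\<^esub> q (n x))"
    by (rule N'.add.finprod_cong')
      (use c cn cl assms(3) in \<open>auto simp: linear_maps_def subset_iff\<close>)
  finally show ?thesis by (simp add: free_ext_def)
qed

lemma projective_lift:
  fixes M :: "('r, 'm, 'y) module_scheme"
    and N :: "('r, 'n, 'z) module_scheme" and N' :: "('r, 'p, 'w) module_scheme"
  assumes M: "module R M" "projective R M"
    and N: "module R N" "module R N'"
    and q: "q \<in> linear_maps R N N'" "q ` carrier N = carrier N'"
    and f: "f \<in> linear_maps R M N'"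
  shows "\<exists>h\<in>linear_maps R M N. \<forall>x\<in>carrier M. q (h x) = f x"
proof -
  interpret M: module R M by fact
  interpret N': module R N' by fact
  let ?X = "carrier M"
  let ?F = "free_module R ?X"
  define M' :: "('r, 'm) module" where
    "M' = \<lparr>carrier = carrier M, mult = mult M, one = one M, zero = zero M, add = add M,
           smult = smult M\<rparr>"
  have M'_simps: "carrier M' = carrier M" "zero M' = zero M" "add M' = add M" "smult M' = smult M"
    by (simp_all add: M'_def)
  have M': "module R M'"
  proof (rule moduleI)
    show "abelian_group M'"
      by (rule abelian_groupI)
        (auto simp: M'_simps M.a_assoc intro: M.a_comm M.l_neg)
  qed (auto simp: M'_simps M.R.is_cring M.smult_l_distr M.smult_r_distr M.smult_assoc1)
  have p: "free_ext R M' id \<in> linear_maps R ?F M'"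
    by (rule free_ext_linear[OF M']) (auto simp: M'_simps)
  have "free_ext R M' id ` carrier ?F = carrier M'"
  proof
    show "free_ext R M' id ` carrier ?F \<subseteq> carrier M'" using p by (auto simp: linear_maps_def)
    show "carrier M' \<subseteq> free_ext R M' id ` carrier ?F"
    proof
      fix x assume "x \<in> carrier M'"
      then have x: "x \<in> carrier M" by (simp add: M'_simps)
      interpret M': module R M' by fact
      let ?c = "\<lambda>y. if y = x then \<one>\<^bsub>R\<^esub> else \<zero>\<^bsub>R\<^esub>"
      have sub: "{y. ?c y \<noteq> \<zero>\<^bsub>R\<^esub>} \<subseteq> {x}" by auto
      then have c: "?c \<in> carrier ?F"
        using x by (auto simp: free_module_def intro: finite_subset)
      have "free_ext R M' id ?c = (\<Oplus>\<^bsub>M'\<^esub>y\<in>{x}. ?c y \<odot>\<^bsub>M'\<^esub> id y)"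
        by (rule free_ext_superset[OF M' c]) (use x sub in \<open>auto simp: M'_simps\<close>)
      also have "\<dots> = x" using x by (subst M'.finsum_insert) (auto simp: M'_simps M'.r_zero)
      finally show "x \<in> free_ext R M' id ` carrier ?F" using c by (metis imageI)
    qed
  qed
  moreover have "id \<in> linear_maps R M M'" by (auto simp: linear_maps_def M'_simps)
  ultimately obtain s where s: "s \<in> linear_maps R M ?F"
      "\<And>x. x \<in> carrier M \<Longrightarrow> free_ext R M' id (s x) = id x"
    using M(2) M' p free_module_module[OF M.R.is_cring] unfolding projective_def by meson
  have s_cl: "s x \<in> carrier ?F" if "x \<in> carrier M" for x
    using s(1) that by (auto simp: linear_maps_def)
  have f_cl: "f x \<in> carrier N'" if "x \<in> carrier M" for x
    using f that by (auto simp: linear_maps_def)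
  have "\<forall>x\<in>carrier M. \<exists>y\<in>carrier N. q y = f x"
    using q(2) f_cl by (metis imageE)
  then obtain n where n: "\<And>x. x \<in> carrier M \<Longrightarrow> n x \<in> carrier N"
      "\<And>x. x \<in> carrier M \<Longrightarrow> q (n x) = f x"
    by metis
  have nX: "n \<in> ?X \<rightarrow> carrier N" using n by auto
  have f': "f \<in> linear_maps R M' N'" using f by (auto simp: linear_maps_def M'_simps)
  define h where "h = (\<lambda>x. free_ext R N n (s x))"
  have "h \<in> linear_maps R M N"
    using free_ext_linear[OF N(1) nX] s(1) s_cl unfolding h_def linear_maps_def by auto
  moreover have "q (h x) = f x" if x: "x \<in> carrier M" for x
  proof -
    have supp: "{y. s x y \<noteq> \<zero>\<^bsub>R\<^esub>} \<subseteq> carrier M" "\<And>y. s x y \<in> carrier R"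
      using s_cl[OF x] by (auto simp: free_module_def)
    have "q (h x) = free_ext R N' (\<lambda>y. q (n y)) (s x)"
      unfolding h_def by (rule linear_maps_free_ext[OF N q(1) nX s_cl[OF x]])
    also have "\<dots> = free_ext R N' (\<lambda>y. f (id y)) (s x)"
      unfolding free_ext_def
      by (rule N'.add.finprod_cong') (use supp n f_cl in \<open>auto simp: subset_iff\<close>)
    also have "\<dots> = f (free_ext R M' id (s x))"
      by (rule linear_maps_free_ext[symmetric, OF M' N(2) f' _ s_cl[OF x]])
        (auto simp: M'_simps)
    also have "\<dots> = f x" using s(2)[OF x] by simp
    finally show ?thesis .
  qed
  ultimately show ?thesis by blast
qed

text \<open>The pair \<open>(a, b)\<close> stands for the formal difference \<open>a - b\<close>.\<close>

definition completion_rel :: "('a, 'x) monoid_scheme \<Rightarrow> (('a \<times> 'a) \<times> ('a \<times> 'a)) set" where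
  "completion_rel A =
     {((a, b), (c, d)). {a, b, c, d} \<subseteq> carrier A \<and>
        (\<exists>e\<in>carrier A. a \<otimes>\<^bsub>A\<^esub> d \<otimes>\<^bsub>A\<^esub> e = c \<otimes>\<^bsub>A\<^esub> b \<otimes>\<^bsub>A\<^esub> e)}"

definition group_completion :: "('a, 'x) monoid_scheme \<Rightarrow> ('a \<times> 'a) set monoid" where
  "group_completion A =
     \<lparr>carrier = (carrier A \<times> carrier A) // completion_rel A,
      mult = (\<lambda>X Y. \<Union>(a, b)\<in>X. \<Union>(c, d)\<in>Y. completion_rel A `` {(a \<otimes>\<^bsub>A\<^esub> c, b \<otimes>\<^bsub>A\<^esub> d)}),
      one = completion_rel A `` {(\<one>\<^bsub>A\<^esub>, \<one>\<^bsub>A\<^esub>)}\<rparr>"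

definition completion_class :: "('a, 'x) monoid_scheme \<Rightarrow> 'a \<Rightarrow> ('a \<times> 'a) set" where
  "completion_class A a = completion_rel A `` {(a, \<one>\<^bsub>A\<^esub>)}"

definition projective_BDF ::
  "('k, 'x) ring_scheme \<Rightarrow> ('k, 'r, 'g::ab_group_add) gmodule \<Rightarrow> ('r, 'm, 'g) gmodule \<Rightarrow> bool" where
  "projective_BDF K R M \<longleftrightarrow> graded_module K R M \<and> BDF K R M \<and> projective R M"

text \<open>The class of all modules is not a set, so isomorphism classes are formed within the modules
  whose elements lie in one fixed type. It is large enough: in coordinates, an element of a BDF
  module is given by a scalar for each \<open>g\<close> and each of the finitely many basis elements in
  degree \<open>g\<close>.\<close>

type_synonym ('k, 'g) universe = "'g \<Rightarrow> nat \<Rightarrow> 'k"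

definition iso_class ::
  "('k, 'x) ring_scheme \<Rightarrow> ('k, 'r, 'g::ab_group_add) gmodule \<Rightarrow> ('r, 'm, 'g) gmodule
     \<Rightarrow> ('r, ('k, 'g) universe, 'g) gmodule set" where
  "iso_class K R M = {N. projective_BDF K R N \<and> graded_iso R M N}"

definition iso_class_monoid ::
  "('k, 'x) ring_scheme \<Rightarrow> ('k, 'r, 'g::ab_group_add) gmodule
     \<Rightarrow> ('r, ('k, 'g) universe, 'g) gmodule set monoid" where
  "iso_class_monoid K R =
     \<lparr>carrier = {iso_class K R M |M :: ('r, ('k, 'g) universe, 'g) gmodule. projective_BDF K R M},
      mult = (\<lambda>X Y. \<Union>M\<in>X. \<Union>N\<in>Y. iso_class K R (gmodule_sum M N)),
      one = iso_class K R zero_gmodule\<rparr>"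

definition K0_BDF ::
  "('k, 'x) ring_scheme \<Rightarrow> ('k, 'r, 'g::ab_group_add) gmodule
     \<Rightarrow> (('r, ('k, 'g) universe, 'g) gmodule set \<times> ('r, ('k, 'g) universe, 'g) gmodule set) set monoid"
  where "K0_BDF K R = group_completion (iso_class_monoid K R)"

definition K0_class ::
  "('k, 'x) ring_scheme \<Rightarrow> ('k, 'r, 'g::ab_group_add) gmodule \<Rightarrow> ('r, 'm, 'g) gmodule
     \<Rightarrow> (('r, ('k, 'g) universe, 'g) gmodule set \<times> ('r, ('k, 'g) universe, 'g) gmodule set) set"
  where "K0_class K R M = completion_class (iso_class_monoid K R) (iso_class K R M)"

end

theory Submission
  imports Defs
begin

text \<open>A graded version of Nakayama's lemma shows that a projective BDF module \<open>F\<close> is graded free: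
  choose minimal homogeneous generators of \<open>F\<close> modulo the product of \<open>F\<close> with the maximal graded
  ideal of \<open>R\<close>, and let \<open>p : P \<rightarrow> F\<close> be the corresponding surjection from a graded free module. As
  \<open>F\<close> is projective, the kernel of \<open>p\<close> is a direct summand of \<open>P\<close>, and as the generators are
  minimal, it is contained in the product of \<open>P\<close> with the maximal graded ideal; so it vanishes, by
  induction along the order given by \<open>Q\<close>. If \<open>m\<close> counts the generators of \<open>F\<close> by degree, then the
  Hilbert series of \<open>F\<close> is \<open>m\<close> times that of \<open>R\<close>, so the \<open>K\<close>-series of \<open>F\<close> is \<open>m\<close>. Thus the
  isomorphism classes correspond to the series with nonnegative coefficients, direct sums to sums,
  and every series is a difference of two nonnegative ones.\<close>

section \<open>The ring of series\<close>

text \<open>The section that projectivity provides is merely \<open>R\<close>-linear and need not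
  respect degrees, so the kernel of \<open>p\<close> does not come as a graded summand. The way
  around is to compare components: for \<open>z\<close> of degree \<open>g\<close> in the kernel,
  the projection built from the section fixes \<open>z\<close>, and in degree \<open>g\<close> its
  expansion involves only the degree \<open>d x\<close> parts of the projected basis vectors
  \<open>x\<close> with nonzero coefficient. Minimality of the generators rules out
  \<open>d x = g\<close>, so these parts are kernel elements of strictly smaller degree. The order
  on the whole group need not be well-founded. Each induction therefore follows a downward finite
  set of degrees: the support of \<open>F\<close> for surjectivity of \<open>p\<close>, the degrees
  of the generators for injectivity. Lower bounds enter with the product of series, where combined
  with downward finiteness they leave finitely many ways to split a degree between two supports.
  Since the series of a module determines its isomorphism class, classes are renamed by series and
  the completion is computed inside the additive group of series.\<close>

definition admissible :: "'g::ab_group_add set \<Rightarrow> 'g set \<Rightarrow> bool" where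
  "admissible Q U \<longleftrightarrow> downward_finite Q U \<and> finitely_bounded_below Q U"

text \<open>Applied with \<open>Q = Supp R\<close>, where closure under addition comes from
  \<open>R\<close> being a domain. Membership \<open>h - g \<in> Q\<close> serves as the order
  \<open>g \<le> h\<close> throughout.\<close>

locale pointed_monoid =
  fixes Q :: "'g::ab_group_add set"
  assumes zero_mem: "0 \<in> Q"
    and add_mem: "p \<in> Q \<Longrightarrow> q \<in> Q \<Longrightarrow> p + q \<in> Q"
    and pointed: "pointed Q"
    and downward_finite: "downward_finite Q Q"
begin

lemma minus_mem_trans: "h - g \<in> Q \<Longrightarrow> k - h \<in> Q \<Longrightarrow> k - g \<in> Q"
  using add_mem[of "h - g" "k - h"] by (simp add: algebra_simps)

lemma antisym: "h - g \<in> Q \<Longrightarrow> g - h \<in> Q \<Longrightarrow> g = h"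
  using pointed unfolding pointed_def by (drule_tac x = "h - g" in bspec) (auto dest: bspec[where x = "g - h"])

lemma admissible_subset: "admissible Q A \<Longrightarrow> B \<subseteq> A \<Longrightarrow> admissible Q B"
  unfolding admissible_def downward_finite_def finitely_bounded_below_def
  by (auto intro: rev_finite_subset) (meson subsetD)

lemma admissible_Un:
  assumes "admissible Q A" "admissible Q B"
  shows "admissible Q (A \<union> B)"
proof -
  have "{u \<in> A \<union> B. le_monoid Q u g} = {u \<in> A. le_monoid Q u g} \<union> {u \<in> B. le_monoid Q u g}" for g
    by auto
  moreover have "finitely_bounded_below Q (A \<union> B)"
    using assms unfolding admissible_def finitely_bounded_below_def
    by (metis Un_iff finite_Un)
  ultimately show ?thesis
    using assms by (simp add: admissible_def downward_finite_def)
qed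

lemma admissible_finite:
  assumes "finite A"
  shows "admissible Q A"
proof -
  have "\<exists>p\<in>A. le_monoid Q p u" if "u \<in> A" for u
    using that zero_mem by (intro bexI[of _ u]) (simp_all add: le_monoid_def)
  then show ?thesis
    using assms by (auto simp: admissible_def downward_finite_def finitely_bounded_below_def)
qed

lemma admissible_monoid: "admissible Q Q"
proof -
  have "\<exists>p\<in>{0}. le_monoid Q p u" if "u \<in> Q" for u using that by (simp add: le_monoid_def)
  then show ?thesis
    using downward_finite unfolding admissible_def finitely_bounded_below_def by blast
qed

lemma finite_interval:
  assumes "admissible Q A"
  shows "finite {g \<in> A. u - g \<in> Q}"
  using assms by (simp add: admissible_def downward_finite_def le_monoid_def)

text \<open>Each \<open>h\<close> in \<open>B\<close> lies above one of the finitely many lower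
  bounds \<open>p\<close> of \<open>B\<close>, so \<open>g + h \<le> u\<close> forces
  \<open>g \<le> u - p\<close>, and downward finiteness of \<open>A\<close> leaves finitely many
  \<open>g\<close> for each \<open>p\<close>.\<close>

lemma finite_below:
  assumes A: "admissible Q A" and B: "admissible Q B"
  shows "finite {g \<in> A. \<exists>h\<in>B. u - (g + h) \<in> Q}"
proof -
  obtain P where P: "finite P" "\<And>h. h \<in> B \<Longrightarrow> \<exists>p\<in>P. h - p \<in> Q"
    using B by (auto simp: admissible_def finitely_bounded_below_def le_monoid_def)
  have "{g \<in> A. \<exists>h\<in>B. u - (g + h) \<in> Q} \<subseteq> (\<Union>p\<in>P. {g \<in> A. (u - p) - g \<in> Q})"
  proof (clarsimp)
    fix g h assume "h \<in> B" and *: "u - (g + h) \<in> Q"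
    then obtain p where p: "p \<in> P" "h - p \<in> Q" using P(2) by blast
    then have "(u - p) - g \<in> Q" using add_mem[OF * p(2)] by (simp add: algebra_simps)
    then show "\<exists>p\<in>P. u - p - g \<in> Q" using p(1) by blast
  qed
  then show ?thesis
    by (rule finite_subset) (use P(1) finite_interval[OF A] in auto)
qed

text \<open>The case \<open>u = g + h\<close> of \<open>finite_below\<close>. It makes the
  coefficients of a product of series finite sums.\<close>

lemma finite_decompositions:
  assumes A: "admissible Q A" and B: "admissible Q B"
  shows "finite {g \<in> A. u - g \<in> B}"
proof (rule finite_subset[OF _ finite_below[OF A B, of u]])
  show "{g \<in> A. u - g \<in> B} \<subseteq> {g \<in> A. \<exists>h\<in>B. u - (g + h) \<in> Q}"
  proof clarify
    fix g assume "u - g \<in> B"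
    moreover have "u - (g + (u - g)) \<in> Q" using zero_mem by simp
    ultimately show "\<exists>h\<in>B. u - (g + h) \<in> Q" by blast
  qed
qed

text \<open>Sums of lower bounds of \<open>A\<close> and \<open>B\<close> bound the sumset from
  below. For downward finiteness, \<open>g + h \<le> v\<close> confines \<open>g\<close> and
  \<open>h\<close> separately to finite sets, by \<open>finite_below\<close> with the two roles
  exchanged.\<close>

lemma admissible_sum:
  assumes A: "admissible Q A" and B: "admissible Q B"
  shows "admissible Q {g + h |g h. g \<in> A \<and> h \<in> B}"
proof -
  let ?S = "{g + h |g h. g \<in> A \<and> h \<in> B}"
  have 1: "finite {u \<in> ?S. le_monoid Q u v}" for v
  proof -
    let ?G = "{g \<in> A. \<exists>h\<in>B. v - (g + h) \<in> Q}" and ?H = "{h \<in> B. \<exists>g\<in>A. v - (h + g) \<in> Q}"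
    have "{u \<in> ?S. le_monoid Q u v} \<subseteq> (\<lambda>(g, h). g + h) ` (?G \<times> ?H)"
    proof
      fix u assume "u \<in> {u \<in> ?S. le_monoid Q u v}"
      then obtain g h where gh: "u = g + h" "g \<in> A" "h \<in> B" "v - (g + h) \<in> Q"
        by (auto simp: le_monoid_def)
      then have "(g, h) \<in> ?G \<times> ?H" by (auto simp: add.commute[of h])
      then show "u \<in> (\<lambda>(g, h). g + h) ` (?G \<times> ?H)" using gh(1) by force
    qed
    moreover have "finite (?G \<times> ?H)" using finite_below[OF A B] finite_below[OF B A] by simp
    ultimately show ?thesis by (rule finite_subset[OF _ finite_imageI])
  qed
  obtain P where P: "finite P" "\<And>h. h \<in> A \<Longrightarrow> \<exists>p\<in>P. h - p \<in> Q"
    using A by (auto simp: admissible_def finitely_bounded_below_def le_monoid_def)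
  obtain P' where P': "finite P'" "\<And>h. h \<in> B \<Longrightarrow> \<exists>p\<in>P'. h - p \<in> Q"
    using B by (auto simp: admissible_def finitely_bounded_below_def le_monoid_def)
  have 2: "\<exists>p\<in>(\<lambda>(p, q). p + q) ` (P \<times> P'). le_monoid Q p u" if u: "u \<in> ?S" for u
  proof -
    obtain g h where gh: "u = g + h" "g \<in> A" "h \<in> B" using u by blast
    obtain p q where pq: "p \<in> P" "g - p \<in> Q" "q \<in> P'" "h - q \<in> Q"
      using P(2)[OF gh(2)] P'(2)[OF gh(3)] by blast
    have "u - (p + q) \<in> Q" using add_mem[OF pq(2,4)] gh(1) by (simp add: algebra_simps)
    then show ?thesis using pq by (force simp: le_monoid_def)
  qed
  have 3: "finite ((\<lambda>(p, q). p + q) ` (P \<times> P'))" using P(1) P'(1) by simp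
  show ?thesis
    unfolding admissible_def downward_finite_def finitely_bounded_below_def
    by (intro conjI allI 1 exI[of _ "(\<lambda>(p, q). p + q) ` (P \<times> P')"] 3 ballI 2)
qed

section \<open>Convolution of series\<close>

abbreviation S where "S \<equiv> series_ring Q"

lemma S_carrier: "a \<in> carrier S \<longleftrightarrow> admissible Q {g. a g \<noteq> 0}"
  by (simp add: series_ring_def admissible_def)

lemma S_add: "a \<oplus>\<^bsub>S\<^esub> b = (\<lambda>g. a g + b g)"
  by (simp add: series_ring_def)

text \<open>The product in \<open>series_ring\<close> sums over the pairs with nonzero product of
  coefficients, a set that depends on both series. Any finite \<open>G\<close> containing the
  relevant first entries serves as well, so iterated products can be brought over common index
  sets.\<close>

lemma S_mult_eq:
  assumes "finite G" "\<And>g. a g \<noteq> 0 \<Longrightarrow> b (u - g) \<noteq> 0 \<Longrightarrow> g \<in> G"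
  shows "(a \<otimes>\<^bsub>S\<^esub> b) u = (\<Sum>g\<in>G. a g * b (u - g))"
proof -
  let ?G = "{g. a g \<noteq> 0 \<and> b (u - g) \<noteq> 0}"
  have "(a \<otimes>\<^bsub>S\<^esub> b) u = (\<Sum>(g, h)\<in>{(g, h). g + h = u \<and> a g * b h \<noteq> 0}. a g * b h)"
    by (simp add: series_ring_def)
  also have "\<dots> = (\<Sum>g\<in>?G. a g * b (u - g))"
    by (rule sum.reindex_bij_witness[where i = "\<lambda>g. (g, u - g)" and j = fst])
      (auto simp: algebra_simps)
  also have "\<dots> = (\<Sum>g\<in>G. a g * b (u - g))"
    by (rule sum.mono_neutral_left) (use assms in auto)
  finally show ?thesis .
qed

lemma S_mult_nonzero:
  assumes "(a \<otimes>\<^bsub>S\<^esub> b) u \<noteq> 0"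
  shows "\<exists>g h. u = g + h \<and> a g \<noteq> 0 \<and> b h \<noteq> 0"
proof (rule ccontr)
  assume "\<not> ?thesis"
  then have "g \<in> {}" if "a g \<noteq> 0" "b (u - g) \<noteq> 0" for g
    using that by (metis add.commute diff_add_cancel)
  then have "(a \<otimes>\<^bsub>S\<^esub> b) u = (\<Sum>g\<in>{}. a g * b (u - g))" by (intro S_mult_eq) simp_all
  then show False using assms by simp
qed

lemma S_mult_closed:
  assumes "a \<in> carrier S" "b \<in> carrier S"
  shows "a \<otimes>\<^bsub>S\<^esub> b \<in> carrier S"
  unfolding S_carrier
  by (rule admissible_subset[OF admissible_sum[OF assms[unfolded S_carrier]]])
    (use S_mult_nonzero in blast)

lemma S_mult_comm: "a \<otimes>\<^bsub>S\<^esub> b = b \<otimes>\<^bsub>S\<^esub> a"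
proof
  fix u
  show "(a \<otimes>\<^bsub>S\<^esub> b) u = (b \<otimes>\<^bsub>S\<^esub> a) u"
    unfolding series_ring_def monoid.simps
    by (rule sum.reindex_bij_witness[where i = "\<lambda>(g, h). (h, g)" and j = "\<lambda>(g, h). (h, g)"])
      (auto simp: add.commute mult.commute)
qed

text \<open>Exchanging the first two factors is symmetric in \<open>a\<close> and \<open>b\<close>:
  both sides become the same double sum up to the order of summation. With commutativity this yields
  associativity.\<close>

lemma S_mult_left_comm:
  assumes a: "a \<in> carrier S" and b: "b \<in> carrier S" and c: "c \<in> carrier S"
  shows "a \<otimes>\<^bsub>S\<^esub> (b \<otimes>\<^bsub>S\<^esub> c) = b \<otimes>\<^bsub>S\<^esub> (a \<otimes>\<^bsub>S\<^esub> c)"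
proof
  fix u
  define N where "N a = {g. a g \<noteq> 0}" for a :: "'g \<Rightarrow> int"
  note adm = a[unfolded S_carrier, folded N_def] b[unfolded S_carrier, folded N_def]
    c[unfolded S_carrier, folded N_def]
  \<comment> \<open>\<open>G\<close> and \<open>H\<close> hold the exponents of \<open>a\<close> and
    \<open>b\<close> that can occur in a nonzero triple product of total degree \<open>u\<close>;
    each is finite as an instance of \<open>finite_decompositions\<close>.\<close>
  define G where "G = {g \<in> N a. u - g \<in> {g + h |g h. g \<in> N b \<and> h \<in> N c}}"
  define H where "H = {g \<in> N b. u - g \<in> {g + h |g h. g \<in> N a \<and> h \<in> N c}}"
  have G: "finite G" unfolding G_def by (intro finite_decompositions admissible_sum adm)
  have H: "finite H" unfolding H_def by (intro finite_decompositions admissible_sum adm)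
  have GH: "g \<in> G \<and> h \<in> H" if "a g \<noteq> 0" "b h \<noteq> 0" "c (u - g - h) \<noteq> 0" for g h
  proof -
    have "u - g = h + (u - g - h)" "u - h = g + (u - g - h)" by (simp_all add: algebra_simps)
    then show ?thesis using that unfolding G_def H_def N_def by blast
  qed
  have "(a \<otimes>\<^bsub>S\<^esub> (b \<otimes>\<^bsub>S\<^esub> c)) u = (\<Sum>g\<in>G. a g * (b \<otimes>\<^bsub>S\<^esub> c) (u - g))"
    by (rule S_mult_eq[OF G]) (use S_mult_nonzero in \<open>auto simp: G_def N_def\<close>)
  also have "\<dots> = (\<Sum>g\<in>G. \<Sum>h\<in>H. a g * b h * c (u - g - h))"
  proof (rule sum.cong[OF refl])
    fix g assume "g \<in> G"
    then have "a g \<noteq> 0" by (simp add: G_def N_def)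
    then have "(b \<otimes>\<^bsub>S\<^esub> c) (u - g) = (\<Sum>h\<in>H. b h * c (u - g - h))"
      using GH by (intro S_mult_eq H) auto
    then show "a g * (b \<otimes>\<^bsub>S\<^esub> c) (u - g) = (\<Sum>h\<in>H. a g * b h * c (u - g - h))"
      by (simp add: sum_distrib_left mult.assoc)
  qed
  also have "\<dots> = (\<Sum>h\<in>H. \<Sum>g\<in>G. b h * a g * c (u - h - g))"
    by (subst sum.swap) (simp add: mult.commute diff_right_commute)
  also have "\<dots> = (\<Sum>h\<in>H. b h * (a \<otimes>\<^bsub>S\<^esub> c) (u - h))"
  proof (rule sum.cong[OF refl])
    fix h assume "h \<in> H"
    then have "b h \<noteq> 0" by (simp add: H_def N_def)
    then have "(a \<otimes>\<^bsub>S\<^esub> c) (u - h) = (\<Sum>g\<in>G. a g * c (u - h - g))"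
      using GH by (intro S_mult_eq G) (auto simp: diff_right_commute[of u h])
    then show "(\<Sum>g\<in>G. b h * a g * c (u - h - g)) = b h * (a \<otimes>\<^bsub>S\<^esub> c) (u - h)"
      by (simp add: sum_distrib_left mult.assoc)
  qed
  also have "\<dots> = (b \<otimes>\<^bsub>S\<^esub> (a \<otimes>\<^bsub>S\<^esub> c)) u"
    by (rule S_mult_eq[OF H, symmetric]) (use S_mult_nonzero in \<open>auto simp: H_def N_def\<close>)
  finally show "(a \<otimes>\<^bsub>S\<^esub> (b \<otimes>\<^bsub>S\<^esub> c)) u = (b \<otimes>\<^bsub>S\<^esub> (a \<otimes>\<^bsub>S\<^esub> c)) u" .
qed

lemma S_mult_assoc:
  assumes "a \<in> carrier S" "b \<in> carrier S" "c \<in> carrier S"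
  shows "(a \<otimes>\<^bsub>S\<^esub> b) \<otimes>\<^bsub>S\<^esub> c = a \<otimes>\<^bsub>S\<^esub> (b \<otimes>\<^bsub>S\<^esub> c)"
  using S_mult_left_comm[OF assms(3,1,2)] by (simp only: S_mult_comm[of _ c])

lemma S_one_mult: "\<one>\<^bsub>S\<^esub> \<otimes>\<^bsub>S\<^esub> a = a"
proof
  fix u
  have "(\<one>\<^bsub>S\<^esub> \<otimes>\<^bsub>S\<^esub> a) u = (\<Sum>g\<in>{0}. \<one>\<^bsub>S\<^esub> g * a (u - g))"
    by (rule S_mult_eq) (auto simp: series_ring_def split: if_splits)
  then show "(\<one>\<^bsub>S\<^esub> \<otimes>\<^bsub>S\<^esub> a) u = a u" by (simp add: series_ring_def)
qed

lemma S_one_closed: "\<one>\<^bsub>S\<^esub> \<in> carrier S"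
  unfolding S_carrier by (rule admissible_finite) (simp add: series_ring_def)

sublocale S: comm_monoid S
  by (rule comm_monoidI)
    (auto simp: S_mult_closed S_one_closed S_one_mult S_mult_comm[of _ "\<one>\<^bsub>S\<^esub>"]
       S_mult_assoc intro: S_mult_comm)

lemma S_add_closed:
  assumes "a \<in> carrier S" "b \<in> carrier S"
  shows "a \<oplus>\<^bsub>S\<^esub> b \<in> carrier S"
  unfolding S_carrier S_add
  by (rule admissible_subset[OF admissible_Un[OF assms[unfolded S_carrier]]]) auto

lemma S_zero_closed: "\<zero>\<^bsub>S\<^esub> \<in> carrier S"
  unfolding S_carrier by (rule admissible_finite) (simp add: series_ring_def)

lemma S_add_group: "comm_group (add_monoid S)"
proof (rule comm_groupI)
  fix a assume "a \<in> carrier (add_monoid S)"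
  then have "(\<lambda>g. - a g) \<in> carrier (add_monoid S)" by (simp add: S_carrier)
  then show "\<exists>b\<in>carrier (add_monoid S). b \<otimes>\<^bsub>add_monoid S\<^esub> a = \<one>\<^bsub>add_monoid S\<^esub>"
    by (rule bexI[rotated]) (simp add: series_ring_def)
qed (simp_all add: S_add_closed S_zero_closed, simp_all add: series_ring_def ac_simps)

text \<open>The inverse of a series with constant term 1 and support in \<open>Q\<close> is given by the usual
  recursion, along the strict order on \<open>Q\<close>, which is well-founded since \<open>Q\<close> is downward
  finite.\<close>

lemma wf_strict: "wf {(k, g). k \<in> Q \<and> g \<in> Q \<and> g - k \<in> Q \<and> k \<noteq> g}"
proof (rule wf_subset)
  \<comment> \<open>The number of elements of \<open>Q\<close> below \<open>g\<close>, with
    \<open>g\<close> counted: passing to \<open>k\<close> strictly below \<open>g\<close> loses at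
    least \<open>g\<close> itself.\<close>
  let ?m = "\<lambda>g. card {k \<in> Q. g - k \<in> Q}"
  show "{(k, g). k \<in> Q \<and> g \<in> Q \<and> g - k \<in> Q \<and> k \<noteq> g} \<subseteq> measure ?m"
  proof clarify
    fix k g assume kg: "k \<in> Q" "g \<in> Q" "g - k \<in> Q" "k \<noteq> g"
    have "{j \<in> Q. k - j \<in> Q} \<subseteq> {j \<in> Q. g - j \<in> Q}" using kg minus_mem_trans by blast
    moreover have "g \<notin> {j \<in> Q. k - j \<in> Q}" using kg antisym by blast
    moreover have "g \<in> {j \<in> Q. g - j \<in> Q}" using kg zero_mem by simp
    ultimately have "{j \<in> Q. k - j \<in> Q} \<subset> {j \<in> Q. g - j \<in> Q}" by blast
    then show "(k, g) \<in> measure ?m"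
      using psubset_card_mono[OF finite_interval[OF admissible_monoid]] by simp
  qed
qed simp

lemma S_unit:
  assumes a0: "a 0 = 1" and aQ: "\<And>g. a g \<noteq> 0 \<Longrightarrow> g \<in> Q"
  shows "a \<in> Units S"
proof -
  have a: "a \<in> carrier S"
    unfolding S_carrier by (rule admissible_subset[OF admissible_monoid]) (use aQ in auto)
  let ?r = "{(k, g). k \<in> Q \<and> g \<in> Q \<and> g - k \<in> Q \<and> k \<noteq> g}"
  let ?I = "\<lambda>g. {k \<in> Q. g - k \<in> Q \<and> k \<noteq> g}"
  \<comment> \<open>Obtained from the vanishing of the coefficient of the product at
    \<open>g \<noteq> 0\<close>, solved for \<open>b g\<close>, whose factor there is
    \<open>a 0 = 1\<close>.\<close>
  define F where "F f g = (if g = 0 then 1 else if g \<notin> Q then 0 else - (\<Sum>k\<in>?I g. a (g - k) * f k))"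
    for f :: "'g \<Rightarrow> int" and g
  define b where "b = wfrec ?r F"
  have b: "b g = F b g" for g
  proof -
    have "b g = F (cut b ?r g) g" unfolding b_def by (rule wfrec[OF wf_strict])
    \<comment> \<open>\<open>F\<close> reads its argument only at indices strictly below
      \<open>g\<close>, so cutting \<open>b\<close> off at \<open>g\<close> changes nothing.\<close>
    also have "\<dots> = F b g"
    proof (cases "g \<in> Q")
      case True
      then have "(\<Sum>k\<in>?I g. a (g - k) * cut b ?r g k) = (\<Sum>k\<in>?I g. a (g - k) * b k)"
        by (intro sum.cong refl) (simp add: cut_def)
      then show ?thesis by (simp only: F_def)
    qed (simp add: F_def)
    finally show ?thesis .
  qed
  have bQ: "b g \<noteq> 0 \<Longrightarrow> g \<in> Q" for g
    using zero_mem by (subst (asm) b) (auto simp: F_def split: if_splits)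
  have bS: "b \<in> carrier S"
    unfolding S_carrier by (rule admissible_subset[OF admissible_monoid]) (use bQ in auto)
  have "b \<otimes>\<^bsub>S\<^esub> a = \<one>\<^bsub>S\<^esub>"
  proof
    fix g
    let ?J = "{k \<in> Q. g - k \<in> Q}"
    have fin: "finite ?J" by (rule finite_interval[OF admissible_monoid])
    have ba: "(b \<otimes>\<^bsub>S\<^esub> a) g = (\<Sum>k\<in>?J. b k * a (g - k))"
      by (rule S_mult_eq[OF fin]) (use aQ bQ in auto)
    show "(b \<otimes>\<^bsub>S\<^esub> a) g = \<one>\<^bsub>S\<^esub> g"
    proof (cases "g \<in> Q")
      case False
      then have "?J = {}" using add_mem by force
      then have "(b \<otimes>\<^bsub>S\<^esub> a) g = 0" by (simp only: ba sum.empty)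
      then show ?thesis using False zero_mem by (auto simp: series_ring_def)
    next
      case True
      \<comment> \<open>The term \<open>k = g\<close> is split off. The remaining sum is what the
        recursion subtracts; for \<open>g = 0\<close> it is empty.\<close>
      have J: "?J = insert g (?I g)" using True zero_mem by auto
      have "(\<Sum>k\<in>?J. b k * a (g - k)) = b g + (\<Sum>k\<in>?I g. b k * a (g - k))"
        using fin unfolding J by (subst sum.insert) (auto simp: a0)
      moreover have "b g = F b g" by (rule b)
      moreover have "?I 0 = {}" using antisym[of _ 0] by force
      ultimately show ?thesis
        using True unfolding ba
        by (cases "g = 0") (simp_all only: sum.empty, simp_all add: F_def series_ring_def mult.commute)
    qed
  qed
  then show ?thesis using a bS S_mult_comm by (auto simp: Units_def)
qed

end

section \<open>Bases and dimensions\<close>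

text \<open>Additive maps of monoids need not preserve zero, so this is assumed separately. It also
  settles infinite index sets, where both sums are zero by convention.\<close>

lemma finsum_additive_map:
  assumes "abelian_monoid G" "abelian_monoid H" "q \<in> carrier G \<rightarrow> carrier H"
    and "q \<zero>\<^bsub>G\<^esub> = \<zero>\<^bsub>H\<^esub>"
    and "\<And>x y. x \<in> carrier G \<Longrightarrow> y \<in> carrier G \<Longrightarrow> q (x \<oplus>\<^bsub>G\<^esub> y) = q x \<oplus>\<^bsub>H\<^esub> q y"
    and "f \<in> A \<rightarrow> carrier G"
  shows "q (\<Oplus>\<^bsub>G\<^esub>i\<in>A. f i) = (\<Oplus>\<^bsub>H\<^esub>i\<in>A. q (f i))"
proof -
  interpret G: abelian_monoid G by fact
  interpret H: abelian_monoid H by fact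
  from assms(6) show ?thesis
  proof (induction A rule: infinite_finite_induct)
    case (insert a A)
    then have f: "f \<in> A \<rightarrow> carrier G" "f a \<in> carrier G" by auto
    moreover have "(\<lambda>i. q (f i)) \<in> A \<rightarrow> carrier H" "q (f a) \<in> carrier H"
      using f assms(3) by auto
    ultimately show ?case
      using insert.hyps insert.IH[OF f(1)] assms(5)[OF f(2) G.finsum_closed[OF f(1)]]
      by (simp add: G.finsum_insert H.finsum_insert)
  qed (simp_all add: assms(4) G.finsum_infinite H.finsum_infinite)
qed

lemma (in abelian_monoid) finsum_swap:
  assumes "finite A" "finite B" "\<And>i j. i \<in> A \<Longrightarrow> j \<in> B \<Longrightarrow> f i j \<in> carrier G"
  shows "(\<Oplus>i\<in>A. \<Oplus>j\<in>B. f i j) = (\<Oplus>j\<in>B. \<Oplus>i\<in>A. f i j)"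
  using assms(1,3)
proof (induction A rule: finite_induct)
  case empty
  then show ?case by simp
next
  case (insert a A)
  then have "(\<Oplus>i\<in>insert a A. \<Oplus>j\<in>B. f i j) = (\<Oplus>j\<in>B. f a j) \<oplus> (\<Oplus>j\<in>B. \<Oplus>i\<in>A. f i j)"
    by (subst finsum_insert) (auto intro!: finsum_closed)
  also have "\<dots> = (\<Oplus>j\<in>B. f a j \<oplus> (\<Oplus>i\<in>A. f i j))"
    by (rule finsum_addf[symmetric]) (use insert.prems in \<open>auto intro!: finsum_closed\<close>)
  also have "\<dots> = (\<Oplus>j\<in>B. \<Oplus>i\<in>insert a A. f i j)"
  proof (rule finsum_cong'[OF refl])
    fix j assume j: "j \<in> B"
    show "f a j \<oplus> (\<Oplus>i\<in>A. f i j) = (\<Oplus>i\<in>insert a A. f i j)"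
      by (rule finsum_insert[symmetric]) (use insert j in auto)
  qed (use insert.prems in \<open>auto intro!: finsum_closed\<close>)
  finally show ?case .
qed

text \<open>Gaussian elimination without division: a nonzero pivot in row \<open>i\<^sub>0\<close>
  removes its unknown from the other rows by cross-multiplication, and the domain property keeps the
  back-substituted solution nonzero.\<close>

lemma (in domain) homogeneous_solution:
  assumes "finite I" "finite J" "card I < card J" "\<And>i j. i \<in> I \<Longrightarrow> j \<in> J \<Longrightarrow> a i j \<in> carrier R"
  shows "\<exists>c. c \<in> J \<rightarrow> carrier R \<and> (\<exists>j\<in>J. c j \<noteq> \<zero>) \<and> (\<forall>i\<in>I. (\<Oplus>j\<in>J. a i j \<otimes> c j) = \<zero>)"
  using assms
proof (induction I arbitrary: J a rule: finite_induct)
  case empty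
  then obtain j where "j \<in> J" by fastforce
  then show ?case by (intro exI[of _ "\<lambda>_. \<one>"]) auto
next
  case (insert i\<^sub>0 I)
  have a: "a i j \<in> carrier R" if "i \<in> insert i\<^sub>0 I" "j \<in> J" for i j using insert.prems that by blast
  show ?case
  proof (cases "\<forall>j\<in>J. a i\<^sub>0 j = \<zero>")
    case True
    have "card I < card J" using insert.prems(2) insert.hyps by simp
    then obtain c where c: "c \<in> J \<rightarrow> carrier R" "\<exists>j\<in>J. c j \<noteq> \<zero>"
        "\<forall>i\<in>I. (\<Oplus>j\<in>J. a i j \<otimes> c j) = \<zero>"
      using insert.IH[OF insert.prems(1), of a] a by auto
    have "(\<Oplus>j\<in>J. a i\<^sub>0 j \<otimes> c j) = \<zero>"
      by (rule add.finprod_one_eqI) (use True c(1) in \<open>auto simp: Pi_iff\<close>)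
    then show ?thesis using c by auto
  next
    case False
    then obtain k where k: "k \<in> J" "a i\<^sub>0 k \<noteq> \<zero>" by blast
    let ?J = "J - {k}"
    \<comment> \<open>Row \<open>i\<close> scaled by the pivot minus row \<open>i\<^sub>0\<close>
      scaled by the entry of row \<open>i\<close> in column \<open>k\<close>, so that column
      \<open>k\<close> cancels.\<close>
    let ?b = "\<lambda>i j. a i\<^sub>0 k \<otimes> a i j \<oplus> (\<ominus> (a i k \<otimes> a i\<^sub>0 j))"
    have "card I < card ?J" using insert.prems(1,2) insert.hyps k by simp
    then have "\<exists>c. c \<in> ?J \<rightarrow> carrier R \<and> (\<exists>j\<in>?J. c j \<noteq> \<zero>) \<and>
        (\<forall>i\<in>I. (\<Oplus>j\<in>?J. ?b i j \<otimes> c j) = \<zero>)"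
      by (intro insert.IH) (use insert.prems(1) a k in auto)
    then obtain c where c: "c \<in> ?J \<rightarrow> carrier R" "\<exists>j\<in>?J. c j \<noteq> \<zero>"
        "\<And>i. i \<in> I \<Longrightarrow> (\<Oplus>j\<in>?J. ?b i j \<otimes> c j) = \<zero>"
      by blast
    define s where "s = (\<Oplus>j\<in>?J. a i\<^sub>0 j \<otimes> c j)"
    have cJ: "c j \<in> carrier R" if "j \<in> ?J" for j using c(1) that by blast
    have s: "s \<in> carrier R" unfolding s_def by (rule finsum_closed) (use a cJ in auto)
    \<comment> \<open>Back-substitution: scaling the other unknowns by the pivot lets
      \<open>\<ominus> s\<close> solve row \<open>i\<^sub>0\<close> for the unknown \<open>k\<close>
      without division.\<close>
    define d where "d j = (if j = k then \<ominus> s else a i\<^sub>0 k \<otimes> c j)" for j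
    have dJ: "d \<in> J \<rightarrow> carrier R" using cJ s a k by (auto simp: d_def)
    have row: "(\<Oplus>j\<in>J. a i j \<otimes> d j) = a i k \<otimes> (\<ominus> s) \<oplus> a i\<^sub>0 k \<otimes> (\<Oplus>j\<in>?J. a i j \<otimes> c j)"
      if i: "i \<in> insert i\<^sub>0 I" for i
    proof -
      have "(\<Oplus>j\<in>J. a i j \<otimes> d j) = (\<Oplus>j\<in>insert k ?J. a i j \<otimes> d j)"
        using k by (simp add: insert_absorb)
      also have "\<dots> = a i k \<otimes> d k \<oplus> (\<Oplus>j\<in>?J. a i j \<otimes> d j)"
        by (rule finsum_insert) (use insert.prems(1) dJ a[OF i] k in auto)
      also have "(\<Oplus>j\<in>?J. a i j \<otimes> d j) = (\<Oplus>j\<in>?J. a i\<^sub>0 k \<otimes> (a i j \<otimes> c j))"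
        by (rule finsum_cong') (use a i k cJ in \<open>auto simp: d_def m_lcomm\<close>)
      also have "\<dots> = a i\<^sub>0 k \<otimes> (\<Oplus>j\<in>?J. a i j \<otimes> c j)"
        by (rule finsum_rdistr[symmetric]) (use insert.prems(1) a i k cJ in auto)
      finally show ?thesis by (simp add: d_def)
    qed
    have "(\<Oplus>j\<in>J. a i\<^sub>0 j \<otimes> d j) = \<zero>"
      using row[of i\<^sub>0] a k s by (simp add: s_def[symmetric] r_minus l_neg)
    moreover have "(\<Oplus>j\<in>J. a i j \<otimes> d j) = \<zero>" if i: "i \<in> I" for i
    proof -
      have "\<zero> = (\<Oplus>j\<in>?J. a i\<^sub>0 k \<otimes> (a i j \<otimes> c j) \<oplus> (\<ominus> a i k) \<otimes> (a i\<^sub>0 j \<otimes> c j))"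
        unfolding c(3)[OF i, symmetric]
        by (rule finsum_cong') (use a i k cJ in \<open>auto simp: l_distr m_assoc l_minus\<close>)
      also have "\<dots> = (\<Oplus>j\<in>?J. a i\<^sub>0 k \<otimes> (a i j \<otimes> c j)) \<oplus> (\<Oplus>j\<in>?J. (\<ominus> a i k) \<otimes> (a i\<^sub>0 j \<otimes> c j))"
        by (rule finsum_addf) (use a i k cJ in auto)
      also have "(\<Oplus>j\<in>?J. a i\<^sub>0 k \<otimes> (a i j \<otimes> c j)) = a i\<^sub>0 k \<otimes> (\<Oplus>j\<in>?J. a i j \<otimes> c j)"
        by (rule finsum_rdistr[symmetric]) (use insert.prems(1) a i k cJ in auto)
      also have "(\<Oplus>j\<in>?J. (\<ominus> a i k) \<otimes> (a i\<^sub>0 j \<otimes> c j)) = (\<ominus> a i k) \<otimes> s"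
        unfolding s_def
        by (rule finsum_rdistr[symmetric]) (use insert.prems(1) a i k cJ in auto)
      also have "(\<ominus> a i k) \<otimes> s = a i k \<otimes> (\<ominus> s)"
        using a i k s by (simp add: l_minus r_minus)
      also have "a i\<^sub>0 k \<otimes> (\<Oplus>j\<in>?J. a i j \<otimes> c j) \<oplus> a i k \<otimes> (\<ominus> s) = (\<Oplus>j\<in>J. a i j \<otimes> d j)"
        unfolding row[OF insertI2[OF i]]
        by (rule a_comm) (use a i k s cJ in \<open>auto intro!: m_closed finsum_closed\<close>)
      finally show ?thesis by simp
    qed
    moreover have "\<exists>j\<in>J. d j \<noteq> \<zero>"
      using c(2) k a cJ by (auto simp: d_def integral_iff)
    ultimately show ?thesis using dJ by auto
  qed
qed

text \<open>Bases as families, so that no injectivity has to be tracked.\<close>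

definition basis_family ::
  "('k, 'x) ring_scheme \<Rightarrow> ('k, 'm, 'y) module_scheme \<Rightarrow> 'm set \<Rightarrow> ('i \<Rightarrow> 'm) \<Rightarrow> 'i set \<Rightarrow> bool" where
  "basis_family K V W e I \<longleftrightarrow>
     finite I \<and> e \<in> I \<rightarrow> W \<and>
     (\<forall>w\<in>W. \<exists>!c. c \<in> I \<rightarrow>\<^sub>E carrier K \<and> w = (\<Oplus>\<^bsub>V\<^esub>i\<in>I. c i \<odot>\<^bsub>V\<^esub> e i))"

lemma finite_basis_eq_family: "finite_basis K V W B \<longleftrightarrow> basis_family K V W (\<lambda>b. b) B"
  by (auto simp: finite_basis_def basis_family_def)

lemma submodule_finsum_closed:
  assumes "module R M" "submodule H R M" "f \<in> A \<rightarrow> H"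
  shows "(\<Oplus>\<^bsub>M\<^esub>i\<in>A. f i) \<in> H"
proof -
  interpret M: module R M by fact
  interpret H: submodule H R M by fact
  have sub: "H \<subseteq> carrier M" using M.submoduleE[OF assms(2)] by auto
  have zero: "\<zero>\<^bsub>M\<^esub> \<in> H" using H.one_closed by simp
  from assms(3) show ?thesis
  proof (induction A rule: infinite_finite_induct)
    case (insert a A)
    then have "f \<in> A \<rightarrow> carrier M" "f a \<in> carrier M" using sub by auto
    then show ?case
      using insert M.submoduleE(5)[OF assms(2)] by (simp add: M.finsum_insert Pi_iff)
  qed (simp_all add: zero M.finsum_infinite)
qed

text \<open>Graded pieces are handled as subsets of the whole module, with its operations, since
  \<open>finite_basis\<close> and \<open>dim_over\<close> take them in this form.\<close>

locale vector_subspace = module K V + K: field K for K (structure) and V (structure) +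
  fixes W
  assumes W: "submodule W K V"
begin

lemma W_subset: "w \<in> W \<Longrightarrow> w \<in> carrier V"
  using submoduleE(1)[OF W] by blast

abbreviation combination :: "('i \<Rightarrow> 'c) \<Rightarrow> 'i set \<Rightarrow> ('i \<Rightarrow> 'a) \<Rightarrow> 'c" where
  "combination e I c \<equiv> \<Oplus>\<^bsub>V\<^esub>i\<in>I. c i \<odot>\<^bsub>V\<^esub> e i"

lemma combination_closed:
  assumes "e \<in> I \<rightarrow> W" "c \<in> I \<rightarrow> carrier K"
  shows "combination e I c \<in> W"
  by (rule submodule_finsum_closed[OF _ W]) (use assms submoduleE(4)[OF W] module_axioms in auto)

lemma basis_familyD:
  assumes "basis_family K V W e I"
  shows basis_family_finite: "finite I" and basis_family_mem: "i \<in> I \<Longrightarrow> e i \<in> W"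
    and basis_family_spans: "w \<in> W \<Longrightarrow> \<exists>c. c \<in> I \<rightarrow> carrier K \<and> w = combination e I c"
proof -
  show "finite I" "i \<in> I \<Longrightarrow> e i \<in> W" using assms by (auto simp: basis_family_def)
  assume "w \<in> W"
  then obtain c where "c \<in> I \<rightarrow>\<^sub>E carrier K" "w = combination e I c"
    using assms unfolding basis_family_def by blast
  then show "\<exists>c. c \<in> I \<rightarrow> carrier K \<and> w = combination e I c"
    by (intro exI[of _ c]) (simp add: PiE_def)
qed

text \<open>The uniqueness in \<open>basis_family\<close> concerns functions that are extensional on
  \<open>I\<close>, so both coefficient functions are restricted to \<open>I\<close> before they are
  compared.\<close>

lemma basis_family_eqD:
  assumes e: "basis_family K V W e I" and c: "c \<in> I \<rightarrow> carrier K" and d: "d \<in> I \<rightarrow> carrier K"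
    and eq: "combination e I c = combination e I d" and i: "i \<in> I"
  shows "c i = d i"
proof -
  let ?w = "\<Oplus>\<^bsub>V\<^esub>i\<in>I. c i \<odot>\<^bsub>V\<^esub> e i"
  have eI: "e i \<in> carrier V" if "i \<in> I" for i
    using e that W_subset by (auto simp: basis_family_def)
  have restr: "combination e I (restrict c I) = combination e I c"
    if "c \<in> I \<rightarrow> carrier K" for c
    by (rule M.finsum_cong') (use that eI in auto)
  have "?w \<in> W" by (rule combination_closed) (use e c in \<open>auto simp: basis_family_def\<close>)
  then have "\<exists>!c. c \<in> I \<rightarrow>\<^sub>E carrier K \<and> ?w = combination e I c"
    using e by (simp add: basis_family_def)
  moreover have "restrict c I \<in> I \<rightarrow>\<^sub>E carrier K \<and> ?w = combination e I (restrict c I)"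
    using restr[OF c] c by simp
  moreover have "restrict d I \<in> I \<rightarrow>\<^sub>E carrier K \<and> ?w = combination e I (restrict d I)"
    using restr[OF d] d eq by simp
  ultimately have "restrict c I = restrict d I" by blast
  then show ?thesis using i by (metis restrict_apply')
qed

lemma basis_familyI:
  assumes fin: "finite I" and e: "\<And>i. i \<in> I \<Longrightarrow> e i \<in> W"
    and span: "\<And>w. w \<in> W \<Longrightarrow> \<exists>c. c \<in> I \<rightarrow> carrier K \<and> w = combination e I c"
    and indep: "\<And>c i. c \<in> I \<rightarrow> carrier K \<Longrightarrow> combination e I c = \<zero>\<^bsub>V\<^esub> \<Longrightarrow> i \<in> I \<Longrightarrow> c i = \<zero>"
  shows "basis_family K V W e I"
  unfolding basis_family_def
proof (intro conjI ballI)
  fix w assume w: "w \<in> W"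
  have eI: "e i \<in> carrier V" if "i \<in> I" for i using e[OF that] W_subset by blast
  obtain c where c: "c \<in> I \<rightarrow> carrier K" "w = combination e I c" using span[OF w] by blast
  show "\<exists>!c. c \<in> I \<rightarrow>\<^sub>E carrier K \<and> w = combination e I c"
  proof (rule ex1I[of _ "restrict c I"])
    have "combination e I (restrict c I) = w"
      unfolding c(2) by (rule M.finsum_cong') (use c eI in auto)
    then show "restrict c I \<in> I \<rightarrow>\<^sub>E carrier K \<and> w = combination e I (restrict c I)"
      using c(1) by simp
  next
    \<comment> \<open>Two expansions of \<open>w\<close> are subtracted; \<open>indep\<close> then
      applies to the coefficients \<open>d i \<oplus> (\<ominus> c i)\<close>.\<close>
    fix d assume d: "d \<in> I \<rightarrow>\<^sub>E carrier K \<and> w = combination e I d"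
    have dc: "d i \<in> carrier K" "c i \<in> carrier K" if "i \<in> I" for i using d c that by auto
    have "(\<Oplus>\<^bsub>V\<^esub>i\<in>I. (d i \<oplus> (\<ominus> c i)) \<odot>\<^bsub>V\<^esub> e i)
        = (\<Oplus>\<^bsub>V\<^esub>i\<in>I. d i \<odot>\<^bsub>V\<^esub> e i \<oplus>\<^bsub>V\<^esub> (\<ominus> \<one>) \<odot>\<^bsub>V\<^esub> (c i \<odot>\<^bsub>V\<^esub> e i))"
      by (rule M.finsum_cong') (use dc eI in \<open>auto simp: smult_l_distr smult_l_minus\<close>)
    also have "\<dots> = combination e I d \<oplus>\<^bsub>V\<^esub> (\<Oplus>\<^bsub>V\<^esub>i\<in>I. (\<ominus> \<one>) \<odot>\<^bsub>V\<^esub> (c i \<odot>\<^bsub>V\<^esub> e i))"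
      by (rule M.finsum_addf) (use dc eI in auto)
    also have "(\<Oplus>\<^bsub>V\<^esub>i\<in>I. (\<ominus> \<one>) \<odot>\<^bsub>V\<^esub> (c i \<odot>\<^bsub>V\<^esub> e i)) = (\<ominus> \<one>) \<odot>\<^bsub>V\<^esub> w"
      unfolding c(2) by (rule finsum_smult_ldistr[symmetric]) (use fin dc eI in auto)
    also have "combination e I d \<oplus>\<^bsub>V\<^esub> (\<ominus> \<one>) \<odot>\<^bsub>V\<^esub> w = \<zero>\<^bsub>V\<^esub>"
      using d W_subset[OF w] by (simp add: smult_l_minus M.r_neg)
    finally have z: "(\<Oplus>\<^bsub>V\<^esub>i\<in>I. (d i \<oplus> (\<ominus> c i)) \<odot>\<^bsub>V\<^esub> e i) = \<zero>\<^bsub>V\<^esub>" .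
    have "d i = c i" if i: "i \<in> I" for i
    proof -
      have "d i \<oplus> (\<ominus> c i) = \<zero>"
        by (rule indep[of "\<lambda>i. d i \<oplus> (\<ominus> c i)", OF _ z i]) (use dc in auto)
      then show ?thesis using dc[OF i] by (metis R.add.inv_closed R.add.inv_inv R.minus_equality)
    qed
    then show "d = restrict c I" using d by (auto simp: PiE_def extensional_def)
  qed
qed (use fin e in auto)

text \<open>Expanding each \<open>e' j\<close> in \<open>e\<close> gives a system with one equation
  per element of \<open>I\<close> and one unknown per element of \<open>J\<close>. If
  \<open>J\<close> were larger, a nonzero solution would be a nontrivial relation among the
  \<open>e' j\<close>.\<close>

lemma basis_family_card_le:
  assumes e: "basis_family K V W e I" and e': "basis_family K V W e' J"
  shows "card J \<le> card I"
proof (rule ccontr)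
  assume "\<not> card J \<le> card I"
  then have less: "card I < card J" by simp
  have "\<forall>j\<in>J. \<exists>c. c \<in> I \<rightarrow> carrier K \<and> e' j = combination e I c"
    using basis_family_spans[OF e] basis_family_mem[OF e'] by blast
  then obtain a where a: "\<And>j. j \<in> J \<Longrightarrow> a j \<in> I \<rightarrow> carrier K"
      "\<And>j. j \<in> J \<Longrightarrow> e' j = (\<Oplus>\<^bsub>V\<^esub>i\<in>I. a j i \<odot>\<^bsub>V\<^esub> e i)"
    by metis
  have aIJ: "a j i \<in> carrier K" if "j \<in> J" "i \<in> I" for i j using a(1) that by blast
  have fin: "finite I" "finite J" using basis_family_finite e e' by blast+
  have eI: "e i \<in> carrier V" if "i \<in> I" for i using basis_family_mem[OF e that] W_subset by blast
  have eJ: "e' i \<in> carrier V" if "i \<in> J" for i using basis_family_mem[OF e' that] W_subset by blast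
  obtain c where c: "c \<in> J \<rightarrow> carrier K" "\<exists>j\<in>J. c j \<noteq> \<zero>"
      "\<forall>i\<in>I. (\<Oplus>\<^bsub>K\<^esub>j\<in>J. a j i \<otimes> c j) = \<zero>"
    using K.homogeneous_solution[OF fin less, of "\<lambda>i j. a j i"] aIJ by blast
  have cJ: "c j \<in> carrier K" if "j \<in> J" for j using c(1) that by blast
  have "combination e' J c = (\<Oplus>\<^bsub>V\<^esub>j\<in>J. \<Oplus>\<^bsub>V\<^esub>i\<in>I. (a j i \<otimes> c j) \<odot>\<^bsub>V\<^esub> e i)"
  proof (rule M.finsum_cong'[OF refl])
    fix j assume j: "j \<in> J"
    have "c j \<odot>\<^bsub>V\<^esub> e' j = (\<Oplus>\<^bsub>V\<^esub>i\<in>I. c j \<odot>\<^bsub>V\<^esub> (a j i \<odot>\<^bsub>V\<^esub> e i))"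
      unfolding a(2)[OF j] by (rule finsum_smult_ldistr) (use fin cJ aIJ eI j in auto)
    also have "\<dots> = (\<Oplus>\<^bsub>V\<^esub>i\<in>I. (a j i \<otimes> c j) \<odot>\<^bsub>V\<^esub> e i)"
    proof (rule M.finsum_cong'[OF refl])
      fix i assume i: "i \<in> I"
      show "c j \<odot>\<^bsub>V\<^esub> (a j i \<odot>\<^bsub>V\<^esub> e i) = (a j i \<otimes> c j) \<odot>\<^bsub>V\<^esub> e i"
        using smult_assoc1[OF cJ[OF j] aIJ[OF j i] eI[OF i]]
        by (simp add: R.m_comm[OF aIJ[OF j i] cJ[OF j]])
    qed (use cJ aIJ eI j in auto)
    finally show "c j \<odot>\<^bsub>V\<^esub> e' j = (\<Oplus>\<^bsub>V\<^esub>i\<in>I. (a j i \<otimes> c j) \<odot>\<^bsub>V\<^esub> e i)" .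
  qed (use cJ aIJ eI in \<open>auto intro!: M.finsum_closed\<close>)
  also have "\<dots> = (\<Oplus>\<^bsub>V\<^esub>i\<in>I. \<Oplus>\<^bsub>V\<^esub>j\<in>J. (a j i \<otimes> c j) \<odot>\<^bsub>V\<^esub> e i)"
    by (rule M.finsum_swap) (use fin cJ aIJ eI in auto)
  also have "\<dots> = \<zero>\<^bsub>V\<^esub>"
  proof (rule M.add.finprod_one_eqI)
    fix i assume i: "i \<in> I"
    have "(\<Oplus>\<^bsub>V\<^esub>j\<in>J. (a j i \<otimes> c j) \<odot>\<^bsub>V\<^esub> e i) = (\<Oplus>\<^bsub>K\<^esub>j\<in>J. a j i \<otimes> c j) \<odot>\<^bsub>V\<^esub> e i"
      by (rule finsum_additive_map[symmetric, where q = "\<lambda>k. k \<odot>\<^bsub>V\<^esub> e i"])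
        (use eI[OF i] aIJ[OF _ i] cJ in \<open>auto simp: smult_l_distr R.abelian_monoid_axioms M.abelian_monoid_axioms\<close>)
    then show "(\<Oplus>\<^bsub>V\<^esub>j\<in>J. (a j i \<otimes> c j) \<odot>\<^bsub>V\<^esub> e i) = \<zero>\<^bsub>V\<^esub>" using c(3) i eI[OF i] by simp
  qed
  also have "\<zero>\<^bsub>V\<^esub> = (\<Oplus>\<^bsub>V\<^esub>j\<in>J. \<zero> \<odot>\<^bsub>V\<^esub> e' j)"
    by (rule M.add.finprod_one_eqI[symmetric]) (use eJ in auto)
  finally have "\<forall>j\<in>J. c j = \<zero>" using basis_family_eqD[OF e' c(1), of "\<lambda>_. \<zero>"] by auto
  then show False using c(2) by blast
qed

lemma dim_over_finite_basis:
  assumes "finite_basis K V W B"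
  shows "dim_over K V W = card B"
  unfolding dim_over_def
proof (rule the_equality)
  fix n assume "\<exists>B. finite_basis K V W B \<and> card B = n"
  then obtain B' where "finite_basis K V W B'" "card B' = n" by blast
  then show "n = card B"
    using assms basis_family_card_le unfolding finite_basis_eq_family by (metis le_antisym)
qed (use assms in blast)

text \<open>If \<open>e i = e j\<close> with \<open>i \<noteq> j\<close>, this vector would have two
  coordinate functions, the unit vectors at \<open>i\<close> and \<open>j\<close>. So basis families
  are injective, which leads back from families to the set bases of
  \<open>finite_basis\<close>.\<close>

lemma finite_basis_of_family:
  assumes e: "basis_family K V W e I"
  shows "inj_on e I" and "finite_basis K V W (e ` I)"
proof -
  have fin: "finite I" by (rule basis_family_finite[OF e])
  have eI: "e i \<in> carrier V" if "i \<in> I" for i using basis_family_mem[OF e that] W_subset by blast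
  have delta: "(\<Oplus>\<^bsub>V\<^esub>k\<in>I. (if i = k then \<one> else \<zero>) \<odot>\<^bsub>V\<^esub> e k) = e i" if i: "i \<in> I" for i
  proof -
    have "(\<Oplus>\<^bsub>V\<^esub>k\<in>I. (if i = k then \<one> else \<zero>) \<odot>\<^bsub>V\<^esub> e k) = (\<Oplus>\<^bsub>V\<^esub>k\<in>I. if i = k then e k else \<zero>\<^bsub>V\<^esub>)"
      by (rule M.finsum_cong') (use eI in auto)
    also have "\<dots> = e i" by (rule M.finsum_singleton) (use i fin eI in auto)
    finally show ?thesis .
  qed
  show inj: "inj_on e I"
  proof (rule inj_onI, rule ccontr)
    fix i j assume ij: "i \<in> I" "j \<in> I" "e i = e j" "i \<noteq> j"
    have "(if i = i then \<one> else \<zero>) = (if j = i then \<one> else \<zero>)"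
      by (rule basis_family_eqD[OF e, of "\<lambda>k. if i = k then \<one> else \<zero>" "\<lambda>k. if j = k then \<one> else \<zero>"])
        (use ij delta in auto)
    then show False using ij(4) by simp
  qed
  have re: "(\<Oplus>\<^bsub>V\<^esub>b\<in>e ` I. c b \<odot>\<^bsub>V\<^esub> b) = (\<Oplus>\<^bsub>V\<^esub>i\<in>I. c (e i) \<odot>\<^bsub>V\<^esub> e i)" if "c \<in> e ` I \<rightarrow> carrier K" for c
    by (rule M.finsum_reindex[OF _ inj]) (use that eI in auto)
  show "finite_basis K V W (e ` I)"
    unfolding finite_basis_eq_family
  proof (rule basis_familyI)
    fix w assume "w \<in> W"
    then obtain c where c: "c \<in> I \<rightarrow> carrier K" "w = combination e I c"
      using basis_family_spans[OF e] by blast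
    let ?d = "\<lambda>b. c (inv_into I e b)"
    have d: "?d \<in> e ` I \<rightarrow> carrier K" using c(1) inj by auto
    have "(\<Oplus>\<^bsub>V\<^esub>b\<in>e ` I. ?d b \<odot>\<^bsub>V\<^esub> b) = w"
      unfolding re[OF d] c(2) by (rule M.finsum_cong') (use c(1) eI inj in auto)
    then show "\<exists>c. c \<in> e ` I \<rightarrow> carrier K \<and> w = (\<Oplus>\<^bsub>V\<^esub>b\<in>e ` I. c b \<odot>\<^bsub>V\<^esub> b)" using d by blast
  next
    fix c b assume c: "c \<in> e ` I \<rightarrow> carrier K" "(\<Oplus>\<^bsub>V\<^esub>b\<in>e ` I. c b \<odot>\<^bsub>V\<^esub> b) = \<zero>\<^bsub>V\<^esub>" and b: "b \<in> e ` I"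
    then obtain i where i: "i \<in> I" "b = e i" by blast
    have "(\<Oplus>\<^bsub>V\<^esub>j\<in>I. \<zero> \<odot>\<^bsub>V\<^esub> e j) = \<zero>\<^bsub>V\<^esub>"
      by (rule M.add.finprod_one_eqI) (use eI in auto)
    then have "c (e i) = \<zero>"
      using basis_family_eqD[OF e, of "\<lambda>i. c (e i)" "\<lambda>_. \<zero>" i] c re[OF c(1)] i by auto
    then show "c b = \<zero>" using i by simp
  qed (use fin basis_family_mem[OF e] in auto)
qed

lemma dim_over_family:
  assumes "basis_family K V W e I"
  shows "dim_over K V W = card I" and "finite_dim K V W"
  using finite_basis_of_family[OF assms] dim_over_finite_basis card_image
  unfolding finite_dim_def by metis+

end

lemma basis_family_transport:
  assumes V: "vector_subspace K V W" and V': "module K V'"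
    and f: "f \<in> linear_maps K V V'" "inj_on f (carrier V)" and e: "basis_family K V W e I"
  shows "basis_family K V' (f ` W) (\<lambda>i. f (e i)) I"
proof -
  interpret V: vector_subspace K V W by fact
  interpret V': module K V' by fact
  have eI: "e i \<in> carrier V" if "i \<in> I" for i
    using V.basis_family_mem[OF e that] V.W_subset by blast
  have comb: "f (\<Oplus>\<^bsub>V\<^esub>i\<in>I. c i \<odot>\<^bsub>V\<^esub> e i) = (\<Oplus>\<^bsub>V'\<^esub>i\<in>I. c i \<odot>\<^bsub>V'\<^esub> f (e i))" if c: "c \<in> I \<rightarrow> carrier K" for c
  proof -
    have "f (\<Oplus>\<^bsub>V\<^esub>i\<in>I. c i \<odot>\<^bsub>V\<^esub> e i) = (\<Oplus>\<^bsub>V'\<^esub>i\<in>I. f (c i \<odot>\<^bsub>V\<^esub> e i))"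
      by (rule linear_maps_finsum[OF V.module_axioms V' f(1) V.basis_family_finite[OF e]])
        (use c eI in auto)
    also have "\<dots> = (\<Oplus>\<^bsub>V'\<^esub>i\<in>I. c i \<odot>\<^bsub>V'\<^esub> f (e i))"
      by (rule V'.M.finsum_cong') (use c eI f(1) in \<open>auto simp: linear_maps_def Pi_iff\<close>)
    finally show ?thesis .
  qed
  have "\<exists>!c. c \<in> I \<rightarrow>\<^sub>E carrier K \<and> f w = (\<Oplus>\<^bsub>V'\<^esub>i\<in>I. c i \<odot>\<^bsub>V'\<^esub> f (e i))" if w: "w \<in> W" for w
  proof -
    have "c \<in> I \<rightarrow>\<^sub>E carrier K \<and> f w = (\<Oplus>\<^bsub>V'\<^esub>i\<in>I. c i \<odot>\<^bsub>V'\<^esub> f (e i)) \<longleftrightarrow>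
        c \<in> I \<rightarrow>\<^sub>E carrier K \<and> w = (\<Oplus>\<^bsub>V\<^esub>i\<in>I. c i \<odot>\<^bsub>V\<^esub> e i)" for c
    proof (cases "c \<in> I \<rightarrow>\<^sub>E carrier K")
      case True
      then have c: "c \<in> I \<rightarrow> carrier K" by (simp add: PiE_def)
      have "(\<Oplus>\<^bsub>V\<^esub>i\<in>I. c i \<odot>\<^bsub>V\<^esub> e i) \<in> W"
        by (rule V.combination_closed) (use c V.basis_family_mem[OF e] in auto)
      then show ?thesis
        using True w V.W_subset by (simp add: comb[OF c, symmetric] inj_on_eq_iff[OF f(2)])
    qed simp
    then show ?thesis using e w by (simp add: basis_family_def)
  qed
  then show ?thesis using e by (auto simp: basis_family_def)
qed

section \<open>Graded modules\<close>

definition decomposition :: "('a, 'm, 'g) gmodule \<Rightarrow> 'm \<Rightarrow> ('g \<Rightarrow> 'm) \<Rightarrow> bool" where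
  "decomposition M x f \<longleftrightarrow>
     (\<forall>g. f g \<in> grade M g) \<and> finite {g. f g \<noteq> \<zero>\<^bsub>M\<^esub>} \<and> x = (\<Oplus>\<^bsub>M\<^esub>g\<in>{g. f g \<noteq> \<zero>\<^bsub>M\<^esub>}. f g)"

definition component :: "('a, 'm, 'g) gmodule \<Rightarrow> 'm \<Rightarrow> 'g \<Rightarrow> 'm" where
  "component M x = (THE f. decomposition M x f)"

lemma (in abelian_group) finsum_minus:
  assumes "f \<in> A \<rightarrow> carrier G"
  shows "(\<Oplus>i\<in>A. \<ominus> f i) = \<ominus> (\<Oplus>i\<in>A. f i)"
  by (rule finsum_additive_map[symmetric])
    (use assms abelian_monoid_axioms in \<open>auto simp: minus_add\<close>)

text \<open>Isolates the part of \<open>graded_space\<close> in which no scalars occur, so that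
  components are available for \<open>R\<close> and for \<open>R\<close>-modules at once, without
  passing through \<open>restrict_scalars\<close>.\<close>

locale graded_group = abelian_group M for M :: "('a, 'm, 'g) gmodule" (structure) +
  assumes grade_subset: "x \<in> grade M g \<Longrightarrow> x \<in> carrier M"
    and grade_zero: "\<zero> \<in> grade M g"
    and decomposition: "x \<in> carrier M \<Longrightarrow> \<exists>!f. decomposition M x f"
begin

lemma component_decomposition: "x \<in> carrier M \<Longrightarrow> decomposition M x (component M x)"
  unfolding component_def by (rule theI'[OF decomposition])

lemma component_mem: "x \<in> carrier M \<Longrightarrow> component M x g \<in> grade M g"
  using component_decomposition by (simp add: decomposition_def)

lemma component_closed [simp]: "x \<in> carrier M \<Longrightarrow> component M x g \<in> carrier M"
  using component_mem grade_subset by blast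

lemma component_finite: "x \<in> carrier M \<Longrightarrow> finite {g. component M x g \<noteq> \<zero>}"
  using component_decomposition by (simp add: decomposition_def)

lemma component_sum:
  assumes "x \<in> carrier M" "finite A" "\<And>g. component M x g \<noteq> \<zero> \<Longrightarrow> g \<in> A"
  shows "(\<Oplus>g\<in>A. component M x g) = x"
proof -
  have "x = (\<Oplus>g\<in>{g. component M x g \<noteq> \<zero>}. component M x g)"
    using component_decomposition[OF assms(1)] by (simp add: decomposition_def)
  also have "\<dots> = (\<Oplus>g\<in>A. component M x g)"
    by (rule add.finprod_mono_neutral_cong_left) (use assms in auto)
  finally show ?thesis ..
qed

text \<open>The degree map \<open>d\<close> admits sums that are not indexed by their own degrees,
  such as the product of a decomposition with a homogeneous element, where all degrees are
  shifted.\<close>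

lemma component_eqI:
  assumes A: "finite A" "inj_on d A" and f: "\<And>h. h \<in> A \<Longrightarrow> f h \<in> grade M (d h)"
    and x: "x = (\<Oplus>h\<in>A. f h)"
  shows "h \<in> A \<Longrightarrow> component M x (d h) = f h" and "g \<notin> d ` A \<Longrightarrow> component M x g = \<zero>"
proof -
  define F where "F g = (if g \<in> d ` A then f (inv_into A d g) else \<zero>)" for g
  have Fd: "F (d h) = f h" if "h \<in> A" for h using that A(2) by (simp add: F_def)
  have Fg: "F g \<in> grade M g" for g
    using f A(2) grade_zero by (auto simp: F_def)
  have fc: "f h \<in> carrier M" if "h \<in> A" for h using f[OF that] grade_subset by blast
  have sub: "{g. F g \<noteq> \<zero>} \<subseteq> d ` A" by (auto simp: F_def)
  have "(\<Oplus>g\<in>{g. F g \<noteq> \<zero>}. F g) = (\<Oplus>g\<in>d ` A. F g)"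
    by (rule add.finprod_mono_neutral_cong_left) (use A sub Fg grade_subset in auto)
  also have "\<dots> = (\<Oplus>h\<in>A. F (d h))"
    by (rule finsum_reindex) (use A Fg grade_subset in auto)
  also have "\<dots> = x" unfolding x by (rule finsum_cong') (use Fd fc in auto)
  finally have "decomposition M x F"
    using Fg finite_subset[OF sub] A by (simp add: decomposition_def)
  moreover have "x \<in> carrier M" unfolding x by (rule finsum_closed) (use fc in auto)
  ultimately have "component M x = F"
    using component_decomposition decomposition by blast
  then show "h \<in> A \<Longrightarrow> component M x (d h) = f h" "g \<notin> d ` A \<Longrightarrow> component M x g = \<zero>"
    using Fd by (auto simp: F_def)
qed

lemma component_zero: "component M \<zero> g = \<zero>"
  by (rule component_eqI(2)[of "{}" id "\<lambda>_. \<zero>"]) auto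

lemma grade_independent:
  assumes "finite A" "inj_on d A" "\<And>h. h \<in> A \<Longrightarrow> f h \<in> grade M (d h)"
    and "(\<Oplus>h\<in>A. f h) = \<zero>" "h \<in> A"
  shows "f h = \<zero>"
  using component_eqI(1)[OF assms(1-3) refl assms(5)] assms(4) by (simp add: component_zero)

lemma component_grade:
  assumes "x \<in> grade M g"
  shows "component M x g = x" and "h \<noteq> g \<Longrightarrow> component M x h = \<zero>"
proof -
  have x: "x = (\<Oplus>h\<in>{g}. x)"
    using finsum_insert[of "{}" g "\<lambda>_. x"] assms grade_subset by auto
  show "component M x g = x"
    by (rule component_eqI(1)[of "{g}" "\<lambda>g. g" "\<lambda>_. x" x g]) (use assms x in auto)
  show "h \<noteq> g \<Longrightarrow> component M x h = \<zero>"
    by (rule component_eqI(2)[of "{g}" "\<lambda>g. g" "\<lambda>_. x" x h]) (use assms x in auto)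
qed

end

text \<open>Existence of a decomposition is \<open>span\<close>. For uniqueness, two decompositions
  are subtracted over a common finite set and \<open>indep\<close> applies to the
  differences.\<close>

lemma graded_groupI:
  fixes M :: "('a, 'm, 'g) gmodule" (structure)
  assumes "abelian_group M"
    and sub: "\<And>g x. x \<in> grade M g \<Longrightarrow> x \<in> carrier M"
    and zero: "\<And>g. \<zero> \<in> grade M g"
    and diff: "\<And>g x y. x \<in> grade M g \<Longrightarrow> y \<in> grade M g \<Longrightarrow> x \<oplus> \<ominus> y \<in> grade M g"
    and span: "\<And>x. x \<in> carrier M \<Longrightarrow>
      \<exists>A f. finite A \<and> (\<forall>g\<in>A. f g \<in> grade M g) \<and> x = (\<Oplus>g\<in>A. f g)"
    and indep: "\<And>A f g. finite A \<Longrightarrow> (\<And>g. g \<in> A \<Longrightarrow> f g \<in> grade M g) \<Longrightarrow>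
      (\<Oplus>g\<in>A. f g) = \<zero> \<Longrightarrow> g \<in> A \<Longrightarrow> f g = \<zero>"
  shows "graded_group M"
proof -
  interpret abelian_group M by fact
  show ?thesis
  proof (unfold_locales)
    fix x assume x: "x \<in> carrier M"
    obtain A f where A: "finite A" "\<And>g. g \<in> A \<Longrightarrow> f g \<in> grade M g" "x = (\<Oplus>g\<in>A. f g)"
      using span[OF x] by blast
    define F where "F g = (if g \<in> A then f g else \<zero>)" for g
    have F: "F g \<in> grade M g" for g using A zero by (auto simp: F_def)
    have Fsub: "{g. F g \<noteq> \<zero>} \<subseteq> A" by (auto simp: F_def)
    have "(\<Oplus>g\<in>{g. F g \<noteq> \<zero>}. F g) = (\<Oplus>g\<in>A. f g)"
      by (rule add.finprod_mono_neutral_cong_left)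
        (use A sub Fsub in \<open>auto simp: F_def\<close>)
    then have dF: "decomposition M x F"
      using F A finite_subset[OF Fsub] by (simp add: decomposition_def)
    have "F = F'" if dF': "decomposition M x F'" for F'
    proof
      fix g
      \<comment> \<open>\<open>g\<close> is added by hand: it may lie in neither support, and the
        conclusion is wanted at \<open>g\<close>.\<close>
      let ?A = "{g. F g \<noteq> \<zero>} \<union> {g. F' g \<noteq> \<zero>} \<union> {g}"
      have fin: "finite ?A" using dF dF' by (simp add: decomposition_def)
      have F': "F' g \<in> grade M g" for g using dF' by (simp add: decomposition_def)
      have cl: "F g \<in> carrier M" "F' g \<in> carrier M" for g using F F' sub by blast+
      have xF: "(\<Oplus>g\<in>?A. F g) = x"
      proof -
        have "x = (\<Oplus>g\<in>{g. F g \<noteq> \<zero>}. F g)" using dF by (simp add: decomposition_def)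
        also have "\<dots> = (\<Oplus>g\<in>?A. F g)"
          by (rule add.finprod_mono_neutral_cong_left) (use fin cl in auto)
        finally show ?thesis ..
      qed
      have xF': "(\<Oplus>g\<in>?A. F' g) = x"
      proof -
        have "x = (\<Oplus>g\<in>{g. F' g \<noteq> \<zero>}. F' g)" using dF' by (simp add: decomposition_def)
        also have "\<dots> = (\<Oplus>g\<in>?A. F' g)"
          by (rule add.finprod_mono_neutral_cong_left) (use fin cl in auto)
        finally show ?thesis ..
      qed
      have "(\<Oplus>g\<in>?A. F g \<oplus> \<ominus> F' g) = (\<Oplus>g\<in>?A. F g) \<oplus> (\<Oplus>g\<in>?A. \<ominus> F' g)"
        by (rule finsum_addf) (use cl in auto)
      also have "(\<Oplus>g\<in>?A. \<ominus> F' g) = \<ominus> (\<Oplus>g\<in>?A. F' g)"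
        by (rule finsum_minus) (use cl in auto)
      finally have "(\<Oplus>g\<in>?A. F g \<oplus> \<ominus> F' g) = \<zero>" using x by (simp only: xF xF' r_neg)
      then have "F g \<oplus> \<ominus> F' g = \<zero>"
        by (rule indep[OF fin, rotated]) (use diff F F' in auto)
      then show "F g = F' g" using cl by (metis minus_equality minus_minus a_inv_closed)
    qed
    with dF show "\<exists>!f. decomposition M x f" by blast
  qed (use sub zero in auto)
qed

section \<open>Restriction of scalars\<close>

lemma restrict_scalars_simps [simp]:
  "carrier (restrict_scalars R M) = carrier M" "zero (restrict_scalars R M) = zero M"
  "add (restrict_scalars R M) = add M" "grade (restrict_scalars R M) = grade M"
  "smult (restrict_scalars R M) c x = smult M (smult R c (one R)) x"
  by (simp_all add: restrict_scalars_def)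

lemma abelian_group_restrict_scalars:
  assumes "abelian_group M"
  shows "abelian_group (restrict_scalars R M)"
proof -
  interpret abelian_group M by fact
  show ?thesis
    by (rule abelian_groupI) (auto simp: a_assoc intro: a_comm l_neg)
qed

lemma a_inv_restrict_scalars: "a_inv (restrict_scalars R M) = a_inv M"
  by (rule ext) (simp add: a_inv_def m_inv_def)

lemma finsum_restrict_scalars:
  assumes "abelian_group M" "f \<in> A \<rightarrow> carrier M"
  shows "finsum (restrict_scalars R M) f A = finsum M f A"
  by (rule finsum_additive_map[symmetric, where q = "\<lambda>x. x"])
    (use assms abelian_group_restrict_scalars abelian_group.axioms(1) in auto)

lemma decomposition_restrict_scalars:
  assumes "abelian_group M" "\<And>g x. x \<in> grade M g \<Longrightarrow> x \<in> carrier M"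
  shows "decomposition (restrict_scalars R M) x f \<longleftrightarrow> decomposition M x f"
proof (cases "\<forall>g. f g \<in> grade M g")
  case True
  then have "f \<in> {g. f g \<noteq> \<zero>\<^bsub>M\<^esub>} \<rightarrow> carrier M" using assms(2) by blast
  then show ?thesis by (simp add: decomposition_def finsum_restrict_scalars[OF assms(1)])
qed (auto simp: decomposition_def)

section \<open>PDCF algebras and their graded modules\<close>

locale pdcf_algebra =
  fixes K :: "('k, 'x) ring_scheme" and R :: "('k, 'r, 'g::ab_group_add) gmodule" (structure)
  assumes field_K: "field K" and graded_R: "graded_algebra K R" and domain_R: "domain R"
    and PDCF: "PDCF K R"
begin

sublocale K: field K by (rule field_K)

sublocale R: domain R by (rule domain_R)

lemma algebra_R: "algebra K R" and graded_space_R: "graded_space K R"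
  and grade_mult: "r \<in> grade R g \<Longrightarrow> s \<in> grade R h \<Longrightarrow> r \<otimes> s \<in> grade R (g + h)"
  using graded_R by (auto simp: graded_algebra_def)

sublocale KR: algebra K R by (rule algebra_R)

lemma module_KR: "module K R" by (rule KR.module)

lemma grade_R_submodule: "submodule (grade R g) K R"
  using graded_space_R by (simp add: graded_space_def)

sublocale GR: graded_group R
proof
  fix g x show "x \<in> grade R g \<Longrightarrow> x \<in> carrier R"
    using KR.submoduleE(1)[OF grade_R_submodule] by blast
  show "\<zero> \<in> grade R g"
    using subgroup.one_closed[OF submodule.axioms(1)[OF grade_R_submodule]] by simp
  show "x \<in> carrier R \<Longrightarrow> \<exists>!f. decomposition R x f"
    using graded_space_R by (simp add: graded_space_def decomposition_def)
qed

lemma grade_R_closed: "r \<in> grade R g \<Longrightarrow> r \<in> carrier R" by (rule GR.grade_subset)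

lemma grade_R_zero: "grade R 0 = (\<lambda>c. c \<odot> \<one>) ` carrier K"
  using PDCF by (simp add: PDCF_def)

lemma scalar_mem: "c \<in> carrier K \<Longrightarrow> c \<odot> \<one> \<in> grade R 0"
  by (simp add: grade_R_zero)

lemma one_mem: "\<one> \<in> grade R 0"
  using scalar_mem[OF K.one_closed] by simp

lemma minus_one_mem: "\<ominus> \<one> \<in> grade R 0"
  using KR.submoduleE(3)[OF grade_R_submodule one_mem] .

lemma Supp_R_mem: "r \<in> grade R g \<Longrightarrow> r \<noteq> \<zero> \<Longrightarrow> g \<in> Supp R"
  by (auto simp: Supp_def)

lemma Supp_RE:
  assumes "g \<in> Supp R"
  obtains r where "r \<in> grade R g" "r \<noteq> \<zero>"
  using assms GR.grade_zero by (auto simp: Supp_def)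

text \<open>The product of nonzero homogeneous elements of the domain \<open>R\<close> is nonzero
  and homogeneous of the sum degree, which gives closure under addition.\<close>

sublocale Q: pointed_monoid "Supp R"
proof
  show "0 \<in> Supp R" using one_mem by (rule Supp_R_mem) simp
  show "p + q \<in> Supp R" if "p \<in> Supp R" "q \<in> Supp R" for p q
  proof -
    obtain r s where "r \<in> grade R p" "r \<noteq> \<zero>" "s \<in> grade R q" "s \<noteq> \<zero>"
      using \<open>p \<in> Supp R\<close> \<open>q \<in> Supp R\<close> by (blast elim: Supp_RE)
    then show ?thesis
      using grade_mult Supp_R_mem R.integral GR.grade_subset by metis
  qed
  show "pointed (Supp R)" "downward_finite (Supp R) (Supp R)" using PDCF by (simp_all add: PDCF_def)
qed

text \<open>Multiplication by \<open>r\<close> turns the decomposition of \<open>x\<close> into that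
  of \<open>r \<otimes> x\<close>, with all degrees shifted by \<open>q\<close>. The degree
  \<open>g\<close> is put into the index set so that a vanishing component is covered too.\<close>

lemma component_mult:
  assumes r: "r \<in> grade R q" and x: "x \<in> carrier R"
  shows "component R (r \<otimes> x) (q + g) = r \<otimes> component R x g"
proof -
  let ?A = "insert g {h. component R x h \<noteq> \<zero>}"
  have fin: "finite ?A" using GR.component_finite[OF x] by simp
  have rc: "r \<in> carrier R" using r by (rule grade_R_closed)
  have "r \<otimes> x = r \<otimes> (\<Oplus>h\<in>?A. component R x h)"
    by (subst GR.component_sum) (use x fin in auto)
  also have "\<dots> = (\<Oplus>h\<in>?A. r \<otimes> component R x h)"
    by (rule R.finsum_rdistr) (use fin rc x in auto)
  finally show ?thesis
    by (intro GR.component_eqI(1)[of ?A "\<lambda>h. q + h"])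
      (use fin grade_mult[OF r] GR.component_mem[OF x] in auto)
qed

lemma module_restrict_scalars:
  assumes "module R M"
  shows "module K (restrict_scalars R M)"
proof -
  interpret M: module R M by fact
  have s: "c \<odot> \<one> \<in> carrier R" if "c \<in> carrier K" for c using that by simp
  have m: "(a \<otimes>\<^bsub>K\<^esub> b) \<odot> \<one> = (a \<odot> \<one>) \<otimes> (b \<odot> \<one>)"
    if "a \<in> carrier K" "b \<in> carrier K" for a b
    using that by (simp add: KR.smult_assoc1 KR.smult_assoc2)
  show ?thesis
  proof (rule moduleI)
    show "abelian_group (restrict_scalars R M)"
      by (rule abelian_group_restrict_scalars) (rule M.abelian_group_axioms)
  qed (auto simp: K.is_cring s m M.smult_l_distr M.smult_r_distr M.smult_assoc1 KR.smult_l_distr)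
qed

lemma graded_module_module: "graded_module K R M \<Longrightarrow> module R M"
  by (simp add: graded_module_def)

lemma graded_module_graded_group:
  assumes "graded_module K R M"
  shows "graded_group M"
proof -
  interpret M: module R M using assms by (rule graded_module_module)
  interpret KM: module K "restrict_scalars R M"
    by (rule module_restrict_scalars) (rule M.module_axioms)
  have sub: "submodule (grade M g) K (restrict_scalars R M)" for g
    using assms by (simp add: graded_module_def graded_space_def)
  show ?thesis
  proof
    fix g x
    show *: "x \<in> grade M g \<Longrightarrow> x \<in> carrier M" for g x
      using KM.submoduleE(1)[OF sub] by auto
    show "\<zero>\<^bsub>M\<^esub> \<in> grade M g"
      using subgroup.one_closed[OF submodule.axioms(1)[OF sub]] by simp
    assume x: "x \<in> carrier M"
    then have "\<exists>!f. decomposition (restrict_scalars R M) x f"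
      using assms unfolding graded_module_def graded_space_def decomposition_def by simp
    then show "\<exists>!f. decomposition M x f"
      using decomposition_restrict_scalars[OF M.abelian_group_axioms *, where R = R and x = x] by simp
  qed
qed

lemma graded_moduleD:
  assumes "graded_module K R M"
  shows graded_module_subset: "m \<in> grade M g \<Longrightarrow> m \<in> carrier M"
    and graded_module_zero: "\<zero>\<^bsub>M\<^esub> \<in> grade M g"
    and graded_module_smult: "r \<in> grade R h \<Longrightarrow> m \<in> grade M g \<Longrightarrow> r \<odot>\<^bsub>M\<^esub> m \<in> grade M (h + g)"
    and graded_module_submodule: "submodule (grade M g) K (restrict_scalars R M)"
    and graded_module_add: "m \<in> grade M g \<Longrightarrow> n \<in> grade M g \<Longrightarrow> m \<oplus>\<^bsub>M\<^esub> n \<in> grade M g"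
proof -
  interpret M: graded_group M using assms by (rule graded_module_graded_group)
  interpret KM: module K "restrict_scalars R M"
    by (rule module_restrict_scalars) (use assms in \<open>rule graded_module_module\<close>)
  show "m \<in> grade M g \<Longrightarrow> m \<in> carrier M" "\<zero>\<^bsub>M\<^esub> \<in> grade M g"
    by (simp_all add: M.grade_subset M.grade_zero)
  show "r \<in> grade R h \<Longrightarrow> m \<in> grade M g \<Longrightarrow> r \<odot>\<^bsub>M\<^esub> m \<in> grade M (h + g)"
    using assms by (simp add: graded_module_def)
  show sub: "submodule (grade M g) K (restrict_scalars R M)"
    using assms by (simp add: graded_module_def graded_space_def)
  show "m \<in> grade M g \<Longrightarrow> n \<in> grade M g \<Longrightarrow> m \<oplus>\<^bsub>M\<^esub> n \<in> grade M g"
    using KM.submoduleE(5)[OF sub] by simp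
qed

lemma graded_module_vector_subspace:
  assumes "graded_module K R M"
  shows "vector_subspace K (restrict_scalars R M) (grade M g)"
  using module_restrict_scalars[OF graded_module_module[OF assms]] field_K
    graded_module_submodule[OF assms]
  by (simp add: vector_subspace_def vector_subspace_axioms_def)

lemma grade_R_vector_subspace: "vector_subspace K R (grade R g)"
  using module_KR field_K grade_R_submodule
  by (simp add: vector_subspace_def vector_subspace_axioms_def)

text \<open>Multiplication by elements of degree 0 covers two closure properties of the graded
  pieces: negation, through \<open>\<ominus> \<one>\<close>, and scaling by \<open>K\<close>, whose
  image in \<open>R\<close> lies in \<open>grade R 0\<close>.\<close>

lemma graded_moduleI:
  assumes mod: "module R M"
    and sub: "\<And>g x. x \<in> grade M g \<Longrightarrow> x \<in> carrier M"
    and zero: "\<And>g. \<zero>\<^bsub>M\<^esub> \<in> grade M g"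
    and add: "\<And>g x y. x \<in> grade M g \<Longrightarrow> y \<in> grade M g \<Longrightarrow> x \<oplus>\<^bsub>M\<^esub> y \<in> grade M g"
    and smult: "\<And>g h r x. r \<in> grade R g \<Longrightarrow> x \<in> grade M h \<Longrightarrow> r \<odot>\<^bsub>M\<^esub> x \<in> grade M (g + h)"
    and span: "\<And>x. x \<in> carrier M \<Longrightarrow>
      \<exists>A f. finite A \<and> (\<forall>g\<in>A. f g \<in> grade M g) \<and> x = (\<Oplus>\<^bsub>M\<^esub>g\<in>A. f g)"
    and indep: "\<And>A f g. finite A \<Longrightarrow> (\<And>g. g \<in> A \<Longrightarrow> f g \<in> grade M g) \<Longrightarrow>
      (\<Oplus>\<^bsub>M\<^esub>g\<in>A. f g) = \<zero>\<^bsub>M\<^esub> \<Longrightarrow> g \<in> A \<Longrightarrow> f g = \<zero>\<^bsub>M\<^esub>"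
  shows "graded_module K R M"
proof -
  interpret M: module R M by fact
  interpret KM: module K "restrict_scalars R M"
    by (rule module_restrict_scalars) (rule M.module_axioms)
  have smult0: "r \<odot>\<^bsub>M\<^esub> x \<in> grade M g" if "r \<in> grade R 0" "x \<in> grade M g" for r x g
    using smult[OF that] by simp
  have minus: "\<ominus>\<^bsub>M\<^esub> x \<in> grade M g" if "x \<in> grade M g" for x g
    using smult0[OF minus_one_mem that] sub[OF that] by (simp add: M.smult_l_minus)
  have "submodule (grade M g) K (restrict_scalars R M)" for g
    by (rule KM.submoduleI)
      (use sub zero add minus smult0 scalar_mem in \<open>auto simp: a_inv_restrict_scalars\<close>)
  moreover have "graded_group M"
  proof (rule graded_groupI)
    show "x \<oplus>\<^bsub>M\<^esub> \<ominus>\<^bsub>M\<^esub> y \<in> grade M g" if "x \<in> grade M g" "y \<in> grade M g" for x y g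
      by (rule add[OF that(1) minus[OF that(2)]])
  qed (fact M.abelian_group_axioms sub zero span indep)+
  then have "\<exists>!f. decomposition M x f" if "x \<in> carrier M" for x
    using that by (rule graded_group.decomposition)
  then have "\<exists>!f. decomposition (restrict_scalars R M) x f" if "x \<in> carrier M" for x
    using that decomposition_restrict_scalars[OF M.abelian_group_axioms sub, where R = R and x = x]
    by simp
  ultimately show ?thesis
    using mod smult KM.module_axioms
    unfolding graded_module_def graded_space_def decomposition_def by simp
qed

end

subsection \<open>Graded isomorphisms\<close>

lemma linear_maps_zero:
  assumes "module R M" "module R N" "f \<in> linear_maps R M N"
  shows "f \<zero>\<^bsub>M\<^esub> = \<zero>\<^bsub>N\<^esub>"
  using linear_maps_finsum[OF assms, of "{}" "\<lambda>x. x"] assms(1,2)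
  by (simp add: module_def abelian_group_def abelian_monoid.finsum_empty)

lemma graded_isoE:
  assumes "graded_iso R M N"
  obtains f where "f \<in> linear_maps R M N" "bij_betw f (carrier M) (carrier N)"
    "\<And>g. f ` grade M g = grade N g"
  using assms by (auto simp: graded_iso_def)

lemma linear_maps_comp:
  "f \<in> linear_maps R M N \<Longrightarrow> f' \<in> linear_maps R N P \<Longrightarrow> (\<lambda>x. f' (f x)) \<in> linear_maps R M P"
  by (auto simp: linear_maps_def Pi_iff)

lemma graded_iso_trans:
  assumes "graded_iso R M N" "graded_iso R N P"
  shows "graded_iso R M P"
proof -
  obtain f where f: "f \<in> linear_maps R M N" "bij_betw f (carrier M) (carrier N)"
      "\<And>g. f ` grade M g = grade N g"
    using assms(1) by (rule graded_isoE) blast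
  obtain h where h: "h \<in> linear_maps R N P" "bij_betw h (carrier N) (carrier P)"
      "\<And>g. h ` grade N g = grade P g"
    using assms(2) by (rule graded_isoE) blast
  have "(\<lambda>x. h (f x)) ` grade M g = grade P g" for g
    using f(3) h(3) by (metis image_image)
  then show ?thesis
    unfolding graded_iso_def
    using linear_maps_comp[OF f(1) h(1)] bij_betw_trans[OF f(2) h(2)] by (auto simp: comp_def)
qed

lemma linear_maps_inv:
  assumes "module R M" "f \<in> linear_maps R M N" "bij_betw f (carrier M) (carrier N)"
  shows "inv_into (carrier M) f \<in> linear_maps R N M"
proof -
  interpret M: module R M by fact
  let ?h = "inv_into (carrier M) f"
  have hc: "?h y \<in> carrier M" "f (?h y) = y" if "y \<in> carrier N" for y
    using assms(3) that by (auto simp: bij_betw_def inv_into_into f_inv_into_f)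
  have hf: "?h (f x) = x" if "x \<in> carrier M" for x
    using assms(3) that by (simp add: bij_betw_def)
  have "?h (y \<oplus>\<^bsub>N\<^esub> z) = ?h y \<oplus>\<^bsub>M\<^esub> ?h z" if yz: "y \<in> carrier N" "z \<in> carrier N" for y z
  proof -
    have "f (?h y \<oplus>\<^bsub>M\<^esub> ?h z) = y \<oplus>\<^bsub>N\<^esub> z"
      using assms(2) hc yz by (simp add: linear_maps_def)
    then show ?thesis using hf[of "?h y \<oplus>\<^bsub>M\<^esub> ?h z"] hc yz by simp
  qed
  moreover have "?h (r \<odot>\<^bsub>N\<^esub> y) = r \<odot>\<^bsub>M\<^esub> ?h y" if ry: "r \<in> carrier R" "y \<in> carrier N" for r y
  proof -
    have "f (r \<odot>\<^bsub>M\<^esub> ?h y) = r \<odot>\<^bsub>N\<^esub> y"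
      using assms(2) hc ry by (simp add: linear_maps_def)
    then show ?thesis using hf[of "r \<odot>\<^bsub>M\<^esub> ?h y"] hc ry by simp
  qed
  ultimately show ?thesis using hc by (simp add: linear_maps_def)
qed

lemma graded_iso_sym:
  assumes "module R M" "\<And>g. grade M g \<subseteq> carrier M" "graded_iso R M N"
  shows "graded_iso R N M"
proof -
  obtain f where f: "f \<in> linear_maps R M N" "bij_betw f (carrier M) (carrier N)"
      "\<And>g. f ` grade M g = grade N g"
    using assms(3) by (rule graded_isoE) blast
  have "inv_into (carrier M) f ` grade N g = grade M g" for g
    unfolding f(3)[symmetric]
    using f(2) assms(2) by (intro inv_into_image_cancel) (auto simp: bij_betw_def)
  then show ?thesis
    unfolding graded_iso_def
    using linear_maps_inv[OF assms(1) f(1,2)] bij_betw_inv_into[OF f(2)] by blast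
qed

text \<open>The test modules for \<open>N\<close> have types built from that of \<open>N\<close>, so
  the lifting property of \<open>M\<close> is applied in the form \<open>projective_lift\<close>,
  which is valid for modules over all types.\<close>

lemma projective_transport:
  fixes R :: "('r, 'x) ring_scheme" and M :: "('r, 'm, 'y) module_scheme"
    and N :: "('r, 'n, 'z) module_scheme"
  assumes M: "module R M" "projective R M" and N: "module R N"
    and f: "f \<in> linear_maps R M N" "bij_betw f (carrier M) (carrier N)"
  shows "projective R N"
  unfolding projective_def
proof (intro allI impI, elim conjE)
  fix P P' q u
  assume P: "module R (P :: ('r, 'n \<Rightarrow> 'r) module)" "module R (P' :: ('r, 'n) module)"
    and q: "q \<in> linear_maps R P P'" "q ` carrier P = carrier P'" and u: "u \<in> linear_maps R N P'"
  let ?i = "inv_into (carrier M) f"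
  have i: "?i \<in> linear_maps R N M" by (rule linear_maps_inv[OF M(1) f])
  obtain h where h: "h \<in> linear_maps R M P" "\<And>x. x \<in> carrier M \<Longrightarrow> q (h x) = u (f x)"
    using projective_lift[OF M P q linear_maps_comp[OF f(1) u]] by blast
  have "q (h (?i y)) = u y" if y: "y \<in> carrier N" for y
    using h(2)[of "?i y"] f(2) y by (simp add: bij_betw_def inv_into_into f_inv_into_f)
  then show "\<exists>h\<in>linear_maps R N P. \<forall>x\<in>carrier N. q (h x) = u x"
    by (intro bexI[of _ "\<lambda>x. h (?i x)"] linear_maps_comp[OF i h(1)]) simp
qed

context pdcf_algebra
begin

lemma graded_iso_symmetric: "graded_module K R M \<Longrightarrow> graded_iso R M N \<Longrightarrow> graded_iso R N M"
  by (rule graded_iso_sym) (auto simp: graded_module_module graded_module_subset)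

text \<open>About \<open>N\<close> only the module axioms are given; its grading is validated
  through the isomorphism. This is how a copy of \<open>M\<close> over another type is recognized as
  a graded module.\<close>

lemma graded_module_transport:
  assumes M: "graded_module K R M" and N: "module R N" and iso: "graded_iso R M N"
  shows "graded_module K R N"
proof -
  obtain f where f: "f \<in> linear_maps R M N" "bij_betw f (carrier M) (carrier N)"
      "\<And>g. f ` grade M g = grade N g"
    using iso by (rule graded_isoE) blast
  interpret M: module R M using M by (rule graded_module_module)
  interpret GM: graded_group M using M by (rule graded_module_graded_group)
  interpret N: module R N by fact
  have f_add: "f (x \<oplus>\<^bsub>M\<^esub> y) = f x \<oplus>\<^bsub>N\<^esub> f y" if "x \<in> carrier M" "y \<in> carrier M" for x y
    using f(1) that by (simp add: linear_maps_def)
  have f_smult: "f (r \<odot>\<^bsub>M\<^esub> x) = r \<odot>\<^bsub>N\<^esub> f x" if "r \<in> carrier R" "x \<in> carrier M" for x r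
    using f(1) that by (simp add: linear_maps_def)
  have f_cl: "f x \<in> carrier N" if "x \<in> carrier M" for x
    using f(1) that by (auto simp: linear_maps_def)
  have f0: "f \<zero>\<^bsub>M\<^esub> = \<zero>\<^bsub>N\<^esub>" by (rule linear_maps_zero[OF M.module_axioms N f(1)])
  have fg: "\<exists>x\<in>grade M g. x \<in> carrier M \<and> y = f x" if "y \<in> grade N g" for y g
    using that f(3)[of g] GM.grade_subset by blast
  show ?thesis
  proof (rule graded_moduleI[OF N])
    show "y \<in> carrier N" if "y \<in> grade N g" for g y
      using fg[OF that] f_cl by auto
    show "\<zero>\<^bsub>N\<^esub> \<in> grade N g" for g
      using f(3)[of g] f0 GM.grade_zero[of g] by force
    show "x \<oplus>\<^bsub>N\<^esub> y \<in> grade N g" if x: "x \<in> grade N g" and y: "y \<in> grade N g" for x y g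
    proof -
      obtain x' y' where xy: "x' \<in> grade M g" "y' \<in> grade M g" "x = f x'" "y = f y'"
        using fg[OF x] fg[OF y] by blast
      then have "x \<oplus>\<^bsub>N\<^esub> y = f (x' \<oplus>\<^bsub>M\<^esub> y')" using f_add GM.grade_subset by simp
      also have "\<dots> \<in> grade N g"
        unfolding f(3)[symmetric] by (rule imageI) (rule graded_module_add[OF M xy(1,2)])
      finally show ?thesis .
    qed
    show "r \<odot>\<^bsub>N\<^esub> x \<in> grade N (g + h)" if r: "r \<in> grade R g" and x0: "x \<in> grade N h" for g h r x
    proof -
      obtain x' where x: "x' \<in> grade M h" "x' \<in> carrier M" "x = f x'" using fg[OF x0] by blast
      then have "r \<odot>\<^bsub>N\<^esub> x = f (r \<odot>\<^bsub>M\<^esub> x')" using f_smult grade_R_closed[OF r] by simp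
      also have "\<dots> \<in> grade N (g + h)"
        unfolding f(3)[symmetric] by (rule imageI) (rule graded_module_smult[OF M r x(1)])
      finally show ?thesis .
    qed
    show "\<exists>A u. finite A \<and> (\<forall>g\<in>A. u g \<in> grade N g) \<and> y = (\<Oplus>\<^bsub>N\<^esub>g\<in>A. u g)" if y: "y \<in> carrier N" for y
    proof -
      obtain x where x: "x \<in> carrier M" "y = f x" using y f(2) by (auto simp: bij_betw_def)
      let ?A = "{g. component M x g \<noteq> \<zero>\<^bsub>M\<^esub>}"
      have "y = f (\<Oplus>\<^bsub>M\<^esub>g\<in>?A. component M x g)"
        by (subst GM.component_sum) (use x GM.component_finite in auto)
      also have "\<dots> = (\<Oplus>\<^bsub>N\<^esub>g\<in>?A. f (component M x g))"
        by (rule linear_maps_finsum[OF M.module_axioms N f(1)])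
          (use x GM.component_finite in auto)
      finally show ?thesis
        using GM.component_finite[OF x(1)] GM.component_mem[OF x(1)] f(3)
        by (intro exI[of _ ?A] exI[of _ "\<lambda>g. f (component M x g)"]) blast
    qed
    show "u g = \<zero>\<^bsub>N\<^esub>" if A: "finite A" and u: "\<And>g. g \<in> A \<Longrightarrow> u g \<in> grade N g"
      and s: "(\<Oplus>\<^bsub>N\<^esub>g\<in>A. u g) = \<zero>\<^bsub>N\<^esub>" and g: "g \<in> A" for A u g
    proof -
      have "\<forall>g\<in>A. \<exists>x\<in>grade M g. x \<in> carrier M \<and> u g = f x" using fg u by blast
      then obtain v where v: "\<And>g. g \<in> A \<Longrightarrow> v g \<in> grade M g" "\<And>g. g \<in> A \<Longrightarrow> v g \<in> carrier M"
          "\<And>g. g \<in> A \<Longrightarrow> u g = f (v g)"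
        by metis
      have "f (\<Oplus>\<^bsub>M\<^esub>g\<in>A. v g) = (\<Oplus>\<^bsub>N\<^esub>g\<in>A. f (v g))"
        by (rule linear_maps_finsum[OF M.module_axioms N f(1) A]) (use v in auto)
      also have "\<dots> = (\<Oplus>\<^bsub>N\<^esub>g\<in>A. u g)"
        by (rule N.M.finsum_cong') (use v f_cl in auto)
      finally have "f (\<Oplus>\<^bsub>M\<^esub>g\<in>A. v g) = f \<zero>\<^bsub>M\<^esub>" using s f0 by simp
      moreover have "(\<Oplus>\<^bsub>M\<^esub>g\<in>A. v g) \<in> carrier M" by (rule M.finsum_closed) (use v in auto)
      ultimately have "(\<Oplus>\<^bsub>M\<^esub>g\<in>A. v g) = \<zero>\<^bsub>M\<^esub>"
        using f(2) M.M.zero_closed unfolding bij_betw_def inj_on_def by blast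
      then have "v g = \<zero>\<^bsub>M\<^esub>"
        by (rule GM.grade_independent[OF A, where d = "\<lambda>g. g", rotated 2]) (use v g in auto)
      then show "u g = \<zero>\<^bsub>N\<^esub>" using v(3)[OF g] f0 by simp
    qed
  qed
qed

lemma linear_maps_restrict_scalars:
  assumes "f \<in> linear_maps R M N"
  shows "f \<in> linear_maps K (restrict_scalars R M) (restrict_scalars R N)"
  using assms by (auto simp: linear_maps_def)

lemma graded_iso_dim:
  assumes M: "graded_module K R M" and N: "module R N" and iso: "graded_iso R M N"
    and fin: "finite_dim K (restrict_scalars R M) (grade M g)"
  shows "finite_dim K (restrict_scalars R N) (grade N g)"
    and "dim_over K (restrict_scalars R N) (grade N g) = dim_over K (restrict_scalars R M) (grade M g)"
proof -
  obtain f where f: "f \<in> linear_maps R M N" "bij_betw f (carrier M) (carrier N)"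
      "\<And>g. f ` grade M g = grade N g"
    using iso by (rule graded_isoE) blast
  have VM: "vector_subspace K (restrict_scalars R M) (grade M g)"
    by (rule graded_module_vector_subspace[OF M])
  have VN: "vector_subspace K (restrict_scalars R N) (grade N g)"
    by (rule graded_module_vector_subspace) (rule graded_module_transport[OF M N iso])
  obtain B where B: "finite_basis K (restrict_scalars R M) (grade M g) B"
    using fin by (auto simp: finite_dim_def)
  have "basis_family K (restrict_scalars R N) (f ` grade M g) (\<lambda>b. f b) B"
    by (rule basis_family_transport[OF VM module_restrict_scalars[OF N]
          linear_maps_restrict_scalars[OF f(1)]])
      (use f(2) B finite_basis_eq_family in \<open>auto simp: bij_betw_def\<close>)
  then have "basis_family K (restrict_scalars R N) (grade N g) (\<lambda>b. f b) B" by (simp add: f(3))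
  then show "finite_dim K (restrict_scalars R N) (grade N g)"
    "dim_over K (restrict_scalars R N) (grade N g) = dim_over K (restrict_scalars R M) (grade M g)"
    using vector_subspace.dim_over_family[OF VN] vector_subspace.dim_over_finite_basis[OF VM B] by auto
qed

lemma graded_iso_Supp:
  assumes M: "graded_module K R M" and N: "module R N" and iso: "graded_iso R M N"
  shows "Supp N = Supp M"
proof -
  obtain f where f: "f \<in> linear_maps R M N" "bij_betw f (carrier M) (carrier N)"
      "\<And>g. f ` grade M g = grade N g"
    using iso by (rule graded_isoE) blast
  have f0: "f ` {\<zero>\<^bsub>M\<^esub>} = {\<zero>\<^bsub>N\<^esub>}"
    using linear_maps_zero[OF graded_module_module[OF M] N f(1)] by simp
  have "grade N g = {\<zero>\<^bsub>N\<^esub>} \<longleftrightarrow> grade M g = {\<zero>\<^bsub>M\<^esub>}" for g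
    unfolding f(3)[symmetric] f0[symmetric]
    by (rule inj_on_image_eq_iff[of f "carrier M"])
      (use f(2) graded_module_subset[OF M] graded_module_zero[OF M] in \<open>auto simp: bij_betw_def\<close>)
  then show ?thesis unfolding Supp_def by simp
qed

lemma projective_BDF_transport:
  assumes M: "projective_BDF K R M" and N: "module R N" and iso: "graded_iso R M N"
  shows "projective_BDF K R N"
proof -
  have gM: "graded_module K R M" and BM: "BDF K R M" and pM: "projective R M"
    using M by (simp_all add: projective_BDF_def)
  have "finite_dim K (restrict_scalars R N) (grade N g)" for g
    by (rule graded_iso_dim(1)[OF gM N iso]) (use BM in \<open>simp add: BDF_def\<close>)
  then have "BDF K R N"
    using BM unfolding BDF_def graded_iso_Supp[OF gM N iso] by simp
  moreover obtain f where "f \<in> linear_maps R M N" "bij_betw f (carrier M) (carrier N)"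
    using iso by (rule graded_isoE)
  then have "projective R N"
    by (rule projective_transport[OF graded_module_module[OF gM] pM N])
  ultimately show ?thesis
    using graded_module_transport[OF gM N iso] by (simp add: projective_BDF_def)
qed

lemma graded_iso_hilbert_series:
  assumes M: "graded_module K R M" "BDF K R M" and N: "module R N" and iso: "graded_iso R M N"
  shows "hilbert_series K (restrict_scalars R N) = hilbert_series K (restrict_scalars R M)"
  using graded_iso_dim(2)[OF M(1) N iso] M(2) by (simp add: hilbert_series_def BDF_def)

end

section \<open>Graded free modules\<close>

text \<open>The direct sum of shifted copies of \<open>R\<close> in which the generator
  \<open>x\<close> has degree \<open>d x\<close>: an element of degree \<open>g\<close> has a
  coefficient of degree \<open>g - d x\<close> at \<open>x\<close>.\<close>

definition graded_free ::
  "('k, 'r, 'g::ab_group_add) gmodule \<Rightarrow> 'x set \<Rightarrow> ('x \<Rightarrow> 'g) \<Rightarrow> ('r, 'x \<Rightarrow> 'r, 'g) gmodule" where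
  "graded_free R X d =
     \<lparr>carrier = carrier (free_module R X), mult = mult (free_module R X),
      one = one (free_module R X), zero = zero (free_module R X), add = add (free_module R X),
      smult = smult (free_module R X),
      grade = (\<lambda>g. {c \<in> carrier (free_module R X). \<forall>x\<in>X. c x \<in> grade R (g - d x)})\<rparr>"

lemma graded_free_carrier:
  "c \<in> carrier (graded_free R X d) \<longleftrightarrow>
     (\<forall>x. c x \<in> carrier R) \<and> finite {x. c x \<noteq> \<zero>\<^bsub>R\<^esub>} \<and> {x. c x \<noteq> \<zero>\<^bsub>R\<^esub>} \<subseteq> X"
  by (simp add: graded_free_def free_module_def)

lemma graded_free_simps:
  "\<zero>\<^bsub>graded_free R X d\<^esub> = (\<lambda>_. \<zero>\<^bsub>R\<^esub>)"
  "b \<oplus>\<^bsub>graded_free R X d\<^esub> c = (\<lambda>x. b x \<oplus>\<^bsub>R\<^esub> c x)"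
  "r \<odot>\<^bsub>graded_free R X d\<^esub> c = (\<lambda>x. r \<otimes>\<^bsub>R\<^esub> c x)"
  "grade (graded_free R X d) g =
     {c \<in> carrier (graded_free R X d). \<forall>x\<in>X. c x \<in> grade R (g - d x)}"
  by (simp_all add: graded_free_def free_module_def)

lemma linear_maps_graded_free:
  "linear_maps R (graded_free R X d) N = linear_maps R (free_module R X) N"
  by (simp add: linear_maps_def graded_free_def)

definition delta :: "('k, 'x) ring_scheme \<Rightarrow> 'i \<Rightarrow> 'i \<Rightarrow> 'k" where
  "delta R x = (\<lambda>y. if y = x then \<one>\<^bsub>R\<^esub> else \<zero>\<^bsub>R\<^esub>)"

context pdcf_algebra
begin

abbreviation Fr :: "'i set \<Rightarrow> ('i \<Rightarrow> 'g) \<Rightarrow> ('r, 'i \<Rightarrow> 'r, 'g) gmodule" where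
  "Fr X d \<equiv> graded_free R X d"

lemma Fr_module: "module R (Fr X d)"
proof -
  interpret F: module R "free_module R X" by (rule free_module_module) (rule R.is_cring)
  have s: "carrier (Fr X d) = carrier (free_module R X)" "zero (Fr X d) = zero (free_module R X)"
    "add (Fr X d) = add (free_module R X)" "smult (Fr X d) = smult (free_module R X)"
    by (simp_all add: graded_free_def)
  show ?thesis
  proof (rule moduleI)
    show "abelian_group (Fr X d)"
      by (rule abelian_groupI) (auto simp: s F.a_assoc intro: F.a_comm F.l_neg)
  qed (auto simp: s R.is_cring F.smult_l_distr F.smult_r_distr F.smult_assoc1)
qed

lemma Fr_app_closed: "c \<in> carrier (Fr X d) \<Longrightarrow> c x \<in> carrier R"
  by (simp add: graded_free_carrier)

lemma Fr_outside: "c \<in> carrier (Fr X d) \<Longrightarrow> x \<notin> X \<Longrightarrow> c x = \<zero>"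
  by (auto simp: graded_free_carrier)

lemma Fr_finsum_app:
  assumes "f \<in> A \<rightarrow> carrier (Fr X d)"
  shows "(\<Oplus>\<^bsub>Fr X d\<^esub>i\<in>A. f i) x = (\<Oplus>i\<in>A. f i x)"
proof -
  interpret F: module R "Fr X d" by (rule Fr_module)
  show ?thesis
    by (rule finsum_additive_map[where q = "\<lambda>c. c x", OF F.M.abelian_monoid_axioms R.abelian_monoid_axioms])
      (use assms in \<open>auto simp: graded_free_simps graded_free_carrier\<close>)
qed

lemma delta_closed: "x \<in> X \<Longrightarrow> delta R x \<in> carrier (Fr X d)"
  by (auto simp: graded_free_carrier delta_def intro: rev_finite_subset[of "{x}"])

lemma delta_mem: "x \<in> X \<Longrightarrow> delta R x \<in> grade (Fr X d) (d x)"
  using delta_closed[of x X d] one_mem GR.grade_zero by (auto simp: graded_free_simps delta_def)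

lemma Fr_expand:
  assumes c: "c \<in> carrier (Fr X d)" and A: "finite A" "A \<subseteq> X" "{x. c x \<noteq> \<zero>} \<subseteq> A"
  shows "(\<Oplus>\<^bsub>Fr X d\<^esub>x\<in>A. c x \<odot>\<^bsub>Fr X d\<^esub> delta R x) = c"
proof
  interpret F: module R "Fr X d" by (rule Fr_module)
  fix y
  have "(\<Oplus>\<^bsub>Fr X d\<^esub>x\<in>A. c x \<odot>\<^bsub>Fr X d\<^esub> delta R x) y = (\<Oplus>x\<in>A. (c x \<odot>\<^bsub>Fr X d\<^esub> delta R x) y)"
  proof (rule Fr_finsum_app, rule Pi_I)
    fix x assume "x \<in> A"
    then have "x \<in> X" using A(2) by blast
    then show "c x \<odot>\<^bsub>Fr X d\<^esub> delta R x \<in> carrier (Fr X d)"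
      by (intro F.smult_closed Fr_app_closed[OF c] delta_closed)
  qed
  also have "\<dots> = (\<Oplus>x\<in>A. if y = x then c x else \<zero>)"
    by (rule R.finsum_cong') (use Fr_app_closed[OF c] in \<open>auto simp: graded_free_simps delta_def\<close>)
  also have "\<dots> = c y"
  proof (cases "y \<in> A")
    case True
    then show ?thesis by (rule R.finsum_singleton) (use A Fr_app_closed[OF c] in auto)
  next
    case False
    then have "(\<Oplus>x\<in>A. if y = x then c x else \<zero>) = \<zero>"
      by (intro R.add.finprod_one_eqI) auto
    moreover have "c y = \<zero>" using A(3) False by blast
    ultimately show ?thesis by simp
  qed
  finally show "(\<Oplus>\<^bsub>Fr X d\<^esub>x\<in>A. c x \<odot>\<^bsub>Fr X d\<^esub> delta R x) y = c y" .
qed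

text \<open>The homogeneous component of degree \<open>h\<close>, computed in coordinates. The
  explicit form lets a component be read off at a single coordinate, as the computation in
  \<open>kernel_grade_zero\<close> requires.\<close>

definition Fr_component :: "('i \<Rightarrow> 'g) \<Rightarrow> ('i \<Rightarrow> 'r) \<Rightarrow> 'g \<Rightarrow> 'i \<Rightarrow> 'r" where
  "Fr_component d c h = (\<lambda>x. component R (c x) (h - d x))"

lemma Fr_component_mem:
  assumes c: "c \<in> carrier (Fr X d)"
  shows "Fr_component d c h \<in> grade (Fr X d) h"
proof -
  have "{x. component R (c x) (h - d x) \<noteq> \<zero>} \<subseteq> {x. c x \<noteq> \<zero>}"
    by (auto simp: GR.component_zero)
  then show ?thesis
    using c finite_subset[of "{x. component R (c x) (h - d x) \<noteq> \<zero>}"]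
      GR.component_closed GR.component_mem
    by (auto simp: graded_free_simps graded_free_carrier Fr_component_def)
qed

text \<open>The degrees that occur are \<open>g + d x\<close>, for \<open>g\<close> a degree of the
  coordinate \<open>c x\<close>. A prescribed \<open>h\<^sub>0\<close> is included so that
  conclusions about the sum over \<open>A\<close> can be drawn at \<open>h\<^sub>0\<close>.\<close>

lemma Fr_component_sum:
  assumes c: "c \<in> carrier (Fr X d)"
  shows "\<exists>A. finite A \<and> h\<^sub>0 \<in> A \<and> c = (\<Oplus>\<^bsub>Fr X d\<^esub>h\<in>A. Fr_component d c h)"
proof (intro exI conjI)
  interpret F: module R "Fr X d" by (rule Fr_module)
  let ?C = "\<lambda>x. {g. component R (c x) g \<noteq> \<zero>}"
  let ?A = "insert h\<^sub>0 (\<Union>x\<in>{x. c x \<noteq> \<zero>}. (\<lambda>g. g + d x) ` ?C x)"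
  have cx: "c x \<in> carrier R" for x using c by (rule Fr_app_closed)
  show "h\<^sub>0 \<in> ?A" by simp
  show fin: "finite ?A" using c cx GR.component_finite by (auto simp: graded_free_carrier)
  show "c = (\<Oplus>\<^bsub>Fr X d\<^esub>h\<in>?A. Fr_component d c h)"
  proof
    fix x
    have "(\<Oplus>\<^bsub>Fr X d\<^esub>h\<in>?A. Fr_component d c h) x = (\<Oplus>h\<in>?A. component R (c x) (h - d x))"
      by (subst Fr_finsum_app)
        (use Fr_component_mem[OF c] in \<open>auto simp: graded_free_simps(4) Fr_component_def\<close>)
    also have "\<dots> = (\<Oplus>h\<in>(\<lambda>h. h - d x) ` ?A. component R (c x) h)"
      by (rule R.finsum_reindex[symmetric]) (use cx in \<open>auto simp: inj_on_def\<close>)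
    also have "\<dots> = c x"
    proof (rule GR.component_sum[OF cx])
      fix g assume g: "component R (c x) g \<noteq> \<zero>"
      then have "c x \<noteq> \<zero>" by (auto simp: GR.component_zero)
      then have "g + d x \<in> ?A" using g by blast
      then show "g \<in> (\<lambda>h. h - d x) ` ?A" by (rule rev_image_eqI) simp
    qed (use fin in simp)
    finally show "c x = (\<Oplus>\<^bsub>Fr X d\<^esub>h\<in>?A. Fr_component d c h) x" by simp
  qed
qed

lemma Fr_graded_module: "graded_module K R (Fr X d)"
proof (rule graded_moduleI[OF Fr_module])
  interpret F: module R "Fr X d" by (rule Fr_module)
  show "\<zero>\<^bsub>Fr X d\<^esub> \<in> grade (Fr X d) g" for g
    using F.M.zero_closed GR.grade_zero by (simp add: graded_free_simps)
  show "x \<oplus>\<^bsub>Fr X d\<^esub> y \<in> grade (Fr X d) g" if "x \<in> grade (Fr X d) g" "y \<in> grade (Fr X d) g" for x y g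
    using F.M.a_closed[of x y] that KR.submoduleE(5)[OF grade_R_submodule]
    by (simp add: graded_free_simps)
  show "r \<odot>\<^bsub>Fr X d\<^esub> x \<in> grade (Fr X d) (g + h)" if "r \<in> grade R g" "x \<in> grade (Fr X d) h" for r x g h
    using F.smult_closed[of r x] that grade_mult[OF that(1)] grade_R_closed[OF that(1)]
    by (auto simp: graded_free_simps diff_conv_add_uminus add.assoc
        simp del: add_uminus_conv_diff)
  show "\<exists>A f. finite A \<and> (\<forall>g\<in>A. f g \<in> grade (Fr X d) g) \<and> x = (\<Oplus>\<^bsub>Fr X d\<^esub>g\<in>A. f g)"
    if x: "x \<in> carrier (Fr X d)" for x
  proof -
    obtain A where "finite A" "x = (\<Oplus>\<^bsub>Fr X d\<^esub>h\<in>A. Fr_component d x h)"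
      using Fr_component_sum[OF x, of 0] by (elim exE conjE) (rule that)
    then show ?thesis
      by (intro exI[of _ A] exI[of _ "Fr_component d x"] conjI ballI Fr_component_mem[OF x])
  qed
  show "f g = \<zero>\<^bsub>Fr X d\<^esub>" if A: "finite A" and f: "\<And>g. g \<in> A \<Longrightarrow> f g \<in> grade (Fr X d) g"
    and s: "(\<Oplus>\<^bsub>Fr X d\<^esub>g\<in>A. f g) = \<zero>\<^bsub>Fr X d\<^esub>" and g: "g \<in> A" for A f g
  proof
    fix x
    have fc: "f h \<in> carrier (Fr X d)" if "h \<in> A" for h using f[OF that] by (simp add: graded_free_simps)
    show "f g x = \<zero>\<^bsub>Fr X d\<^esub> x"
    proof (cases "x \<in> X")
      case True
      have "(\<Oplus>h\<in>A. f h x) = \<zero>"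
        using fun_cong[OF s, of x] fc by (simp add: Fr_finsum_app graded_free_simps)
      then have "f g x = \<zero>"
        by (rule GR.grade_independent[OF A, where d = "\<lambda>h. h - d x", rotated 2])
          (use f g True in \<open>auto simp: inj_on_def graded_free_simps\<close>)
      then show ?thesis by (simp add: graded_free_simps)
    next
      case False
      then show ?thesis using Fr_outside[OF fc[OF g] False] by (simp add: graded_free_simps)
    qed
  qed
qed (simp add: graded_free_simps)

lemma free_ext_Fr_linear:
  assumes "module R N" "n \<in> X \<rightarrow> carrier N"
  shows "free_ext R N n \<in> linear_maps R (Fr X d) N"
  using free_ext_linear[OF assms] by (simp add: linear_maps_graded_free)

lemma linear_map_Fr_eq_free_ext:
  assumes N: "module R N" and f: "f \<in> linear_maps R (Fr X d) N" and c: "c \<in> carrier (Fr X d)"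
  shows "f c = free_ext R N (\<lambda>x. f (delta R x)) c"
proof -
  interpret N: module R N by fact
  interpret F: module R "Fr X d" by (rule Fr_module)
  let ?A = "{x. c x \<noteq> \<zero>}"
  have A: "finite ?A" "?A \<subseteq> X" using c by (auto simp: graded_free_carrier)
  have cl: "c x \<in> carrier R" for x by (rule Fr_app_closed[OF c])
  have dl: "delta R x \<in> carrier (Fr X d)" if "x \<in> ?A" for x using A(2) that by (blast intro: delta_closed)
  have "f c = f (\<Oplus>\<^bsub>Fr X d\<^esub>x\<in>?A. c x \<odot>\<^bsub>Fr X d\<^esub> delta R x)"
    by (subst Fr_expand[OF c A]) simp_all
  also have "\<dots> = (\<Oplus>\<^bsub>N\<^esub>x\<in>?A. f (c x \<odot>\<^bsub>Fr X d\<^esub> delta R x))"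
    by (rule linear_maps_finsum[OF F.module_axioms N f A(1)]) (use cl dl in blast)
  also have "\<dots> = (\<Oplus>\<^bsub>N\<^esub>x\<in>?A. c x \<odot>\<^bsub>N\<^esub> f (delta R x))"
    by (rule N.M.finsum_cong'[OF refl]) (use f cl dl in \<open>auto simp: linear_maps_def Pi_iff\<close>)
  finally show ?thesis by (simp add: free_ext_def)
qed

lemma Fr_projective: "projective R (Fr X d)"
  unfolding projective_def
proof (intro allI impI, elim conjE)
  fix N N' q f
  assume N: "module R (N :: ('r, ('i \<Rightarrow> 'r) \<Rightarrow> 'r) module)" "module R (N' :: ('r, 'i \<Rightarrow> 'r) module)"
    and q: "q \<in> linear_maps R N N'" "q ` carrier N = carrier N'"
    and f: "f \<in> linear_maps R (Fr X d) N'"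
  interpret N': module R N' by fact
  have fd: "f (delta R x) \<in> carrier N'" if "x \<in> X" for x
    using f delta_closed[OF that] by (auto simp: linear_maps_def)
  then have "\<forall>x\<in>X. \<exists>y\<in>carrier N. q y = f (delta R x)" using q(2) by (metis imageE)
  then obtain n where n: "\<And>x. x \<in> X \<Longrightarrow> n x \<in> carrier N" "\<And>x. x \<in> X \<Longrightarrow> q (n x) = f (delta R x)"
    by metis
  have nX: "n \<in> X \<rightarrow> carrier N" using n(1) by blast
  have "q (free_ext R N n c) = f c" if c: "c \<in> carrier (Fr X d)" for c
  proof -
    have sub: "{x. c x \<noteq> \<zero>} \<subseteq> X" using c by (simp add: graded_free_carrier)
    have "q (free_ext R N n c) = free_ext R N' (\<lambda>x. q (n x)) c"
      by (rule linear_maps_free_ext[OF N q(1) nX]) (use c in \<open>simp add: graded_free_def\<close>)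
    also have "\<dots> = free_ext R N' (\<lambda>x. f (delta R x)) c"
      unfolding free_ext_def
      by (rule N'.M.finsum_cong'[OF refl])
        (use n fd sub Fr_app_closed[OF c] in \<open>auto simp: subset_iff\<close>)
    also have "\<dots> = f c" by (rule linear_map_Fr_eq_free_ext[OF N(2) f c, symmetric])
    finally show ?thesis .
  qed
  then show "\<exists>h\<in>linear_maps R (Fr X d) N. \<forall>x\<in>carrier (Fr X d). q (h x) = f x"
    using free_ext_Fr_linear[OF N(1) nX] by blast
qed

section \<open>The Hilbert series of the algebra itself\<close>

definition basis_R :: "'g \<Rightarrow> 'r set" where
  "basis_R g = (SOME B. finite_basis K R (grade R g) B)"

lemma basis_R: "finite_basis K R (grade R g) (basis_R g)"
  unfolding basis_R_def
  by (rule someI_ex) (use PDCF in \<open>simp add: PDCF_def finite_dim_def\<close>)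

lemma basis_R_family: "basis_family K R (grade R g) (\<lambda>b. b) (basis_R g)"
  using basis_R by (simp add: finite_basis_eq_family)

lemma dim_R: "dim_over K R (grade R g) = card (basis_R g)"
  by (rule vector_subspace.dim_over_finite_basis[OF grade_R_vector_subspace basis_R])

lemma hilbert_R: "hilbert_series K R g = int (card (basis_R g))"
  by (simp add: hilbert_series_def dim_R)

lemma hilbert_R_nonzero:
  assumes "hilbert_series K R g \<noteq> 0"
  shows "g \<in> Supp R"
proof (rule ccontr)
  assume "g \<notin> Supp R"
  then have g: "grade R g = {\<zero>}" by (simp add: Supp_def)
  interpret V: vector_subspace K R "grade R g" by (rule grade_R_vector_subspace)
  have "basis_family K R (grade R g) (\<lambda>_. \<zero>) ({} :: nat set)"
    by (rule V.basis_familyI) (auto simp: g)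
  then show False using V.dim_over_family(1) assms by (fastforce simp: hilbert_series_def)
qed

text \<open>By connectedness \<open>\<one>\<close> alone is a basis of \<open>grade R 0\<close>. The
  resulting constant term 1 is what \<open>S_unit\<close> asks for.\<close>

lemma hilbert_R_zero: "hilbert_series K R 0 = 1"
proof -
  interpret V: vector_subspace K R "grade R 0" by (rule grade_R_vector_subspace)
  have sum1: "(\<Oplus>i\<in>{0::nat}. c i \<odot> \<one>) = c 0 \<odot> \<one>" if "c 0 \<in> carrier K" for c
    using that by (subst R.finsum_insert) auto
  have "basis_family K R (grade R 0) (\<lambda>_. \<one>) {0::nat}"
  proof (rule V.basis_familyI)
    fix w assume "w \<in> grade R 0"
    then obtain c where "c \<in> carrier K" "w = c \<odot> \<one>" using grade_R_zero by auto
    then show "\<exists>c. c \<in> {0::nat} \<rightarrow> carrier K \<and> w = (\<Oplus>i\<in>{0}. c i \<odot> \<one>)"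
      using sum1[of "\<lambda>_. c"] by (intro exI[of _ "\<lambda>_. c"]) simp
  next
    fix c :: "nat \<Rightarrow> 'k" and i
    assume c: "c \<in> {0} \<rightarrow> carrier K" "(\<Oplus>i\<in>{0}. c i \<odot> \<one>) = \<zero>" "i \<in> {0::nat}"
    then have c0: "c 0 \<in> carrier K" "c 0 \<odot> \<one> = \<zero>" using sum1[of c] by auto
    show "c i = \<zero>\<^bsub>K\<^esub>"
    proof (rule ccontr)
      assume "c i \<noteq> \<zero>\<^bsub>K\<^esub>"
      then have u: "c 0 \<in> Units K" using c(3) c0(1) by (simp add: K.field_Units)
      have "\<one> = (inv\<^bsub>K\<^esub> c 0 \<otimes>\<^bsub>K\<^esub> c 0) \<odot> \<one>" using u by simp
      also have "\<dots> = inv\<^bsub>K\<^esub> c 0 \<odot> (c 0 \<odot> \<one>)" using u by (intro KR.smult_assoc1) auto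
      also have "\<dots> = \<zero>" using u by (simp add: c0(2))
      finally show False by simp
    qed
  qed (auto simp: one_mem)
  then show ?thesis using V.dim_over_family(1) by (fastforce simp: hilbert_series_def)
qed

lemma hilbert_R_unit: "hilbert_series K R \<in> Units (Q.S)"
  using Q.S_unit[of "hilbert_series K R"] hilbert_R_zero hilbert_R_nonzero by blast

end

text \<open>Conditions under which \<open>Fr X d\<close> is BDF: finitely many generators in each
  degree, and degrees that form an admissible set. They also make the count of generators by degree
  a series.\<close>

locale free_index = pdcf_algebra K R for K :: "('k, 'x) ring_scheme"
    and R :: "('k, 'r, 'g::ab_group_add) gmodule" (structure) +
  fixes X :: "'i set" and d :: "'i \<Rightarrow> 'g"
  assumes finite_fiber: "finite {x \<in> X. d x = g}" and admissible_X: "admissible (Supp R) (d ` X)"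
begin

definition below :: "'g \<Rightarrow> 'i set" where
  "below g = {x \<in> X. g - d x \<in> Supp R}"

lemma finite_below_X: "finite (below g)"
proof -
  have "below g \<subseteq> (\<Union>h\<in>{h \<in> d ` X. g - h \<in> Supp R}. {x \<in> X. d x = h})"
    by (auto simp: below_def)
  then show ?thesis
    by (rule finite_subset) (use Q.finite_interval[OF admissible_X] finite_fiber in auto)
qed

text \<open>A nonzero coefficient at \<open>x\<close> places the degree in
  \<open>d x + Supp R\<close>, and sumsets of admissible sets are admissible.\<close>

lemma Supp_Fr: "admissible (Supp R) (Supp (Fr X d))"
proof (rule Q.admissible_subset[OF Q.admissible_sum[OF admissible_X Q.admissible_monoid]])
  show "Supp (Fr X d) \<subseteq> {g + h |g h. g \<in> d ` X \<and> h \<in> Supp R}"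
  proof
    fix g assume "g \<in> Supp (Fr X d)"
    then have "grade (Fr X d) g \<noteq> {\<zero>\<^bsub>Fr X d\<^esub>}" by (simp add: Supp_def)
    then obtain c where c: "c \<in> grade (Fr X d) g" "c \<noteq> \<zero>\<^bsub>Fr X d\<^esub>"
      using graded_module_zero[OF Fr_graded_module] by fast
    then have cc: "c \<in> carrier (Fr X d)" by (simp add: graded_free_simps)
    obtain x where x: "c x \<noteq> \<zero>" using c(2) by (auto simp: graded_free_simps)
    then have xX: "x \<in> X" using Fr_outside[OF cc] by blast
    then have "c x \<in> grade R (g - d x)" using c(1) by (simp add: graded_free_simps)
    then have "g - d x \<in> Supp R" using x by (rule Supp_R_mem)
    moreover have "g = d x + (g - d x)" by simp
    ultimately show "g \<in> {g + h |g h. g \<in> d ` X \<and> h \<in> Supp R}" using xX by blast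
  qed
qed

definition Fr_index :: "'g \<Rightarrow> ('i \<times> 'r) set" where
  "Fr_index g = Sigma (below g) (\<lambda>x. basis_R (g - d x))"

lemma basis_R_mem: "b \<in> basis_R g \<Longrightarrow> b \<in> grade R g" "b \<in> basis_R g \<Longrightarrow> b \<in> carrier R"
  using basis_R[of g] grade_R_closed by (auto simp: finite_basis_def)

lemma finite_basis_R: "finite (basis_R g)"
  using basis_R by (simp add: finite_basis_def)

definition Fr_basis :: "'i \<times> 'r \<Rightarrow> 'i \<Rightarrow> 'r" where
  "Fr_basis = (\<lambda>(x, b). b \<odot>\<^bsub>Fr X d\<^esub> delta R x)"

lemma Fr_basis_mem:
  assumes "i \<in> Fr_index g"
  shows "Fr_basis i \<in> grade (Fr X d) g"
proof -
  obtain x b where i: "i = (x, b)" "x \<in> X" "b \<in> grade R (g - d x)"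
    using assms basis_R_mem by (auto simp: Fr_index_def below_def)
  then show ?thesis
    using graded_module_smult[OF Fr_graded_module i(3) delta_mem[OF i(2), of d]]
    by (simp add: Fr_basis_def)
qed

text \<open>Coordinate \<open>y\<close> only sees the index pairs with first entry \<open>y\<close>.
  So spanning and independence in degree \<open>g\<close> reduce, one coordinate at a time, to the
  chosen bases of the pieces \<open>grade R (g - d y)\<close>.\<close>

lemma Fr_basis_combination:
  assumes k: "k \<in> Fr_index g \<rightarrow> carrier K"
  shows "(\<Oplus>\<^bsub>restrict_scalars R (Fr X d)\<^esub>i\<in>Fr_index g. k i \<odot>\<^bsub>restrict_scalars R (Fr X d)\<^esub> Fr_basis i) y =
    (if y \<in> below g then \<Oplus>b\<in>basis_R (g - d y). k (y, b) \<odot> b else \<zero>)"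
proof -
  interpret F: module R "Fr X d" by (rule Fr_module)
  let ?KF = "restrict_scalars R (Fr X d)"
  interpret KF: module K ?KF by (rule module_restrict_scalars[OF Fr_module])
  have kc: "k i \<in> carrier K" if "i \<in> Fr_index g" for i using k that by blast
  have Bc: "Fr_basis i \<in> carrier (Fr X d)" if "i \<in> Fr_index g" for i
    using Fr_basis_mem[OF that] by (simp add: graded_free_simps)
  have term_c: "k i \<odot>\<^bsub>?KF\<^esub> Fr_basis i \<in> carrier (Fr X d)" if "i \<in> Fr_index g" for i
    using KF.smult_closed[OF kc[OF that]] Bc[OF that] by simp
  have ap: "(k (x, b) \<odot>\<^bsub>?KF\<^esub> Fr_basis (x, b)) y = (if x = y then k (x, b) \<odot> b else \<zero>)"
    if xb: "(x, b) \<in> Fr_index g" for x b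
  proof -
    have bc: "b \<in> carrier R" using xb basis_R_mem by (auto simp: Fr_index_def)
    show ?thesis
      using bc kc[OF xb]
      by (simp add: Fr_basis_def graded_free_simps delta_def KR.smult_assoc2 R.m_assoc)
  qed
  have fin: "finite (Fr_index g)" by (simp add: Fr_index_def finite_below_X finite_basis_R)
  have "(\<Oplus>\<^bsub>?KF\<^esub>i\<in>Fr_index g. k i \<odot>\<^bsub>?KF\<^esub> Fr_basis i) y = (\<Oplus>\<^bsub>Fr X d\<^esub>i\<in>Fr_index g. k i \<odot>\<^bsub>?KF\<^esub> Fr_basis i) y"
    by (rule fun_cong[OF finsum_restrict_scalars]) (use term_c F.M.abelian_group_axioms in auto)
  also have "\<dots> = (\<Oplus>i\<in>Fr_index g. (k i \<odot>\<^bsub>?KF\<^esub> Fr_basis i) y)"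
    by (rule Fr_finsum_app) (use term_c in blast)
  also have "\<dots> = (\<Oplus>i\<in>Fr_index g. if fst i = y then k i \<odot> snd i else \<zero>)"
    by (rule R.finsum_cong'[OF refl]) (use ap kc basis_R_mem in \<open>auto simp: Fr_index_def\<close>)
  also have "\<dots> = (if y \<in> below g then \<Oplus>b\<in>basis_R (g - d y). k (y, b) \<odot> b else \<zero>)"
  proof (cases "y \<in> below g")
    case False
    then have "(\<Oplus>i\<in>Fr_index g. if fst i = y then k i \<odot> snd i else \<zero>) = \<zero>"
      by (intro R.add.finprod_one_eqI) (auto simp: Fr_index_def)
    then show ?thesis using False by simp
  next
    case True
    have "(\<Oplus>i\<in>Fr_index g. if fst i = y then k i \<odot> snd i else \<zero>)
        = (\<Oplus>i\<in>Pair y ` basis_R (g - d y). k i \<odot> snd i)"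
      by (rule R.add.finprod_mono_neutral_cong_right)
        (use True fin kc basis_R_mem in \<open>auto simp: Fr_index_def\<close>)
    also have "\<dots> = (\<Oplus>b\<in>basis_R (g - d y). k (y, b) \<odot> snd (y, b))"
      by (rule R.finsum_reindex)
        (use True kc basis_R_mem in \<open>auto simp: Fr_index_def inj_on_def\<close>)
    finally show ?thesis using True by simp
  qed
  finally show ?thesis .
qed

lemma Fr_basis_family:
  "basis_family K (restrict_scalars R (Fr X d)) (grade (Fr X d) g) Fr_basis (Fr_index g)"
proof -
  let ?KF = "restrict_scalars R (Fr X d)"
  interpret V: vector_subspace K ?KF "grade (Fr X d) g"
    by (rule graded_module_vector_subspace[OF Fr_graded_module])
  show ?thesis
  proof (rule V.basis_familyI)
    show "finite (Fr_index g)" by (simp add: Fr_index_def finite_below_X finite_basis_R)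
    show "Fr_basis i \<in> grade (Fr X d) g" if "i \<in> Fr_index g" for i by (rule Fr_basis_mem[OF that])
  next
    fix c assume c: "c \<in> grade (Fr X d) g"
    then have cc: "c \<in> carrier (Fr X d)" by (simp add: graded_free_simps)
    have "\<forall>x\<in>X. \<exists>k. k \<in> basis_R (g - d x) \<rightarrow> carrier K \<and> c x = (\<Oplus>b\<in>basis_R (g - d x). k b \<odot> b)"
      using c vector_subspace.basis_family_spans[OF grade_R_vector_subspace basis_R_family]
      by (simp add: graded_free_simps)
    from bchoice[OF this] obtain k where "\<forall>x\<in>X. k x \<in> basis_R (g - d x) \<rightarrow> carrier K \<and>
        c x = (\<Oplus>b\<in>basis_R (g - d x). k x b \<odot> b)" ..
    then have k: "\<And>x. x \<in> X \<Longrightarrow> k x \<in> basis_R (g - d x) \<rightarrow> carrier K"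
        "\<And>x. x \<in> X \<Longrightarrow> c x = (\<Oplus>b\<in>basis_R (g - d x). k x b \<odot> b)"
      by simp_all
    have kI: "(\<lambda>(x, b). k x b) \<in> Fr_index g \<rightarrow> carrier K"
      using k(1) by (auto simp: Fr_index_def below_def Pi_iff)
    have "c = (\<Oplus>\<^bsub>?KF\<^esub>i\<in>Fr_index g. (\<lambda>(x, b). k x b) i \<odot>\<^bsub>?KF\<^esub> Fr_basis i)"
    proof
      fix y
      show "c y = (\<Oplus>\<^bsub>?KF\<^esub>i\<in>Fr_index g. (\<lambda>(x, b). k x b) i \<odot>\<^bsub>?KF\<^esub> Fr_basis i) y"
      proof (cases "y \<in> below g")
        case True
        then have "c y = (\<Oplus>b\<in>basis_R (g - d y). k y b \<odot> b)"
          by (intro k(2)) (simp add: below_def)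
        then show ?thesis using True by (simp only: Fr_basis_combination[OF kI] if_True prod.case)
      next
        case False
        have "c y = \<zero>"
        proof (cases "y \<in> X")
          case True
          then have "c y \<in> grade R (g - d y)" using c by (simp add: graded_free_simps)
          then show ?thesis using False True Supp_R_mem by (auto simp: below_def)
        qed (rule Fr_outside[OF cc])
        then show ?thesis using False by (simp only: Fr_basis_combination[OF kI] if_False)
      qed
    qed
    then show "\<exists>k. k \<in> Fr_index g \<rightarrow> carrier K \<and> c = (\<Oplus>\<^bsub>?KF\<^esub>i\<in>Fr_index g. k i \<odot>\<^bsub>?KF\<^esub> Fr_basis i)"
      using kI by blast
  next
    fix k i assume k: "k \<in> Fr_index g \<rightarrow> carrier K" and i: "i \<in> Fr_index g"
      and z: "(\<Oplus>\<^bsub>?KF\<^esub>i\<in>Fr_index g. k i \<odot>\<^bsub>?KF\<^esub> Fr_basis i) = \<zero>\<^bsub>?KF\<^esub>"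
    obtain y b where yb: "i = (y, b)" "y \<in> below g" "b \<in> basis_R (g - d y)"
      using i by (auto simp: Fr_index_def)
    interpret W: vector_subspace K R "grade R (g - d y)" by (rule grade_R_vector_subspace)
    have "(\<Oplus>b\<in>basis_R (g - d y). k (y, b) \<odot> b) = \<zero>"
      using fun_cong[OF z, of y] yb(2) Fr_basis_combination[OF k, of y]
      by (simp only: if_True restrict_scalars_simps(2) graded_free_simps(1))
    also have "\<zero> = (\<Oplus>b\<in>basis_R (g - d y). \<zero>\<^bsub>K\<^esub> \<odot> b)"
      by (rule R.add.finprod_one_eqI[symmetric]) (use basis_R_mem in auto)
    finally have "k (y, b) = \<zero>\<^bsub>K\<^esub>"
      by (rule W.basis_family_eqD[OF basis_R_family, rotated 2])
        (use k yb in \<open>auto simp: Fr_index_def\<close>)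
    then show "k i = \<zero>\<^bsub>K\<^esub>" by (simp add: yb(1))
  qed
qed

lemma Fr_projective_BDF: "projective_BDF K R (Fr X d)"
proof -
  have "finite_dim K (restrict_scalars R (Fr X d)) (grade (Fr X d) g)" for g
    by (rule vector_subspace.dim_over_family(2)[OF graded_module_vector_subspace[OF Fr_graded_module]
          Fr_basis_family])
  then show ?thesis
    using Supp_Fr Fr_graded_module Fr_projective
    by (auto simp: projective_BDF_def BDF_def admissible_def)
qed

text \<open>The series that turns out to be the \<open>K\<close>-series of
  \<open>Fr X d\<close>.\<close>

definition fiber_count :: "'g \<Rightarrow> int" where
  "fiber_count g = int (card {x \<in> X. d x = g})"

lemma fiber_count_nonzero: "fiber_count g \<noteq> 0 \<longleftrightarrow> g \<in> d ` X"
  using finite_fiber by (auto simp: fiber_count_def)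

lemma fiber_count_closed: "fiber_count \<in> carrier (Q.S)"
  unfolding Q.S_carrier fiber_count_nonzero by (simp add: admissible_X)

text \<open>Each \<open>x\<close> contributes a copy of \<open>grade R (g - d x)\<close> in degree
  \<open>g\<close>; collecting the \<open>x\<close> of equal degree turns the sum over generators
  into a convolution.\<close>

lemma hilbert_Fr:
  "hilbert_series K (restrict_scalars R (Fr X d)) =
     fiber_count \<otimes>\<^bsub>Q.S\<^esub> hilbert_series K R"
proof
  fix g
  let ?B = "\<lambda>h. int (card (basis_R h))"
  have "dim_over K (restrict_scalars R (Fr X d)) (grade (Fr X d) g) = card (Fr_index g)"
    by (rule vector_subspace.dim_over_family(1)[OF graded_module_vector_subspace[OF Fr_graded_module]
          Fr_basis_family])
  then have "hilbert_series K (restrict_scalars R (Fr X d)) g = (\<Sum>x\<in>below g. ?B (g - d x))"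
    by (simp add: hilbert_series_def Fr_index_def card_SigmaI finite_below_X finite_basis_R)
  also have "\<dots> = (\<Sum>h\<in>d ` below g. \<Sum>x\<in>{x \<in> below g. d x = h}. ?B (g - d x))"
    by (rule sum.image_gen[OF finite_below_X])
  also have "\<dots> = (\<Sum>h\<in>d ` below g. fiber_count h * hilbert_series K R (g - h))"
  proof (rule sum.cong[OF refl])
    fix h assume "h \<in> d ` below g"
    then have "{x \<in> below g. d x = h} = {x \<in> X. d x = h}" by (auto simp: below_def)
    then show "(\<Sum>x\<in>{x \<in> below g. d x = h}. ?B (g - d x)) = fiber_count h * hilbert_series K R (g - h)"
      by (simp add: fiber_count_def hilbert_R)
  qed
  also have "\<dots> = (fiber_count \<otimes>\<^bsub>Q.S\<^esub> hilbert_series K R) g"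
    by (rule Q.S_mult_eq[symmetric])
      (use finite_below_X hilbert_R_nonzero fiber_count_nonzero in \<open>auto simp: below_def\<close>)
  finally show "hilbert_series K (restrict_scalars R (Fr X d)) g =
      (fiber_count \<otimes>\<^bsub>Q.S\<^esub> hilbert_series K R) g" .
qed

lemma K_series_iso_Fr:
  assumes N: "module R N" and iso: "graded_iso R (Fr X d) N"
  shows "K_series K R N = fiber_count"
proof -
  have "hilbert_series K (restrict_scalars R N) = hilbert_series K (restrict_scalars R (Fr X d))"
    by (rule graded_iso_hilbert_series[OF Fr_graded_module _ N iso])
      (use Fr_projective_BDF in \<open>simp add: projective_BDF_def\<close>)
  then have "K_series K R N = (fiber_count \<otimes>\<^bsub>Q.S\<^esub> hilbert_series K R)
      \<otimes>\<^bsub>Q.S\<^esub> inv\<^bsub>Q.S\<^esub> (hilbert_series K R)"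
    by (simp only: K_series_def hilbert_Fr)
  also have "\<dots> = fiber_count"
    using hilbert_R_unit fiber_count_closed
    by (subst Q.S.m_assoc) (simp_all add: Q.S.Units_closed Q.S.Units_r_inv)
  finally show ?thesis .
qed

end

lemma (in abelian_monoid) finsum_mem:
  assumes "S \<subseteq> carrier G" "\<zero> \<in> S" "\<And>x y. x \<in> S \<Longrightarrow> y \<in> S \<Longrightarrow> x \<oplus> y \<in> S"
    and "\<And>i. i \<in> A \<Longrightarrow> f i \<in> S"
  shows "(\<Oplus>i\<in>A. f i) \<in> S"
  using assms(4)
proof (induction A rule: infinite_finite_induct)
  case (insert a A)
  then have "f a \<in> S" "(\<Oplus>i\<in>A. f i) \<in> S" by auto
  moreover have "(\<Oplus>i\<in>insert a A. f i) = f a \<oplus> (\<Oplus>i\<in>A. f i)"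
    by (rule finsum_insert) (use insert assms(1) in auto)
  ultimately show ?case using assms(3) by simp
qed (simp_all add: assms(2) finsum_infinite)

lemma (in graded_group) component_add:
  assumes x: "x \<in> carrier M" and y: "y \<in> carrier M"
    and add: "\<And>g x y. x \<in> grade M g \<Longrightarrow> y \<in> grade M g \<Longrightarrow> x \<oplus> y \<in> grade M g"
  shows "component M (x \<oplus> y) g = component M x g \<oplus> component M y g"
proof -
  let ?A = "{g. component M x g \<noteq> \<zero>} \<union> {g. component M y g \<noteq> \<zero>} \<union> {g}"
  have fin: "finite ?A" using component_finite x y by simp
  have "(\<Oplus>g\<in>?A. component M x g \<oplus> component M y g) =
      (\<Oplus>g\<in>?A. component M x g) \<oplus> (\<Oplus>g\<in>?A. component M y g)"
    by (rule finsum_addf) (use x y in auto)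
  also have "(\<Oplus>g\<in>?A. component M x g) = x"
    by (rule component_sum[OF x fin]) simp
  also have "(\<Oplus>g\<in>?A. component M y g) = y"
    by (rule component_sum[OF y fin]) simp
  finally have sum: "x \<oplus> y = (\<Oplus>g\<in>?A. component M x g \<oplus> component M y g)" ..
  show ?thesis
    by (rule component_eqI(1)[of ?A "\<lambda>g. g" _ _ g, OF fin _ _ sum])
      (use add component_mem x y in auto)
qed

lemma graded_isoI:
  assumes f: "f \<in> linear_maps R M N"
    and h: "\<And>y. y \<in> carrier N \<Longrightarrow> h y \<in> carrier M \<and> f (h y) = y"
    and hf: "\<And>x. x \<in> carrier M \<Longrightarrow> h (f x) = x"
    and fg: "\<And>g x. x \<in> grade M g \<Longrightarrow> f x \<in> grade N g"
    and hg: "\<And>g y. y \<in> grade N g \<Longrightarrow> y \<in> carrier N \<and> h y \<in> grade M g"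
  shows "graded_iso R M N"
  unfolding graded_iso_def
proof (intro bexI[OF _ f] conjI allI)
  show "bij_betw f (carrier M) (carrier N)"
    by (rule bij_betw_byWitness[where f' = h]) (use f h hf in \<open>auto simp: linear_maps_def\<close>)
  show "f ` grade M g = grade N g" for g
  proof
    show "f ` grade M g \<subseteq> grade N g" using fg by blast
    show "grade N g \<subseteq> f ` grade M g"
    proof
      fix y assume y: "y \<in> grade N g"
      have "y = f (h y)" using h hg[OF y] by simp
      then show "y \<in> f ` grade M g" using hg[OF y] by blast
    qed
  qed
qed

section \<open>Reindexing graded free modules\<close>

context pdcf_algebra
begin

lemma Fr_reindex:
  assumes \<phi>: "bij_betw \<phi> Y X" and d: "\<And>y. y \<in> Y \<Longrightarrow> d (\<phi> y) = d' y"
  shows "graded_iso R (Fr X d) (Fr Y d')"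
proof -
  let ?f = "\<lambda>c y. if y \<in> Y then c (\<phi> y) else \<zero>"
  let ?i = "inv_into Y \<phi>"
  let ?h = "\<lambda>c x. if x \<in> X then c (?i x) else \<zero>"
  have \<phi>X: "\<phi> y \<in> X" if "y \<in> Y" for y using \<phi> that by (auto simp: bij_betw_def)
  have i: "?i x \<in> Y" "\<phi> (?i x) = x" if "x \<in> X" for x
    using \<phi> that by (auto simp: bij_betw_def inv_into_into f_inv_into_f)
  have i\<phi>: "?i (\<phi> y) = y" if "y \<in> Y" for y using \<phi> that by (simp add: bij_betw_def)
  have di: "d' (?i x) = d x" if "x \<in> X" for x using d[OF i(1)[OF that]] i(2)[OF that] by simp
  have fc: "?f c \<in> carrier (Fr Y d')" if c: "c \<in> carrier (Fr X d)" for c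
  proof -
    have "{y. ?f c y \<noteq> \<zero>} \<subseteq> ?i ` {x. c x \<noteq> \<zero>}"
    proof
      fix y assume "y \<in> {y. ?f c y \<noteq> \<zero>}"
      then have "y \<in> Y" "c (\<phi> y) \<noteq> \<zero>" by (auto split: if_splits)
      then show "y \<in> ?i ` {x. c x \<noteq> \<zero>}" using i\<phi>[of y] by (metis (mono_tags) imageI mem_Collect_eq)
    qed
    then show ?thesis
      using c finite_subset[of "{y. ?f c y \<noteq> \<zero>}" "?i ` {x. c x \<noteq> \<zero>}"]
      by (auto simp: graded_free_carrier split: if_splits)
  qed
  have hc: "?h c \<in> carrier (Fr X d)" if c: "c \<in> carrier (Fr Y d')" for c
  proof -
    have "{x. ?h c x \<noteq> \<zero>} \<subseteq> \<phi> ` {y. c y \<noteq> \<zero>}"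
    proof
      fix x assume "x \<in> {x. ?h c x \<noteq> \<zero>}"
      then have "x \<in> X" "c (?i x) \<noteq> \<zero>" by (auto split: if_splits)
      then show "x \<in> \<phi> ` {y. c y \<noteq> \<zero>}" using i(2)[of x] by (metis (mono_tags) imageI mem_Collect_eq)
    qed
    then show ?thesis
      using c finite_subset[of "{x. ?h c x \<noteq> \<zero>}" "\<phi> ` {y. c y \<noteq> \<zero>}"]
      by (auto simp: graded_free_carrier split: if_splits)
  qed
  show ?thesis
  proof (rule graded_isoI[where f = ?f and h = ?h])
    have "?f c \<in> carrier (Fr Y d')" if "c \<in> carrier (Fr X d)" for c by (rule fc[OF that])
    then show "?f \<in> linear_maps R (Fr X d) (Fr Y d')"
      by (auto simp: linear_maps_def graded_free_simps fun_eq_iff)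
    show "?h c \<in> carrier (Fr X d) \<and> ?f (?h c) = c" if c: "c \<in> carrier (Fr Y d')" for c
      using hc[OF c] i\<phi> \<phi>X Fr_outside[OF c] by (auto simp: fun_eq_iff)
    show "?h (?f c) = c" if c: "c \<in> carrier (Fr X d)" for c
      using i Fr_outside[OF c] by (auto simp: fun_eq_iff)
    show "?f c \<in> grade (Fr Y d') g" if "c \<in> grade (Fr X d) g" for c g
      using fc[of c] that \<phi>X by (auto simp: graded_free_simps(4) d[symmetric])
    show "c \<in> carrier (Fr Y d') \<and> ?h c \<in> grade (Fr X d) g" if "c \<in> grade (Fr Y d') g" for c g
      using hc[of c] that i(1) by (auto simp: graded_free_simps(4) di[symmetric])
  qed
qed

lemma Fr_iso_of_card:
  assumes fin: "\<And>g. finite {x \<in> X. d x = g}" "\<And>g. finite {y \<in> Y. d' y = g}"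
    and card: "\<And>g. card {x \<in> X. d x = g} = card {y \<in> Y. d' y = g}"
  shows "graded_iso R (Fr X d) (Fr Y d')"
proof -
  have "\<exists>\<phi>. bij_betw \<phi> {y \<in> Y. d' y = g} {x \<in> X. d x = g}" for g
    using fin card by (metis bij_betw_iff_card)
  then obtain \<phi> where \<phi>: "\<And>g. bij_betw (\<phi> g) {y \<in> Y. d' y = g} {x \<in> X. d x = g}" by metis
  \<comment> \<open>The bijections for the single degrees are glued: \<open>y\<close> is sent by the
    one that belongs to its own degree, and preservation of degrees keeps the result
    injective.\<close>
  let ?\<phi> = "\<lambda>y. \<phi> (d' y) y"
  have \<phi>X: "?\<phi> y \<in> X \<and> d (?\<phi> y) = d' y" if "y \<in> Y" for y
    using bij_betwE[OF \<phi>[of "d' y"]] that by auto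
  have "bij_betw ?\<phi> Y X"
    unfolding bij_betw_def
  proof
    show "inj_on ?\<phi> Y"
    proof (rule inj_onI)
      fix y z assume yz: "y \<in> Y" "z \<in> Y" "?\<phi> y = ?\<phi> z"
      then have "d' y = d' z" using \<phi>X by metis
      then show "y = z" using yz bij_betw_imp_inj_on[OF \<phi>[of "d' z"]] by (auto dest: inj_onD)
    qed
    show "?\<phi> ` Y = X"
    proof
      show "?\<phi> ` Y \<subseteq> X" using \<phi>X by blast
      show "X \<subseteq> ?\<phi> ` Y"
      proof
        fix x assume "x \<in> X"
        then have "x \<in> \<phi> (d x) ` {y \<in> Y. d' y = d x}"
          using bij_betw_imp_surj_on[OF \<phi>[of "d x"]] by simp
        then show "x \<in> ?\<phi> ` Y" by force
      qed
    qed
  qed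
  then show ?thesis by (rule Fr_reindex) (use \<phi>X in blast)
qed

end

section \<open>Projective modules are free\<close>

locale projective_bdf = pdcf_algebra K R for K :: "('k, 'x) ring_scheme"
    and R :: "('k, 'r, 'g::ab_group_add) gmodule" (structure) +
  fixes F :: "('r, 'm, 'g) gmodule"
  assumes projective_BDF_F: "projective_BDF K R F"
begin

lemma graded_module_F: "graded_module K R F" and projective_F: "projective R F"
  and BDF_F: "BDF K R F"
  using projective_BDF_F by (simp_all add: projective_BDF_def)

sublocale F: module R F by (rule graded_module_module[OF graded_module_F])

sublocale GF: graded_group F by (rule graded_module_graded_group[OF graded_module_F])

lemma F_add: "x \<in> grade F g \<Longrightarrow> y \<in> grade F g \<Longrightarrow> x \<oplus>\<^bsub>F\<^esub> y \<in> grade F g"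
  and F_smult: "r \<in> grade R h \<Longrightarrow> y \<in> grade F g \<Longrightarrow> r \<odot>\<^bsub>F\<^esub> y \<in> grade F (h + g)"
  by (fact graded_module_add[OF graded_module_F] graded_module_smult[OF graded_module_F])+

text \<open>Subspaces of \<open>F\<close> over \<open>grade R 0\<close>, that is over
  \<open>K\<close>; negatives come from the scalar \<open>\<ominus> \<one>\<close>.\<close>

definition closed_set :: "'m set \<Rightarrow> bool" where
  "closed_set S \<longleftrightarrow> S \<subseteq> carrier F \<and> \<zero>\<^bsub>F\<^esub> \<in> S \<and> (\<forall>x\<in>S. \<forall>y\<in>S. x \<oplus>\<^bsub>F\<^esub> y \<in> S) \<and>
     (\<forall>r\<in>grade R 0. \<forall>x\<in>S. r \<odot>\<^bsub>F\<^esub> x \<in> S)"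

lemma closed_set_finsum:
  "closed_set S \<Longrightarrow> (\<And>i. i \<in> A \<Longrightarrow> f i \<in> S) \<Longrightarrow> (\<Oplus>\<^bsub>F\<^esub>i\<in>A. f i) \<in> S"
  by (rule F.M.finsum_mem) (auto simp: closed_set_def)

text \<open>The part of \<open>F\<close> in degree \<open>g\<close> that lies in the product of \<open>F\<close> with the maximal graded
  ideal of \<open>R\<close>.\<close>

definition decomposables :: "'g \<Rightarrow> 'm set" where
  "decomposables g = \<Inter>{S. closed_set S \<and>
     (\<forall>h r y. h \<noteq> g \<longrightarrow> r \<in> grade R (g - h) \<longrightarrow> y \<in> grade F h \<longrightarrow> r \<odot>\<^bsub>F\<^esub> y \<in> S)}"

lemma decomposables_least:
  assumes "closed_set S"
    and "\<And>h r y. h \<noteq> g \<Longrightarrow> r \<in> grade R (g - h) \<Longrightarrow> y \<in> grade F h \<Longrightarrow> r \<odot>\<^bsub>F\<^esub> y \<in> S"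
  shows "decomposables g \<subseteq> S"
  using assms unfolding decomposables_def by (intro Inter_lower) simp

lemma closed_set_carrier: "closed_set (carrier F)"
  by (auto simp: closed_set_def grade_R_closed)

lemma decomposables_subset: "decomposables g \<subseteq> carrier F"
  by (rule decomposables_least[OF closed_set_carrier]) (auto simp: grade_R_closed GF.grade_subset)

lemma closed_set_decomposables: "closed_set (decomposables g)"
proof -
  have "\<zero>\<^bsub>F\<^esub> \<in> decomposables g" by (auto simp: decomposables_def closed_set_def)
  moreover have "x \<oplus>\<^bsub>F\<^esub> y \<in> decomposables g" if "x \<in> decomposables g" "y \<in> decomposables g" for x y
    using that unfolding decomposables_def closed_set_def by simp
  moreover have "r \<odot>\<^bsub>F\<^esub> x \<in> decomposables g" if "r \<in> grade R 0" "x \<in> decomposables g" for r x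
    using that unfolding decomposables_def closed_set_def by simp
  ultimately show ?thesis using decomposables_subset by (simp add: closed_set_def)
qed

lemma decomposables_mem:
  "h \<noteq> g \<Longrightarrow> r \<in> grade R (g - h) \<Longrightarrow> y \<in> grade F h \<Longrightarrow> r \<odot>\<^bsub>F\<^esub> y \<in> decomposables g"
  by (simp add: decomposables_def)

text \<open>\<open>S\<close> spans the degree \<open>g\<close> part of the quotient of
  \<open>F\<close> by its product with the maximal graded ideal. The quotient is never formed;
  \<open>w\<close> absorbs what it would kill.\<close>

definition generates :: "'g \<Rightarrow> 'm set \<Rightarrow> bool" where
  "generates g S \<longleftrightarrow> finite S \<and> S \<subseteq> grade F g \<and>
     (\<forall>y\<in>grade F g. \<exists>c w. (\<forall>s\<in>S. c s \<in> grade R 0) \<and> w \<in> decomposables g \<and>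
        y = (\<Oplus>\<^bsub>F\<^esub>s\<in>S. c s \<odot>\<^bsub>F\<^esub> s) \<oplus>\<^bsub>F\<^esub> w)"

text \<open>A basis of \<open>grade F g\<close> over \<open>K\<close> works, with decomposable part
  zero.\<close>

lemma generates_ex: "\<exists>S. generates g S"
proof -
  let ?KF = "restrict_scalars R F"
  obtain B where B: "finite_basis K ?KF (grade F g) B"
    using BDF_F by (auto simp: BDF_def finite_dim_def)
  have Bg: "b \<in> grade F g" "b \<in> carrier F" if "b \<in> B" for b
    using B that GF.grade_subset by (auto simp: finite_basis_def)
  interpret V: vector_subspace K ?KF "grade F g"
    by (rule graded_module_vector_subspace[OF graded_module_F])
  have "generates g B"
    unfolding generates_def
  proof (intro conjI ballI)
    fix y assume y: "y \<in> grade F g"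
    obtain k where k: "k \<in> B \<rightarrow> carrier K" "y = (\<Oplus>\<^bsub>?KF\<^esub>b\<in>B. k b \<odot>\<^bsub>?KF\<^esub> b)"
      using V.basis_family_spans[OF _ y, of "\<lambda>b. b" B] B by (auto simp: finite_basis_eq_family)
    let ?c = "\<lambda>b. k b \<odot> \<one>"
    have c0: "?c b \<in> grade R 0" if "b \<in> B" for b using k(1) that by (intro scalar_mem) blast
    have "y = (\<Oplus>\<^bsub>F\<^esub>b\<in>B. k b \<odot>\<^bsub>?KF\<^esub> b)"
      unfolding k(2)
      by (rule finsum_restrict_scalars[OF F.M.abelian_group_axioms])
        (use c0 Bg in \<open>auto intro!: F.smult_closed grade_R_closed\<close>)
    then have yc: "y = (\<Oplus>\<^bsub>F\<^esub>b\<in>B. ?c b \<odot>\<^bsub>F\<^esub> b)" by simp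
    have "y = (\<Oplus>\<^bsub>F\<^esub>b\<in>B. ?c b \<odot>\<^bsub>F\<^esub> b) \<oplus>\<^bsub>F\<^esub> \<zero>\<^bsub>F\<^esub>"
      using GF.grade_subset[OF y] by (simp add: yc[symmetric])
    moreover have "\<zero>\<^bsub>F\<^esub> \<in> decomposables g" using closed_set_decomposables by (simp add: closed_set_def)
    ultimately show "\<exists>c w. (\<forall>s\<in>B. c s \<in> grade R 0) \<and> w \<in> decomposables g \<and>
        y = (\<Oplus>\<^bsub>F\<^esub>s\<in>B. c s \<odot>\<^bsub>F\<^esub> s) \<oplus>\<^bsub>F\<^esub> w"
      using c0 by (intro exI[of _ ?c] exI[of _ "\<zero>\<^bsub>F\<^esub>"]) blast
  qed (use B in \<open>auto simp: finite_basis_def\<close>)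
  then show ?thesis ..
qed

text \<open>Minimal cardinality stands in for linear independence in the quotient by the
  decomposables, which \<open>gens_independent\<close> extracts from it.\<close>

definition gens :: "'g \<Rightarrow> 'm set" where
  "gens g = (ARG_MIN card S. generates g S)"

lemma gens: "generates g (gens g)" and gens_minimal: "generates g S \<Longrightarrow> card (gens g) \<le> card S"
proof -
  show "generates g (gens g)" unfolding gens_def using generates_ex arg_min_natI by metis
  show "generates g S \<Longrightarrow> card (gens g) \<le> card S" unfolding gens_def by (rule arg_min_nat_le)
qed

lemma gens_mem: "s \<in> gens g \<Longrightarrow> s \<in> grade F g" "s \<in> gens g \<Longrightarrow> s \<in> carrier F"
  using gens[of g] GF.grade_subset by (auto simp: generates_def)

lemma finite_gens: "finite (gens g)"
  using gens by (simp add: generates_def)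

lemma R_zero_inverse:
  assumes "r \<in> grade R 0" "r \<noteq> \<zero>"
  shows "\<exists>u\<in>grade R 0. u \<otimes> r = \<one>"
proof -
  obtain c where c: "c \<in> carrier K" "r = c \<odot> \<one>" using assms(1) by (auto simp: grade_R_zero)
  then have "c \<noteq> \<zero>\<^bsub>K\<^esub>" using assms(2) by auto
  then have u: "c \<in> Units K" using c(1) by (simp add: K.field_Units)
  have "(inv\<^bsub>K\<^esub> c \<odot> \<one>) \<otimes> r = inv\<^bsub>K\<^esub> c \<odot> (c \<odot> \<one>)"
    using u c by (simp add: KR.smult_assoc2)
  also have "\<dots> = (inv\<^bsub>K\<^esub> c \<otimes>\<^bsub>K\<^esub> c) \<odot> \<one>"
    using u by (intro KR.smult_assoc1[symmetric]) auto
  also have "\<dots> = \<one>" using u by simp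
  finally show ?thesis using scalar_mem[of "inv\<^bsub>K\<^esub> c"] u by (intro bexI) auto
qed

text \<open>A generator with nonzero coefficient in such a relation could be removed from the minimal
  generating set, since the nonzero elements of \<open>R\<^sub>0 = K\<close> are invertible.\<close>

lemma gens_independent:
  assumes c: "\<And>s. s \<in> gens g \<Longrightarrow> c s \<in> grade R 0"
    and z: "(\<Oplus>\<^bsub>F\<^esub>s\<in>gens g. c s \<odot>\<^bsub>F\<^esub> s) \<in> decomposables g" and t: "t \<in> gens g"
  shows "c t = \<zero>"
proof (rule ccontr)
  assume "c t \<noteq> \<zero>"
  then obtain u where u: "u \<in> grade R 0" "u \<otimes> c t = \<one>"
    using R_zero_inverse c t by blast
  let ?S = "gens g" and ?T = "gens g - {t}"
  let ?z = "\<Oplus>\<^bsub>F\<^esub>s\<in>?S. c s \<odot>\<^bsub>F\<^esub> s"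
  note W = closed_set_decomposables[of g, unfolded closed_set_def]
  have zc: "?z \<in> carrier F" using z decomposables_subset by blast
  have mult0: "r \<otimes> r' \<in> grade R 0" if "r \<in> grade R 0" "r' \<in> grade R 0" for r r'
    using grade_mult[OF that] by simp
  have add0: "r \<oplus> r' \<in> grade R 0" if "r \<in> grade R 0" "r' \<in> grade R 0" for r r'
    using KR.submoduleE(5)[OF grade_R_submodule] that by blast
  have "generates g ?T"
    unfolding generates_def
  proof (intro conjI ballI)
    fix y assume y: "y \<in> grade F g"
    obtain a w where a: "\<And>s. s \<in> ?S \<Longrightarrow> a s \<in> grade R 0" and w: "w \<in> decomposables g"
      and yw: "y = (\<Oplus>\<^bsub>F\<^esub>s\<in>?S. a s \<odot>\<^bsub>F\<^esub> s) \<oplus>\<^bsub>F\<^esub> w"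
      using gens[of g] y unfolding generates_def by blast
    \<comment> \<open>Subtracting \<open>v\<close> times the relation \<open>?z\<close> from the
      expansion of \<open>y\<close> cancels the coefficient at \<open>t\<close>. As
      \<open>?z\<close> is decomposable, the correction goes into the remainder.\<close>
    define v where "v = a t \<otimes> u"
    have v0: "v \<in> grade R 0" unfolding v_def by (rule mult0[OF a[OF t] u(1)])
    have mv0: "\<ominus> v \<in> grade R 0" by (rule KR.submoduleE(3)[OF grade_R_submodule v0])
    have cl: "a s \<in> carrier R" "c s \<in> carrier R" "s \<in> carrier F" if "s \<in> ?S" for s
      using a[OF that] c[OF that] gens_mem[OF that] grade_R_closed by blast+
    have vc: "v \<in> carrier R" by (rule grade_R_closed[OF v0])
    have wc: "w \<in> carrier F" using w decomposables_subset by blast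
    let ?b = "\<lambda>s. a s \<oplus> (\<ominus> v) \<otimes> c s"
    let ?y = "\<Oplus>\<^bsub>F\<^esub>s\<in>?S. a s \<odot>\<^bsub>F\<^esub> s" and ?y' = "\<Oplus>\<^bsub>F\<^esub>s\<in>?T. ?b s \<odot>\<^bsub>F\<^esub> s"
    have "v \<otimes> c t = a t"
      using cl[OF t] u grade_R_closed[OF u(1)] by (simp add: v_def R.m_assoc)
    then have bt: "?b t = \<zero>" using cl[OF t] vc by (simp add: R.l_minus R.r_neg)
    have sumb: "?y' = ?y \<oplus>\<^bsub>F\<^esub> (\<ominus> v) \<odot>\<^bsub>F\<^esub> ?z"
    proof -
      have "?y' = (\<Oplus>\<^bsub>F\<^esub>s\<in>?S. ?b s \<odot>\<^bsub>F\<^esub> s)"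
        by (rule F.M.add.finprod_mono_neutral_cong_left)
          (use finite_gens bt cl vc t in auto)
      also have "\<dots> = (\<Oplus>\<^bsub>F\<^esub>s\<in>?S. a s \<odot>\<^bsub>F\<^esub> s \<oplus>\<^bsub>F\<^esub> (\<ominus> v) \<odot>\<^bsub>F\<^esub> (c s \<odot>\<^bsub>F\<^esub> s))"
        by (rule F.M.finsum_cong'[OF refl])
          (use cl vc in \<open>auto simp: F.smult_l_distr F.smult_assoc1\<close>)
      also have "\<dots> = ?y \<oplus>\<^bsub>F\<^esub> (\<Oplus>\<^bsub>F\<^esub>s\<in>?S. (\<ominus> v) \<odot>\<^bsub>F\<^esub> (c s \<odot>\<^bsub>F\<^esub> s))"
        by (rule F.M.finsum_addf) (use cl vc in auto)
      also have "(\<Oplus>\<^bsub>F\<^esub>s\<in>?S. (\<ominus> v) \<odot>\<^bsub>F\<^esub> (c s \<odot>\<^bsub>F\<^esub> s)) = (\<ominus> v) \<odot>\<^bsub>F\<^esub> ?z"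
        by (rule F.finsum_smult_ldistr[symmetric]) (use finite_gens cl vc in auto)
      finally show ?thesis .
    qed
    have ac: "?y \<in> carrier F" by (rule F.M.finsum_closed) (use cl in auto)
    have "?y' \<oplus>\<^bsub>F\<^esub> (v \<odot>\<^bsub>F\<^esub> ?z \<oplus>\<^bsub>F\<^esub> w) =
        ?y \<oplus>\<^bsub>F\<^esub> (((\<ominus> v) \<odot>\<^bsub>F\<^esub> ?z \<oplus>\<^bsub>F\<^esub> v \<odot>\<^bsub>F\<^esub> ?z) \<oplus>\<^bsub>F\<^esub> w)"
      unfolding sumb using ac vc zc wc by (simp add: F.M.a_assoc)
    also have "(\<ominus> v) \<odot>\<^bsub>F\<^esub> ?z \<oplus>\<^bsub>F\<^esub> v \<odot>\<^bsub>F\<^esub> ?z = \<zero>\<^bsub>F\<^esub>"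
      using vc zc by (simp add: F.smult_l_minus F.M.l_neg)
    also have "?y \<oplus>\<^bsub>F\<^esub> (\<zero>\<^bsub>F\<^esub> \<oplus>\<^bsub>F\<^esub> w) = y" using wc yw by simp
    finally have yb: "y = ?y' \<oplus>\<^bsub>F\<^esub> (v \<odot>\<^bsub>F\<^esub> ?z \<oplus>\<^bsub>F\<^esub> w)" ..
    have "v \<odot>\<^bsub>F\<^esub> ?z \<oplus>\<^bsub>F\<^esub> w \<in> decomposables g" using W v0 z w by simp
    moreover have "\<forall>s\<in>?T. ?b s \<in> grade R 0" using a c mv0 add0 mult0 by simp
    ultimately show "\<exists>c w. (\<forall>s\<in>?T. c s \<in> grade R 0) \<and> w \<in> decomposables g \<and>
        y = (\<Oplus>\<^bsub>F\<^esub>s\<in>?T. c s \<odot>\<^bsub>F\<^esub> s) \<oplus>\<^bsub>F\<^esub> w"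
      using yb by (intro exI[of _ ?b] exI[of _ "v \<odot>\<^bsub>F\<^esub> ?z \<oplus>\<^bsub>F\<^esub> w"] conjI)
  qed (use finite_gens gens_mem in auto)
  then have "card ?S \<le> card ?T" by (rule gens_minimal)
  then show False using t finite_gens[of g] by (metis card_Diff1_less not_less)
qed

end

section \<open>The surjection from a graded free module and its kernel\<close>

context projective_bdf
begin

lemma closed_set_smult:
  "closed_set S \<Longrightarrow> r \<in> grade R 0 \<Longrightarrow> x \<in> S \<Longrightarrow> r \<odot>\<^bsub>F\<^esub> x \<in> S"
  by (simp add: closed_set_def)

text \<open>Tagging each generator with its degree makes \<open>fst\<close> the degree map and
  \<open>snd\<close> the map into \<open>F\<close>.\<close>

definition index_set :: "('g \<times> 'm) set" where
  "index_set = Sigma UNIV gens"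

lemma fiber_index_set: "{x \<in> index_set. fst x = g} = Pair g ` gens g"
  by (auto simp: index_set_def)

lemma gens_Supp:
  assumes "gens g \<noteq> {}"
  shows "g \<in> Supp F"
proof (rule ccontr)
  assume "g \<notin> Supp F"
  then have Fg: "grade F g = {\<zero>\<^bsub>F\<^esub>}" by (simp add: Supp_def)
  have "\<zero>\<^bsub>F\<^esub> \<in> decomposables g" using closed_set_decomposables by (simp add: closed_set_def)
  then have "generates g {}" by (auto simp: generates_def Fg)
  then have "card (gens g) = 0" using gens_minimal by fastforce
  then show False using assms finite_gens by simp
qed

lemma Supp_admissible: "admissible (Supp R) (Supp F)"
  using BDF_F by (simp add: BDF_def admissible_def)

sublocale I: free_index K R index_set fst
proof
  show "finite {x \<in> index_set. fst x = g}" for g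
    unfolding fiber_index_set by (simp add: finite_gens)
  show "admissible (Supp R) (fst ` index_set)"
    by (rule Q.admissible_subset[OF Supp_admissible]) (use gens_Supp in \<open>fastforce simp: index_set_def\<close>)
qed

abbreviation P :: "('r, 'g \<times> 'm \<Rightarrow> 'r, 'g) gmodule" where
  "P \<equiv> Fr index_set fst"

sublocale P: module R P by (rule Fr_module)

definition p :: "('g \<times> 'm \<Rightarrow> 'r) \<Rightarrow> 'm" where
  "p = free_ext R F snd"

lemma snd_mem: "x \<in> index_set \<Longrightarrow> snd x \<in> grade F (fst x)" "x \<in> index_set \<Longrightarrow> snd x \<in> carrier F"
  using gens_mem by (auto simp: index_set_def)

lemma p_linear: "p \<in> linear_maps R P F"
  unfolding p_def by (rule free_ext_Fr_linear[OF F.module_axioms]) (use snd_mem in blast)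

lemma p_closed: "c \<in> carrier P \<Longrightarrow> p c \<in> carrier F"
  using p_linear by (auto simp: linear_maps_def)

lemma p_add: "b \<in> carrier P \<Longrightarrow> c \<in> carrier P \<Longrightarrow> p (b \<oplus>\<^bsub>P\<^esub> c) = p b \<oplus>\<^bsub>F\<^esub> p c"
  using p_linear by (simp add: linear_maps_def)

lemma p_smult: "r \<in> carrier R \<Longrightarrow> c \<in> carrier P \<Longrightarrow> p (r \<odot>\<^bsub>P\<^esub> c) = r \<odot>\<^bsub>F\<^esub> p c"
  using p_linear by (simp add: linear_maps_def)

lemma p_zero: "p \<zero>\<^bsub>P\<^esub> = \<zero>\<^bsub>F\<^esub>"
  by (rule linear_maps_zero[OF P.module_axioms F.module_axioms p_linear])

lemma p_eq:
  assumes "c \<in> carrier P" "finite A" "A \<subseteq> index_set" "{x. c x \<noteq> \<zero>} \<subseteq> A"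
  shows "p c = (\<Oplus>\<^bsub>F\<^esub>x\<in>A. c x \<odot>\<^bsub>F\<^esub> snd x)"
  unfolding p_def
  by (rule free_ext_superset[OF F.module_axioms _ _ assms(2-4)])
    (use assms(1) snd_mem in \<open>auto simp: graded_free_def\<close>)

lemma P_grade_closed: "c \<in> grade P g \<Longrightarrow> c \<in> carrier P"
  by (rule graded_module_subset[OF Fr_graded_module])

lemma closed_set_grade: "closed_set (grade F g)"
  using F_smult[of _ 0] by (auto simp: closed_set_def GF.grade_subset GF.grade_zero F_add)

lemma p_grade:
  assumes c: "c \<in> grade P g"
  shows "p c \<in> grade F g"
proof -
  have cc: "c \<in> carrier P" by (rule P_grade_closed[OF c])
  then have supp: "finite {x. c x \<noteq> \<zero>}" "{x. c x \<noteq> \<zero>} \<subseteq> index_set"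
    by (simp_all add: graded_free_carrier)
  have "(\<Oplus>\<^bsub>F\<^esub>x\<in>{x. c x \<noteq> \<zero>}. c x \<odot>\<^bsub>F\<^esub> snd x) \<in> grade F g"
  proof (rule closed_set_finsum[OF closed_set_grade])
    fix x assume "x \<in> {x. c x \<noteq> \<zero>}"
    then have x: "x \<in> index_set" using supp(2) by blast
    then have "c x \<in> grade R (g - fst x)" using c by (simp add: graded_free_simps(4))
    then have "c x \<odot>\<^bsub>F\<^esub> snd x \<in> grade F (g - fst x + fst x)" using snd_mem(1)[OF x] by (rule F_smult)
    then show "c x \<odot>\<^bsub>F\<^esub> snd x \<in> grade F g" by simp
  qed
  then show ?thesis using p_eq[OF cc supp] by simp
qed

lemma p_delta:
  assumes x: "x \<in> index_set"
  shows "p (delta R x) = snd x"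
proof -
  have "p (delta R x) = (\<Oplus>\<^bsub>F\<^esub>y\<in>{x}. delta R x y \<odot>\<^bsub>F\<^esub> snd y)"
    by (rule p_eq[OF delta_closed[OF x]]) (use x in \<open>auto simp: delta_def\<close>)
  also have "\<dots> = snd x"
    by (subst F.M.finsum_insert) (use snd_mem(2)[OF x] in \<open>auto simp: delta_def\<close>)
  finally show ?thesis .
qed

definition strictly_below :: "'g set \<Rightarrow> 'g \<Rightarrow> 'g set" where
  "strictly_below U g = {u \<in> U. g - u \<in> Supp R \<and> u \<noteq> g}"

lemma strictly_below_psubset:
  assumes U: "admissible (Supp R) U" and h: "h \<in> U" "g - h \<in> Supp R" "h \<noteq> g"
  shows "card (strictly_below U h) < card (strictly_below U g)"
proof (rule psubset_card_mono)
  show "finite (strictly_below U g)"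
    by (rule finite_subset[OF _ Q.finite_interval[OF U, of g]]) (auto simp: strictly_below_def)
  have "strictly_below U h \<subseteq> strictly_below U g"
  proof
    fix u assume u: "u \<in> strictly_below U h"
    then have "h - u \<in> Supp R" by (simp add: strictly_below_def)
    then have "g - u \<in> Supp R" using h(2) by (rule Q.minus_mem_trans)
    moreover have "u \<noteq> g" using \<open>h - u \<in> Supp R\<close> h(2,3) Q.antisym by blast
    ultimately show "u \<in> strictly_below U g" using u by (simp add: strictly_below_def)
  qed
  moreover have "h \<in> strictly_below U g" "h \<notin> strictly_below U h"
    using h by (simp_all add: strictly_below_def)
  ultimately show "strictly_below U h \<subset> strictly_below U g" by blast
qed

text \<open>Finitely many elements of \<open>U\<close> lie strictly below any \<open>g\<close>, and
  their number drops on passing to one of them. The hypothesis is available only at degrees in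
  \<open>U\<close>, whereas \<open>g\<close> itself is arbitrary.\<close>

lemma strictly_below_induct [consumes 1, case_names less]:
  assumes U: "admissible (Supp R) U"
    and step: "\<And>g. (\<And>h. h \<in> U \<Longrightarrow> g - h \<in> Supp R \<Longrightarrow> h \<noteq> g \<Longrightarrow> A h) \<Longrightarrow> A g"
  shows "A g"
proof (induction "card (strictly_below U g)" arbitrary: g rule: less_induct)
  case less
  show ?case
    by (rule step, rule less) (rule strictly_below_psubset[OF U])
qed

text \<open>The graded Nakayama argument. The image of \<open>p\<close> in degree \<open>g\<close>
  is a subspace that contains the generators and, by induction, the products of elements of
  \<open>R\<close> with elements of smaller degree; hence it contains the decomposables, and so
  everything.\<close>

lemma p_surj_grade: "grade F g \<subseteq> p ` grade P g"
  using Supp_admissible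
proof (induction g rule: strictly_below_induct)
  case (less g)
  let ?S = "p ` grade P g"
  have cS: "closed_set ?S"
    unfolding closed_set_def
  proof (intro conjI ballI)
    show "?S \<subseteq> carrier F" using p_closed P_grade_closed by blast
    show "\<zero>\<^bsub>F\<^esub> \<in> ?S"
      unfolding p_zero[symmetric] by (rule imageI) (rule graded_module_zero[OF Fr_graded_module])
    show "x \<oplus>\<^bsub>F\<^esub> y \<in> ?S" if "x \<in> ?S" "y \<in> ?S" for x y
    proof -
      obtain b c where "b \<in> grade P g" "x = p b" "c \<in> grade P g" "y = p c"
        using \<open>x \<in> ?S\<close> \<open>y \<in> ?S\<close> by blast
      then have "x \<oplus>\<^bsub>F\<^esub> y = p (b \<oplus>\<^bsub>P\<^esub> c)" "b \<oplus>\<^bsub>P\<^esub> c \<in> grade P g"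
        using p_add P_grade_closed graded_module_add[OF Fr_graded_module] by simp_all
      then show ?thesis by blast
    qed
    show "r \<odot>\<^bsub>F\<^esub> x \<in> ?S" if r: "r \<in> grade R 0" and x: "x \<in> ?S" for r x
    proof -
      obtain b where "b \<in> grade P g" "x = p b" using x by blast
      then have "r \<odot>\<^bsub>F\<^esub> x = p (r \<odot>\<^bsub>P\<^esub> b)" "r \<odot>\<^bsub>P\<^esub> b \<in> grade P (0 + g)"
        using p_smult P_grade_closed grade_R_closed[OF r] graded_module_smult[OF Fr_graded_module r]
        by simp_all
      then show ?thesis by auto
    qed
  qed
  have "decomposables g \<subseteq> ?S"
  proof (rule decomposables_least[OF cS])
    fix h r y assume h: "h \<noteq> g" and r: "r \<in> grade R (g - h)" and y: "y \<in> grade F h"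
    have rc: "r \<in> carrier R" and yc: "y \<in> carrier F"
      using r y grade_R_closed GF.grade_subset by blast+
    show "r \<odot>\<^bsub>F\<^esub> y \<in> ?S"
    \<comment> \<open>Only for nonzero factors are \<open>g - h\<close> in \<open>Supp R\<close> and
      \<open>h\<close> in \<open>Supp F\<close> known, as the induction hypothesis demands.\<close>
    proof (cases "r = \<zero> \<or> y = \<zero>\<^bsub>F\<^esub>")
      case True
      then have "r \<odot>\<^bsub>F\<^esub> y = \<zero>\<^bsub>F\<^esub>" using rc yc by auto
      then show ?thesis using cS by (simp add: closed_set_def)
    next
      case False
      then have "g - h \<in> Supp R" using Supp_R_mem[OF r] by blast
      moreover have "h \<in> Supp F" using y False by (auto simp: Supp_def)
      ultimately have "grade F h \<subseteq> p ` grade P h" using less h by blast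
      then obtain b where b: "b \<in> grade P h" "y = p b" using y by blast
      have "r \<odot>\<^bsub>P\<^esub> b \<in> grade P (g - h + h)"
        by (rule graded_module_smult[OF Fr_graded_module r b(1)])
      moreover have "r \<odot>\<^bsub>F\<^esub> y = p (r \<odot>\<^bsub>P\<^esub> b)"
        using p_smult P_grade_closed[OF b(1)] rc b(2) by simp
      ultimately show ?thesis by auto
    qed
  qed
  moreover have "s \<in> ?S" if s: "s \<in> gens g" for s
  proof -
    have gs: "(g, s) \<in> index_set" using s by (simp add: index_set_def)
    show ?thesis
      using p_delta[OF gs] delta_mem[OF gs, where d = fst] by force
  qed
  ultimately show ?case
  proof (intro subsetI)
    assume W: "decomposables g \<subseteq> ?S" and S: "\<And>s. s \<in> gens g \<Longrightarrow> s \<in> ?S"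
    fix y assume "y \<in> grade F g"
    then obtain c w where c: "\<And>s. s \<in> gens g \<Longrightarrow> c s \<in> grade R 0" and w: "w \<in> decomposables g"
      and y: "y = (\<Oplus>\<^bsub>F\<^esub>s\<in>gens g. c s \<odot>\<^bsub>F\<^esub> s) \<oplus>\<^bsub>F\<^esub> w"
      using gens[of g] unfolding generates_def by blast
    have "(\<Oplus>\<^bsub>F\<^esub>s\<in>gens g. c s \<odot>\<^bsub>F\<^esub> s) \<in> ?S"
      by (rule closed_set_finsum[OF cS]) (rule closed_set_smult[OF cS c S])
    then show "y \<in> ?S" using cS w W unfolding y closed_set_def by blast
  qed
qed

lemma p_surj: "p ` carrier P = carrier F"
proof
  show "p ` carrier P \<subseteq> carrier F" using p_closed by blast
  show "carrier F \<subseteq> p ` carrier P"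
  proof
    fix y assume y: "y \<in> carrier F"
    have "component F y g \<in> p ` carrier P" for g
      using GF.component_mem[OF y, of g] p_surj_grade[of g] P_grade_closed by blast
    then have "(\<Oplus>\<^bsub>F\<^esub>g\<in>{g. component F y g \<noteq> \<zero>\<^bsub>F\<^esub>}. component F y g) \<in> p ` carrier P"
    proof (intro F.M.finsum_mem)
      show "\<zero>\<^bsub>F\<^esub> \<in> p ` carrier P" unfolding p_zero[symmetric] by (rule imageI) simp
      fix a b assume "a \<in> p ` carrier P" "b \<in> p ` carrier P"
      then obtain a' b' where "a' \<in> carrier P" "a = p a'" "b' \<in> carrier P" "b = p b'" by blast
      then have "a \<oplus>\<^bsub>F\<^esub> b = p (a' \<oplus>\<^bsub>P\<^esub> b')" "a' \<oplus>\<^bsub>P\<^esub> b' \<in> carrier P" by (simp_all add: p_add)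
      then show "a \<oplus>\<^bsub>F\<^esub> b \<in> p ` carrier P" by blast
    qed (use p_closed in auto)
    then show "y \<in> p ` carrier P"
      using GF.component_sum[OF y GF.component_finite[OF y]] by simp
  qed
qed

text \<open>\<open>p\<close> preserves degrees, so the images of the components of \<open>t\<close>
  are homogeneous of different degrees and sum to zero.\<close>

lemma p_component:
  assumes t: "t \<in> carrier P" "p t = \<zero>\<^bsub>F\<^esub>"
  shows "p (Fr_component fst t h) = \<zero>\<^bsub>F\<^esub>"
proof -
  obtain A where A: "finite A" "h \<in> A" "t = (\<Oplus>\<^bsub>P\<^esub>h\<in>A. Fr_component fst t h)"
    using Fr_component_sum[OF t(1), of h] by (elim exE conjE) (rule that)
  have "p (\<Oplus>\<^bsub>P\<^esub>h\<in>A. Fr_component fst t h) = (\<Oplus>\<^bsub>F\<^esub>h\<in>A. p (Fr_component fst t h))"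
    by (rule linear_maps_finsum[OF P.module_axioms F.module_axioms p_linear A(1)])
      (use P_grade_closed Fr_component_mem[OF t(1)] in blast)
  then have "(\<Oplus>\<^bsub>F\<^esub>h\<in>A. p (Fr_component fst t h)) = \<zero>\<^bsub>F\<^esub>" using t(2) A(3) by simp
  then show ?thesis
    by (rule GF.grade_independent[OF A(1), where d = "\<lambda>h. h", rotated 2])
      (use p_grade[OF Fr_component_mem[OF t(1)]] A(2) in auto)
qed

text \<open>Modulo the decomposables, only the coefficients of the generators of degree \<open>g\<close> survive in
  \<open>p z\<close>.\<close>

lemma kernel_top_zero:
  assumes z: "z \<in> grade P g" "p z = \<zero>\<^bsub>F\<^esub>" and x: "x \<in> index_set" "fst x = g"
  shows "z x = \<zero>"
proof -
  have zc: "z \<in> carrier P" by (rule P_grade_closed[OF z(1)])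
  then have supp: "finite {x. z x \<noteq> \<zero>}" "{x. z x \<noteq> \<zero>} \<subseteq> index_set"
    by (simp_all add: graded_free_carrier)
  have zR: "z x \<in> grade R (g - fst x)" if "x \<in> index_set" for x
    using z(1) that by (simp add: graded_free_simps(4))
  \<comment> \<open>\<open>?T\<close> takes all generators of degree \<open>g\<close>, also those
    with coefficient zero, because \<open>gens_independent\<close> speaks of sums over the whole of
    \<open>gens g\<close>.\<close>
  let ?T = "Pair g ` gens g" and ?A = "{x. z x \<noteq> \<zero>} - {x. fst x = g}"
  let ?w = "\<Oplus>\<^bsub>F\<^esub>x\<in>?A. z x \<odot>\<^bsub>F\<^esub> snd x" and ?t = "\<Oplus>\<^bsub>F\<^esub>s\<in>gens g. z (g, s) \<odot>\<^bsub>F\<^esub> s"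
  have T: "?T \<subseteq> index_set" by (auto simp: index_set_def)
  have A: "?A \<subseteq> index_set" using supp(2) by blast
  have cl: "z x \<odot>\<^bsub>F\<^esub> snd x \<in> carrier F" if "x \<in> index_set" for x
    using Fr_app_closed[OF zc] snd_mem(2)[OF that] by simp
  have "\<zero>\<^bsub>F\<^esub> = (\<Oplus>\<^bsub>F\<^esub>x\<in>?T \<union> ?A. z x \<odot>\<^bsub>F\<^esub> snd x)"
    unfolding z(2)[symmetric]
    by (rule p_eq[OF zc]) (use supp T A finite_gens in \<open>auto simp: index_set_def\<close>)
  also have "\<dots> = (\<Oplus>\<^bsub>F\<^esub>x\<in>?T. z x \<odot>\<^bsub>F\<^esub> snd x) \<oplus>\<^bsub>F\<^esub> ?w"
    by (rule F.M.finsum_Un_disjoint) (use supp finite_gens cl T A in auto)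
  also have "(\<Oplus>\<^bsub>F\<^esub>x\<in>?T. z x \<odot>\<^bsub>F\<^esub> snd x) = (\<Oplus>\<^bsub>F\<^esub>s\<in>gens g. z (g, s) \<odot>\<^bsub>F\<^esub> snd (g, s))"
    by (rule F.M.finsum_reindex) (use cl T in \<open>auto simp: inj_on_def\<close>)
  finally have sum0: "?t \<oplus>\<^bsub>F\<^esub> ?w = \<zero>\<^bsub>F\<^esub>"
    by simp
  have w: "?w \<in> decomposables g"
  proof (rule closed_set_finsum[OF closed_set_decomposables])
    fix x assume x: "x \<in> ?A"
    then have "x \<in> index_set" using A by blast
    then show "z x \<odot>\<^bsub>F\<^esub> snd x \<in> decomposables g"
      using x by (intro decomposables_mem[OF _ zR snd_mem(1)]) auto
  qed
  have wc: "?w \<in> carrier F"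
    using w decomposables_subset by blast
  have tc: "?t \<in> carrier F"
    by (rule F.M.finsum_closed) (use cl T in force)
  have "?t = \<ominus>\<^bsub>F\<^esub> ?w"
    by (rule F.M.minus_equality[OF sum0 wc tc, symmetric])
  also have "\<dots> = (\<ominus> \<one>) \<odot>\<^bsub>F\<^esub> ?w"
    using wc by (subst F.smult_l_minus) simp_all
  also have "\<dots> \<in> decomposables g"
    using closed_set_decomposables w minus_one_mem by (simp add: closed_set_def)
  finally have "?t \<in> decomposables g" .
  moreover have "z (g, s) \<in> grade R 0" if "s \<in> gens g" for s
    using zR[of "(g, s)"] that by (simp add: index_set_def)
  moreover obtain s where "s \<in> gens g" "x = (g, s)" using x by (cases x) (auto simp: index_set_def)
  ultimately show ?thesis using gens_independent[of g "\<lambda>s. z (g, s)" s] by simp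
qed

text \<open>A section \<open>s\<close> of \<open>p\<close> gives the projection \<open>c \<mapsto> c - s (p c)\<close> onto the kernel of \<open>p\<close>, so the
  kernel is generated by the homogeneous components of the images of the basis elements; if these
  vanish below degree \<open>g\<close>, then so does the kernel in degree \<open>g\<close>.\<close>

lemma kernel_grade_zero:
  assumes "z \<in> grade P g" "p z = \<zero>\<^bsub>F\<^esub>"
  shows "z = \<zero>\<^bsub>P\<^esub>"
proof -
  \<comment> \<open>The identity of \<open>F\<close> is lifted along \<open>p\<close>. The section
    need not preserve degrees, and neither need \<open>\<pi>\<close> below.\<close>
  obtain s where s: "s \<in> linear_maps R F P" "\<And>y. y \<in> carrier F \<Longrightarrow> p (s y) = y"
    using projective_lift[OF F.module_axioms projective_F P.module_axioms F.module_axioms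
        p_linear p_surj, of "\<lambda>y. y"] by (auto simp: linear_maps_def)
  have sc: "s y \<in> carrier P" if "y \<in> carrier F" for y using s(1) that by (auto simp: linear_maps_def)
  define \<pi> where "\<pi> c = c \<oplus>\<^bsub>P\<^esub> (\<ominus> \<one>) \<odot>\<^bsub>P\<^esub> s (p c)" for c
  have \<pi>c: "\<pi> c \<in> carrier P" if "c \<in> carrier P" for c
    using that sc p_closed by (simp add: \<pi>_def)
  have p\<pi>: "p (\<pi> c) = \<zero>\<^bsub>F\<^esub>" if c: "c \<in> carrier P" for c
  proof -
    have "p (\<pi> c) = p c \<oplus>\<^bsub>F\<^esub> (\<ominus> \<one>) \<odot>\<^bsub>F\<^esub> p c"
      using c sc p_closed s(2) by (simp add: \<pi>_def p_add p_smult)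
    then show ?thesis using p_closed[OF c] by (simp add: F.smult_l_minus F.M.r_neg)
  qed
  have "\<pi> \<in> linear_maps R P P"
    unfolding linear_maps_def
  proof (intro CollectI conjI ballI Pi_I)
    fix b c assume bc: "b \<in> carrier P" "c \<in> carrier P"
    have "s (p (b \<oplus>\<^bsub>P\<^esub> c)) = s (p b) \<oplus>\<^bsub>P\<^esub> s (p c)"
      using s(1) bc p_closed by (simp add: p_add linear_maps_def)
    then show "\<pi> (b \<oplus>\<^bsub>P\<^esub> c) = \<pi> b \<oplus>\<^bsub>P\<^esub> \<pi> c"
      using bc sc p_closed by (simp add: \<pi>_def P.smult_r_distr P.M.a_ac)
  next
    fix r c assume rc: "r \<in> carrier R" "c \<in> carrier P"
    have "s (p (r \<odot>\<^bsub>P\<^esub> c)) = r \<odot>\<^bsub>P\<^esub> s (p c)"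
      using s(1) rc p_closed by (simp add: p_smult linear_maps_def)
    then show "\<pi> (r \<odot>\<^bsub>P\<^esub> c) = r \<odot>\<^bsub>P\<^esub> \<pi> c"
      using rc sc p_closed by (simp add: \<pi>_def P.smult_r_distr P.smult_l_minus P.smult_r_minus)
  qed (rule \<pi>c)
  then have \<pi>_ext: "\<pi> c = free_ext R P (\<lambda>x. \<pi> (delta R x)) c" if "c \<in> carrier P" for c
    using linear_map_Fr_eq_free_ext[OF P.module_axioms _ that] by blast
  \<comment> \<open>The induction follows the degrees of the generators, since the components to be
    shown zero sit in the degrees \<open>fst x\<close>.\<close>
  from I.admissible_X assms show ?thesis
  proof (induction g arbitrary: z rule: strictly_below_induct)
    case (less g)
    have zc: "z \<in> carrier P" by (rule P_grade_closed[OF less.prems(1)])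
    let ?A = "{x. z x \<noteq> \<zero>}"
    have A: "finite ?A" "?A \<subseteq> index_set" using zc by (simp_all add: graded_free_carrier)
    have zR: "z x \<in> grade R (g - fst x)" if "x \<in> index_set" for x
      using less.prems(1) that by (simp add: graded_free_simps(4))
    have d\<pi>: "\<pi> (delta R x) \<in> carrier P" if "x \<in> ?A" for x
      by (rule \<pi>c, rule delta_closed) (use A(2) that in blast)
    \<comment> \<open>A nonzero coefficient of degree \<open>g - fst x\<close> puts
      \<open>fst x\<close> below \<open>g\<close>, strictly so by \<open>kernel_top_zero\<close>.
      The degree \<open>fst x\<close> component of a kernel element lies in the kernel again, so the
      induction hypothesis applies to it.\<close>
    have comp0: "Fr_component fst (\<pi> (delta R x)) (fst x) = \<zero>\<^bsub>P\<^esub>" if x: "x \<in> ?A" for x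
    proof (rule less.IH)
      have xI: "x \<in> index_set" using x A by blast
      show "fst x \<in> fst ` index_set" using xI by blast
      show "g - fst x \<in> Supp R" using Supp_R_mem[OF zR[OF xI]] x by blast
      show "fst x \<noteq> g" using kernel_top_zero[OF less.prems xI] x by blast
      show "Fr_component fst (\<pi> (delta R x)) (fst x) \<in> grade P (fst x)"
        by (rule Fr_component_mem[OF d\<pi>[OF x]])
      show "p (Fr_component fst (\<pi> (delta R x)) (fst x)) = \<zero>\<^bsub>F\<^esub>"
        by (rule p_component[OF d\<pi>[OF x] p\<pi>[OF delta_closed[OF xI]]])
    qed
    have "s \<zero>\<^bsub>F\<^esub> = \<zero>\<^bsub>P\<^esub>" by (rule linear_maps_zero[OF F.module_axioms P.module_axioms s(1)])
    then have "\<pi> z = z" using zc by (simp add: \<pi>_def less.prems(2))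
    then have z_sum: "z = (\<Oplus>\<^bsub>P\<^esub>x\<in>?A. z x \<odot>\<^bsub>P\<^esub> \<pi> (delta R x))"
      using \<pi>_ext[OF zc] by (simp add: free_ext_def)
    show "z = \<zero>\<^bsub>P\<^esub>"
    proof
      fix y
      show "z y = \<zero>\<^bsub>P\<^esub> y"
      proof (cases "y \<in> index_set")
        case False
        then show ?thesis using Fr_outside[OF zc] by (simp add: graded_free_simps)
      next
        case True
        have zx: "z x \<in> carrier R" for x by (rule Fr_app_closed[OF zc])
        have tc: "z x \<otimes> \<pi> (delta R x) y \<in> carrier R" if "x \<in> ?A" for x
          using zx Fr_app_closed[OF d\<pi>[OF that]] by simp
        have "z y = (\<Oplus>\<^bsub>P\<^esub>x\<in>?A. z x \<odot>\<^bsub>P\<^esub> \<pi> (delta R x)) y" by (rule fun_cong[OF z_sum])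
        also have "\<dots> = (\<Oplus>x\<in>?A. (z x \<odot>\<^bsub>P\<^esub> \<pi> (delta R x)) y)"
          by (rule Fr_finsum_app) (use zx d\<pi> in blast)
        also have "\<dots> = (\<Oplus>x\<in>?A. z x \<otimes> \<pi> (delta R x) y)" by (simp add: graded_free_simps)
        finally have zy: "z y = (\<Oplus>x\<in>?A. z x \<otimes> \<pi> (delta R x) y)" .
        have "z y = component R (z y) (g - fst y)"
          using GR.component_grade(1)[OF zR[OF True]] by simp
        also have "\<dots> = (\<Oplus>x\<in>?A. component R (z x \<otimes> \<pi> (delta R x) y) (g - fst y))"
          unfolding zy
          by (rule finsum_additive_map[where q = "\<lambda>r. component R r (g - fst y)"])
            (use tc KR.submoduleE(5)[OF grade_R_submodule] in
              \<open>auto simp: R.abelian_monoid_axioms GR.component_zero intro!: GR.component_add\<close>)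
        also have "\<dots> = \<zero>"
        proof (rule R.add.finprod_one_eqI)
          fix x assume x: "x \<in> ?A"
          then have xI: "x \<in> index_set" using A by blast
          \<comment> \<open>\<open>z x\<close> has degree \<open>g - fst x\<close>, so degree
            \<open>g - fst y\<close> of the product involves only degree
            \<open>fst x - fst y\<close> of the other factor. That is coordinate \<open>y\<close> of
            the component killed by \<open>comp0\<close>.\<close>
          have "component R (\<pi> (delta R x) y) (fst x - fst y) = \<zero>"
            using fun_cong[OF comp0[OF x], of y] by (simp add: Fr_component_def graded_free_simps)
          then show "component R (z x \<otimes> \<pi> (delta R x) y) (g - fst y) = \<zero>"
            using component_mult[OF zR[OF xI] Fr_app_closed[OF d\<pi>[OF x]], of y "fst x - fst y"] zx
            by simp
        qed
        finally show ?thesis by (simp add: graded_free_simps)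
      qed
    qed
  qed
qed

lemma kernel_zero:
  assumes z: "z \<in> carrier P" "p z = \<zero>\<^bsub>F\<^esub>"
  shows "z = \<zero>\<^bsub>P\<^esub>"
proof -
  obtain A where A: "z = (\<Oplus>\<^bsub>P\<^esub>h\<in>A. Fr_component fst z h)"
    using Fr_component_sum[OF z(1), of 0] by (elim exE conjE) (rule that)
  have "Fr_component fst z h = \<zero>\<^bsub>P\<^esub>" for h
    by (rule kernel_grade_zero[OF Fr_component_mem[OF z(1)] p_component[OF z]])
  then have "(\<Oplus>\<^bsub>P\<^esub>h\<in>A. Fr_component fst z h) = \<zero>\<^bsub>P\<^esub>"
    by (intro P.M.add.finprod_one_eqI) simp
  then show ?thesis using A by simp
qed

theorem graded_iso_free: "graded_iso R P F"
  unfolding graded_iso_def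
proof (intro bexI[OF _ p_linear] conjI allI)
  have "inj_on p (carrier P)"
  proof (rule inj_onI)
    fix b c assume bc: "b \<in> carrier P" "c \<in> carrier P" "p b = p c"
    have "p (b \<oplus>\<^bsub>P\<^esub> (\<ominus> \<one>) \<odot>\<^bsub>P\<^esub> c) = \<zero>\<^bsub>F\<^esub>"
      using bc p_closed by (simp add: p_add p_smult F.smult_l_minus F.M.r_neg)
    then have "b \<oplus>\<^bsub>P\<^esub> (\<ominus> \<one>) \<odot>\<^bsub>P\<^esub> c = \<zero>\<^bsub>P\<^esub>"
      using bc by (intro kernel_zero) simp_all
    then have "b \<oplus>\<^bsub>P\<^esub> \<ominus>\<^bsub>P\<^esub> c = \<zero>\<^bsub>P\<^esub>" using bc by (simp add: P.smult_l_minus)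
    then show "b = c" using bc by (metis P.M.minus_equality P.M.minus_minus P.M.a_inv_closed)
  qed
  then show "bij_betw p (carrier P) (carrier F)" using p_surj by (simp add: bij_betw_def)
  show "p ` grade P g = grade F g" for g using p_grade p_surj_grade by blast
qed

end

section \<open>The monoid of isomorphism classes\<close>

lemma gmodule_sum_simps:
  "carrier (gmodule_sum M N) = carrier M \<times> carrier N"
  "add (gmodule_sum M N) (x, y) (x', y') = (add M x x', add N y y')"
  "smult (gmodule_sum M N) r (x, y) = (smult M r x, smult N r y)"
  "grade (gmodule_sum M N) g = grade M g \<times> grade N g"
  by (simp_all add: gmodule_sum_def)

lemma graded_iso_gmodule_sum:
  assumes "graded_iso R M M'" "graded_iso R N N'"
  shows "graded_iso R (gmodule_sum M N) (gmodule_sum M' N')"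
proof -
  obtain f where f: "f \<in> linear_maps R M M'" "bij_betw f (carrier M) (carrier M')"
      "\<And>g. f ` grade M g = grade M' g"
    using assms(1) by (rule graded_isoE) blast
  obtain h where h: "h \<in> linear_maps R N N'" "bij_betw h (carrier N) (carrier N')"
      "\<And>g. h ` grade N g = grade N' g"
    using assms(2) by (rule graded_isoE) blast
  have "map_prod f h \<in> linear_maps R (gmodule_sum M N) (gmodule_sum M' N')"
    using f(1) h(1) by (auto simp: linear_maps_def gmodule_sum_simps)
  moreover have "bij_betw (map_prod f h) (carrier M \<times> carrier N) (carrier M' \<times> carrier N')"
    using f(2) h(2) by (rule bij_betw_map_prod)
  moreover have "map_prod f h ` (grade M g \<times> grade N g) = grade M' g \<times> grade N' g" for g
    using f(3)[of g] h(3)[of g] by (simp add: map_prod_surj_on)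
  ultimately show ?thesis
    by (auto simp: graded_iso_def gmodule_sum_simps)
qed

text \<open>Transport of structure along the injection \<open>j\<close>. It moves a module into
  another type, in the application the \<open>universe\<close>.\<close>

lemma graded_iso_copy:
  fixes j :: "'m \<Rightarrow> 'n" and M :: "('r, 'm, 'g) gmodule" and R :: "('k, 'r, 'g) gmodule"
  assumes M: "module R M" and sub: "\<And>g. grade M g \<subseteq> carrier M" and j: "inj_on j (carrier M)"
  shows "\<exists>L :: ('r, 'n, 'g) gmodule. module R L \<and> graded_iso R M L"
proof -
  interpret M: module R M by fact
  define i where "i = inv_into (carrier M) j"
  have ij: "i (j x) = x" if "x \<in> carrier M" for x using that j by (simp add: i_def)
  define L :: "('r, 'n, 'g) gmodule" where
    "L = \<lparr>carrier = j ` carrier M, mult = (\<lambda>x y. x), one = j \<zero>\<^bsub>M\<^esub>, zero = j \<zero>\<^bsub>M\<^esub>,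
      add = (\<lambda>x y. j (i x \<oplus>\<^bsub>M\<^esub> i y)), smult = (\<lambda>r x. j (r \<odot>\<^bsub>M\<^esub> i x)),
      grade = (\<lambda>g. j ` grade M g)\<rparr>"
  have L: "carrier L = j ` carrier M" "\<zero>\<^bsub>L\<^esub> = j \<zero>\<^bsub>M\<^esub>" "grade L g = j ` grade M g"
    "x \<oplus>\<^bsub>L\<^esub> y = j (i x \<oplus>\<^bsub>M\<^esub> i y)" "r \<odot>\<^bsub>L\<^esub> x = j (r \<odot>\<^bsub>M\<^esub> i x)" for g x y r
    by (simp_all add: L_def)
  have "module R L"
  proof (rule moduleI)
    show "abelian_group L"
    proof (rule abelian_groupI)
      fix x assume "x \<in> carrier L"
      then obtain a where a: "a \<in> carrier M" "x = j a" by (auto simp: L)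
      show "\<exists>y\<in>carrier L. y \<oplus>\<^bsub>L\<^esub> x = \<zero>\<^bsub>L\<^esub>"
        by (rule bexI[of _ "j (\<ominus>\<^bsub>M\<^esub> a)"]) (use a in \<open>simp_all add: L ij M.M.l_neg\<close>)
    qed (auto simp: L ij M.M.a_ac)
  qed (auto simp: L ij M.R.is_cring M.smult_l_distr M.smult_r_distr M.smult_assoc1)
  moreover have "graded_iso R M L"
    unfolding graded_iso_def
    by (rule bexI[of _ j]) (use j in \<open>auto simp: L ij linear_maps_def bij_betw_def\<close>)
  ultimately show ?thesis by blast
qed

text \<open>The finite basis is enumerated by natural numbers, so that a vector becomes a function
  \<open>nat \<Rightarrow> 'k\<close>, the part of a \<open>universe\<close> element at one degree.
  Coordinate functions are extensional on \<open>B\<close>, hence agreement along the enumeration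
  suffices.\<close>

lemma inj_on_coordinates:
  fixes K :: "('k, 'x) ring_scheme" and V :: "('k, 'm, 'y) module_scheme"
  assumes "finite_basis K V W B"
  shows "\<exists>\<iota> :: 'm \<Rightarrow> nat \<Rightarrow> 'k. inj_on \<iota> W"
proof -
  have "finite B" using assms by (simp add: finite_basis_def)
  then obtain n and b :: "nat \<Rightarrow> 'm" where b: "B = b ` {i. i < n}" by (metis finite_conv_nat_seg_image)
  have "\<forall>w\<in>W. \<exists>c. c \<in> B \<rightarrow>\<^sub>E carrier K \<and> w = (\<Oplus>\<^bsub>V\<^esub>b\<in>B. c b \<odot>\<^bsub>V\<^esub> b)"
    using assms unfolding finite_basis_def by blast
  from bchoice[OF this] obtain c where "\<forall>w\<in>W. c w \<in> B \<rightarrow>\<^sub>E carrier K \<and>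
      w = (\<Oplus>\<^bsub>V\<^esub>b\<in>B. c w b \<odot>\<^bsub>V\<^esub> b)" ..
  then have c: "\<And>w. w \<in> W \<Longrightarrow> c w \<in> B \<rightarrow>\<^sub>E carrier K"
      "\<And>w. w \<in> W \<Longrightarrow> w = (\<Oplus>\<^bsub>V\<^esub>b\<in>B. c w b \<odot>\<^bsub>V\<^esub> b)"
    by simp_all
  have "inj_on (\<lambda>w i. c w (b i)) W"
  proof (rule inj_onI)
    fix v w assume vw: "v \<in> W" "w \<in> W" "(\<lambda>i. c v (b i)) = (\<lambda>i. c w (b i))"
    have "c v = c w"
    proof (rule PiE_ext[OF c(1)[OF vw(1)] c(1)[OF vw(2)]])
      fix x assume "x \<in> B"
      then show "c v x = c w x" using fun_cong[OF vw(3)] b by auto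
    qed
    then show "v = w" using c(2)[OF vw(1)] c(2)[OF vw(2)] by simp
  qed
  then show ?thesis by blast
qed

section \<open>Representatives in the fixed type\<close>

context pdcf_algebra
begin

lemma graded_iso_Fr_sum:
  "graded_iso R (Fr (X <+> Y) (case_sum d d')) (gmodule_sum (Fr X d) (Fr Y d'))"
proof (rule graded_isoI[where f = "\<lambda>c. (c \<circ> Inl, c \<circ> Inr)" and h = "\<lambda>(a, b). case_sum a b"])
  let ?P = "Fr (X <+> Y) (case_sum d d')"
  have split: "c \<circ> Inl \<in> carrier (Fr X d) \<and> c \<circ> Inr \<in> carrier (Fr Y d')" if c: "c \<in> carrier ?P" for c
  proof -
    have s: "finite {x. c x \<noteq> \<zero>}" "{x. c x \<noteq> \<zero>} \<subseteq> X <+> Y"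
      using c by (simp_all add: graded_free_carrier)
    have "finite (Inl -` {x. c x \<noteq> \<zero>})" "finite (Inr -` {x. c x \<noteq> \<zero>})"
      by (rule finite_vimageI[OF s(1)], simp)+
    then show ?thesis
      using s(2) c by (auto simp: graded_free_carrier vimage_def)
  qed
  have join: "case_sum a b \<in> carrier ?P" if a: "a \<in> carrier (Fr X d)" and b: "b \<in> carrier (Fr Y d')" for a b
  proof -
    have "{x. case_sum a b x \<noteq> \<zero>} = {x. a x \<noteq> \<zero>} <+> {x. b x \<noteq> \<zero>}"
    proof (rule Set.set_eqI)
      show "x \<in> {x. case_sum a b x \<noteq> \<zero>} \<longleftrightarrow> x \<in> {x. a x \<noteq> \<zero>} <+> {x. b x \<noteq> \<zero>}" for x
        by (cases x) auto
    qed
    then show ?thesis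
      using a b by (auto simp: graded_free_carrier split: sum.splits)
  qed
  show "(\<lambda>c. (c \<circ> Inl, c \<circ> Inr)) \<in> linear_maps R ?P (gmodule_sum (Fr X d) (Fr Y d'))"
    using split by (auto simp: linear_maps_def gmodule_sum_simps graded_free_simps comp_def)
  fix g
  show "(\<lambda>(a, b). case_sum a b) y \<in> carrier ?P \<and> (\<lambda>c. (c \<circ> Inl, c \<circ> Inr)) ((\<lambda>(a, b). case_sum a b) y) = y"
    if "y \<in> carrier (gmodule_sum (Fr X d) (Fr Y d'))" for y
    using that join by (auto simp: gmodule_sum_simps comp_def)
  show "(\<lambda>(a, b). case_sum a b) (x \<circ> Inl, x \<circ> Inr) = x" for x :: "'a + 'b \<Rightarrow> 'r"
    by (auto simp: fun_eq_iff split: sum.splits)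
  show "(x \<circ> Inl, x \<circ> Inr) \<in> grade (gmodule_sum (Fr X d) (Fr Y d')) g" if x: "x \<in> grade ?P g" for x
  proof -
    have xc: "x \<in> carrier ?P" and xg: "\<And>i. i \<in> X <+> Y \<Longrightarrow> x i \<in> grade R (g - case_sum d d' i)"
      using x by (simp_all add: graded_free_simps(4))
    show ?thesis
      using split[OF xc] xg[OF InlI] xg[OF InrI] by (auto simp: gmodule_sum_simps graded_free_simps(4))
  qed
  show "y \<in> carrier (gmodule_sum (Fr X d) (Fr Y d')) \<and> (\<lambda>(a, b). case_sum a b) y \<in> grade ?P g"
    if "y \<in> grade (gmodule_sum (Fr X d) (Fr Y d')) g" for y
    using that join by (auto simp: gmodule_sum_simps graded_free_simps(4))
qed

lemma graded_iso_Fr_empty: "graded_iso R (Fr {} d) (zero_gmodule :: ('r, unit, 'g) gmodule)"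
proof (rule graded_isoI[where f = "\<lambda>_. ()" and h = "\<lambda>_ _. \<zero>"])
  have *: "x = (\<lambda>_. \<zero>)" if "x \<in> carrier (Fr {} d)" for x
    using Fr_outside[OF that] by auto
  show "(\<lambda>_. \<zero>) = x" if "x \<in> carrier (Fr {} d)" for x
    using *[OF that] by simp
qed (auto simp: linear_maps_def zero_gmodule_def graded_free_simps(4) graded_free_carrier)

text \<open>An element is determined by its components, and each component by its coordinates in a
  finite basis. This embeds the carrier into \<open>universe\<close>, where the structure is
  copied.\<close>

lemma universe_copy:
  fixes M :: "('r, 'm, 'g) gmodule"
  assumes M: "projective_BDF K R M"
  shows "\<exists>L :: ('r, ('k, 'g) universe, 'g) gmodule. projective_BDF K R L \<and> graded_iso R M L"
proof -
  have gM: "graded_module K R M" using M by (simp add: projective_BDF_def)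
  interpret GM: graded_group M by (rule graded_module_graded_group[OF gM])
  have "\<exists>\<iota> :: 'm \<Rightarrow> nat \<Rightarrow> 'k. inj_on \<iota> (grade M g)" for g
    using M by (auto simp: projective_BDF_def BDF_def finite_dim_def intro: inj_on_coordinates)
  then obtain \<iota> :: "'g \<Rightarrow> 'm \<Rightarrow> nat \<Rightarrow> 'k" where \<iota>: "\<And>g. inj_on (\<iota> g) (grade M g)" by metis
  have "inj_on (\<lambda>x g. \<iota> g (component M x g)) (carrier M)"
  proof (rule inj_onI)
    fix x y assume xy: "x \<in> carrier M" "y \<in> carrier M"
      and eq: "(\<lambda>g. \<iota> g (component M x g)) = (\<lambda>g. \<iota> g (component M y g))"
    have c: "component M x g = component M y g" for g
      by (rule inj_onD[OF \<iota>[of g] fun_cong[OF eq]]) (use xy GM.component_mem in auto)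
    then have eq': "component M x = component M y" by (rule ext)
    have "decomposition M x (component M y)"
      using GM.component_decomposition[OF xy(1)] by (simp only: eq')
    then have "x = (\<Oplus>\<^bsub>M\<^esub>g\<in>{g. component M y g \<noteq> \<zero>\<^bsub>M\<^esub>}. component M y g)"
      by (simp only: decomposition_def)
    also have "\<dots> = y"
      using GM.component_decomposition[OF xy(2)] by (simp only: decomposition_def)
    finally show "x = y" .
  qed
  then obtain L :: "('r, ('k, 'g) universe, 'g) gmodule" where "module R L" "graded_iso R M L"
    using graded_iso_copy[OF graded_module_module[OF gM]] GM.grade_subset by blast
  then show ?thesis using projective_BDF_transport[OF M] by blast
qed

lemma projective_BDF_module: "projective_BDF K R M \<Longrightarrow> module R M"
  by (simp add: projective_BDF_def graded_module_def)

lemma K_series_graded_iso: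
  assumes M: "projective_BDF K R M" and N: "projective_BDF K R N" and iso: "graded_iso R M N"
  shows "K_series K R M = K_series K R N"
  using graded_iso_hilbert_series[OF _ _ projective_BDF_module[OF N] iso] M
  by (simp add: K_series_def projective_BDF_def)

lemma projective_BDF_free:
  fixes M :: "('r, 'm, 'g) gmodule"
  assumes "projective_BDF K R M"
  shows "\<exists>(X :: ('g \<times> 'm) set) d. free_index K R X d \<and> graded_iso R (Fr X d) M \<and>
    K_series K R M = free_index.fiber_count X d"
proof -
  interpret M: projective_bdf K R M by unfold_locales (rule assms)
  show ?thesis
    using M.I.free_index_axioms M.graded_iso_free
      M.I.K_series_iso_Fr[OF M.F.module_axioms M.graded_iso_free] by blast
qed

text \<open>By freeness the series counts generators by degree, and graded free modules with equal
  counts are isomorphic. The two modules may live in different types, so that arbitrary modules can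
  be compared with members of the universe.\<close>

lemma graded_iso_iff_K_series:
  fixes M :: "('r, 'm, 'g) gmodule" and N :: "('r, 'n, 'g) gmodule"
  assumes M: "projective_BDF K R M" and N: "projective_BDF K R N"
  shows "graded_iso R M N \<longleftrightarrow> K_series K R M = K_series K R N"
proof
  show "graded_iso R M N \<Longrightarrow> K_series K R M = K_series K R N"
    by (rule K_series_graded_iso[OF M N])
  assume eq: "K_series K R M = K_series K R N"
  obtain X :: "('g \<times> 'm) set" and d where X: "free_index K R X d" "graded_iso R (Fr X d) M"
      "K_series K R M = free_index.fiber_count X d"
    using projective_BDF_free[OF M] by (elim exE conjE) (rule that)
  obtain Y :: "('g \<times> 'n) set" and d' where Y: "free_index K R Y d'" "graded_iso R (Fr Y d') N"
      "K_series K R N = free_index.fiber_count Y d'"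
    using projective_BDF_free[OF N] by (elim exE conjE) (rule that)
  interpret X: free_index K R X d by (rule X(1))
  interpret Y: free_index K R Y d' by (rule Y(1))
  have "card {x \<in> X. d x = g} = card {y \<in> Y. d' y = g}" for g
    using fun_cong[OF eq, of g] unfolding X(3) Y(3) X.fiber_count_def Y.fiber_count_def by simp
  then have "graded_iso R (Fr X d) (Fr Y d')"
    by (rule Fr_iso_of_card[OF X.finite_fiber Y.finite_fiber])
  then have "graded_iso R (Fr X d) N" using Y(2) by (rule graded_iso_trans)
  with graded_iso_symmetric[OF Fr_graded_module X(2)] show "graded_iso R M N"
    by (rule graded_iso_trans)
qed

section \<open>Isomorphism classes named by series with nonnegative coefficients\<close>

definition positive_series :: "('g \<Rightarrow> int) set" where
  "positive_series = {a \<in> carrier (Q.S). \<forall>g. 0 \<le> a g}"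

lemma K_series_positive:
  assumes "projective_BDF K R M"
  shows "K_series K R M \<in> positive_series"
proof -
  interpret M: projective_bdf K R M by unfold_locales (rule assms)
  have "K_series K R M = M.I.fiber_count"
    by (rule M.I.K_series_iso_Fr[OF M.F.module_axioms M.graded_iso_free])
  then show ?thesis
    using M.I.fiber_count_closed by (simp add: positive_series_def M.I.fiber_count_def)
qed

text \<open>The index set holds \<open>a g\<close> generators in each degree \<open>g\<close>, so
  every nonnegative series is the generator count of a graded free module.\<close>

lemma free_index_positive_series:
  assumes a: "a \<in> positive_series"
  shows "free_index K R {(g, i). i < nat (a g)} fst"
    and "free_index.fiber_count {(g, i). i < nat (a g)} fst = a"
proof -
  let ?X = "{(g, i). i < nat (a g)}"
  have fib: "{x \<in> ?X. fst x = g} = Pair g ` {..<nat (a g)}" for g by auto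
  show fi: "free_index K R ?X fst"
  proof
    show "finite {x \<in> ?X. fst x = g}" for g unfolding fib by simp
    have "admissible (Supp R) {g. a g \<noteq> 0}" using a by (simp add: positive_series_def Q.S_carrier)
    then show "admissible (Supp R) (fst ` ?X)" by (rule Q.admissible_subset) auto
  qed
  show "free_index.fiber_count ?X fst = a"
    unfolding free_index.fiber_count_def[OF fi, abs_def] fib
    using a by (simp add: card_image inj_on_def positive_series_def)
qed

lemma universe_free:
  assumes "free_index K R X d"
  shows "\<exists>L :: ('r, ('k, 'g) universe, 'g) gmodule. projective_BDF K R L \<and>
    graded_iso R (Fr X d) L \<and> K_series K R L = free_index.fiber_count X d"
proof -
  interpret X: free_index K R X d by fact
  obtain L :: "('r, ('k, 'g) universe, 'g) gmodule"
    where L: "projective_BDF K R L" "graded_iso R (Fr X d) L"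
    using universe_copy[OF X.Fr_projective_BDF] by blast
  then show ?thesis using X.K_series_iso_Fr[OF projective_BDF_module] by blast
qed

text \<open>The direct sum has elements in a product type, so an isomorphic \<open>L\<close> in the
  universe is needed to name its class. The generators of the two summands are put together as a
  disjoint union, which adds the counts.\<close>

lemma universe_sum:
  fixes M :: "('r, 'm, 'g) gmodule" and N :: "('r, 'n, 'g) gmodule"
  assumes M: "projective_BDF K R M" and N: "projective_BDF K R N"
  shows "\<exists>L :: ('r, ('k, 'g) universe, 'g) gmodule. projective_BDF K R L \<and>
    graded_iso R L (gmodule_sum M N) \<and> graded_iso R (gmodule_sum M N) L \<and>
    K_series K R L = K_series K R M \<oplus>\<^bsub>Q.S\<^esub> K_series K R N"
proof -
  obtain X :: "('g \<times> 'm) set" and d where X: "free_index K R X d" "graded_iso R (Fr X d) M"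
      "K_series K R M = free_index.fiber_count X d"
    using projective_BDF_free[OF M] by (elim exE conjE) (rule that)
  obtain Y :: "('g \<times> 'n) set" and d' where Y: "free_index K R Y d'" "graded_iso R (Fr Y d') N"
      "K_series K R N = free_index.fiber_count Y d'"
    using projective_BDF_free[OF N] by (elim exE conjE) (rule that)
  interpret X: free_index K R X d by (rule X(1))
  interpret Y: free_index K R Y d' by (rule Y(1))
  let ?Z = "X <+> Y" and ?d = "case_sum d d'"
  have fib: "{z \<in> ?Z. ?d z = g} = {x \<in> X. d x = g} <+> {y \<in> Y. d' y = g}" for g
  proof (rule Set.set_eqI)
    show "z \<in> {z \<in> ?Z. ?d z = g} \<longleftrightarrow> z \<in> {x \<in> X. d x = g} <+> {y \<in> Y. d' y = g}" for z
      by (cases z) auto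
  qed
  have Z: "free_index K R ?Z ?d"
  proof
    show "finite {z \<in> ?Z. ?d z = g}" for g
      unfolding fib using X.finite_fiber Y.finite_fiber by simp
    have "?d ` ?Z = d ` X \<union> d' ` Y" by force
    then show "admissible (Supp R) (?d ` ?Z)"
      using Q.admissible_Un[OF X.admissible_X Y.admissible_X] by simp
  qed
  obtain L :: "('r, ('k, 'g) universe, 'g) gmodule" where L: "projective_BDF K R L"
      "graded_iso R (Fr ?Z ?d) L" "K_series K R L = free_index.fiber_count ?Z ?d"
    using universe_free[OF Z] by (elim exE conjE) (rule that)
  have gL: "graded_module K R L" using L(1) by (simp add: projective_BDF_def)
  have gM: "graded_module K R M" and gN: "graded_module K R N"
    using M N by (simp_all add: projective_BDF_def)
  have "graded_iso R (gmodule_sum (Fr X d) (Fr Y d')) (gmodule_sum M N)"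
    by (rule graded_iso_gmodule_sum[OF X(2) Y(2)])
  with graded_iso_Fr_sum have "graded_iso R (Fr ?Z ?d) (gmodule_sum M N)" by (rule graded_iso_trans)
  with graded_iso_symmetric[OF Fr_graded_module L(2)] have 1: "graded_iso R L (gmodule_sum M N)"
    by (rule graded_iso_trans)
  \<comment> \<open>The inversion starts from \<open>L\<close>, already known to be a graded module,
    which \<open>graded_iso_symmetric\<close> requires of its source.\<close>
  have 2: "graded_iso R (gmodule_sum M N) L" by (rule graded_iso_symmetric[OF gL 1])
  have "K_series K R L = K_series K R M \<oplus>\<^bsub>Q.S\<^esub> K_series K R N"
    unfolding L(3) X(3) Y(3) Q.S_add free_index.fiber_count_def[OF Z, abs_def]
      X.fiber_count_def Y.fiber_count_def fib
    using X.finite_fiber Y.finite_fiber by (simp add: card_Plus)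
  then show ?thesis using L(1) 1 2 by blast
qed

lemma universe_zero:
  "\<exists>L :: ('r, ('k, 'g) universe, 'g) gmodule. projective_BDF K R L \<and>
    graded_iso R (zero_gmodule :: ('r, unit, 'g) gmodule) L \<and>
    graded_iso R L (zero_gmodule :: ('r, unit, 'g) gmodule) \<and>
    K_series K R L = \<zero>\<^bsub>Q.S\<^esub>"
proof -
  have X: "free_index K R ({} :: nat set) (\<lambda>_. 0)"
    by unfold_locales (simp_all add: Q.admissible_finite)
  obtain L :: "('r, ('k, 'g) universe, 'g) gmodule" where L: "projective_BDF K R L"
      "graded_iso R (Fr ({} :: nat set) (\<lambda>_. 0)) L"
      "K_series K R L = free_index.fiber_count ({} :: nat set) (\<lambda>_. 0)"
    using universe_free[OF X] by (elim exE conjE) (rule that)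
  have gL: "graded_module K R L" using L(1) by (simp add: projective_BDF_def)
  have 1: "graded_iso R L (zero_gmodule :: ('r, unit, 'g) gmodule)"
    by (rule graded_iso_trans[OF graded_iso_symmetric[OF Fr_graded_module L(2)] graded_iso_Fr_empty])
  have "K_series K R L = \<zero>\<^bsub>Q.S\<^esub>"
    unfolding L(3) free_index.fiber_count_def[OF X, abs_def] by (simp add: series_ring_def)
  then show ?thesis using L(1) 1 graded_iso_symmetric[OF gL 1] by blast
qed

text \<open>Names isomorphism classes by their invariant: by \<open>iso_class_eq\<close> the class
  of \<open>M\<close> is the \<open>series_class\<close> of its \<open>K\<close>-series, so
  computations with classes become computations with series.\<close>

definition series_class :: "('g \<Rightarrow> int) \<Rightarrow> ('r, ('k, 'g) universe, 'g) gmodule set" where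
  "series_class a = {L. projective_BDF K R L \<and> K_series K R L = a}"

abbreviation A where "A \<equiv> iso_class_monoid K R"

lemma iso_class_eq:
  assumes "projective_BDF K R M"
  shows "iso_class K R M = series_class (K_series K R M)"
  by (auto simp: iso_class_def series_class_def graded_iso_iff_K_series[OF assms])

lemma series_class_nonempty:
  assumes "a \<in> positive_series"
  obtains L where "projective_BDF K R L" "K_series K R L = a" "L \<in> series_class a"
proof -
  have "\<exists>L :: ('r, ('k, 'g) universe, 'g) gmodule. projective_BDF K R L \<and> K_series K R L = a"
    using universe_free[OF free_index_positive_series(1)[OF assms]]
    unfolding free_index_positive_series(2)[OF assms] by blast
  then show thesis using that unfolding series_class_def by blast
qed

lemma iso_class_monoid_carrier: "carrier A = series_class ` positive_series"
proof -
  have "carrier A = {iso_class K R M |M :: ('r, ('k, 'g) universe, 'g) gmodule. projective_BDF K R M}"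
    by (simp add: iso_class_monoid_def)
  also have "\<dots> = series_class ` positive_series"
  proof
    show "{iso_class K R M |M :: ('r, ('k, 'g) universe, 'g) gmodule. projective_BDF K R M}
        \<subseteq> series_class ` positive_series"
      using iso_class_eq K_series_positive by auto
    show "series_class ` positive_series
        \<subseteq> {iso_class K R M |M :: ('r, ('k, 'g) universe, 'g) gmodule. projective_BDF K R M}"
    proof clarify
      fix a assume "a \<in> positive_series"
      then obtain L where L: "projective_BDF K R L" "K_series K R L = a" "L \<in> series_class a"
        by (rule series_class_nonempty)
      then have "series_class a = iso_class K R L" using iso_class_eq[OF L(1)] by simp
      then show "\<exists>M :: ('r, ('k, 'g) universe, 'g) gmodule.
          series_class a = iso_class K R M \<and> projective_BDF K R M"
        using L(1) by blast
    qed
  qed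
  finally show ?thesis .
qed

lemma iso_class_cong:
  assumes "graded_iso R M L" "graded_iso R L M"
  shows "iso_class K R M = iso_class K R L"
  by (auto simp: iso_class_def intro: graded_iso_trans[OF assms(1)] graded_iso_trans[OF assms(2)])

lemma iso_class_gmodule_sum:
  assumes M: "projective_BDF K R M" and N: "projective_BDF K R N"
  shows "iso_class K R (gmodule_sum M N) =
    series_class (K_series K R M \<oplus>\<^bsub>Q.S\<^esub> K_series K R N)"
proof -
  obtain L :: "('r, ('k, 'g) universe, 'g) gmodule" where L: "projective_BDF K R L"
      "graded_iso R L (gmodule_sum M N)" "graded_iso R (gmodule_sum M N) L"
      "K_series K R L = K_series K R M \<oplus>\<^bsub>Q.S\<^esub> K_series K R N"
    using universe_sum[OF M N] by (elim exE conjE) (rule that)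
  show ?thesis
    using iso_class_cong[OF L(3,2)] iso_class_eq[OF L(1)] by (simp add: L(4))
qed

text \<open>All members of the double union agree by \<open>iso_class_gmodule_sum\<close>, so the
  union is their common value; its index sets are nonempty because every nonnegative series is
  realized in the universe.\<close>

lemma iso_class_monoid_mult:
  assumes a: "a \<in> positive_series" and b: "b \<in> positive_series"
  shows "series_class a \<otimes>\<^bsub>A\<^esub> series_class b = series_class (a \<oplus>\<^bsub>Q.S\<^esub> b)"
proof -
  have "(\<Union>M\<in>series_class a. \<Union>N\<in>series_class b. iso_class K R (gmodule_sum M N)) =
      (\<Union>M\<in>series_class a. \<Union>N\<in>series_class b. series_class (a \<oplus>\<^bsub>Q.S\<^esub> b))"
    by (intro SUP_cong refl) (auto simp: iso_class_gmodule_sum series_class_def)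
  also have "\<dots> = series_class (a \<oplus>\<^bsub>Q.S\<^esub> b)"
    using series_class_nonempty[OF a] series_class_nonempty[OF b] by (metis SUP_const empty_iff)
  finally show ?thesis by (simp add: iso_class_monoid_def)
qed

lemma iso_class_monoid_one: "\<one>\<^bsub>A\<^esub> = series_class \<zero>\<^bsub>Q.S\<^esub>"
proof -
  obtain L :: "('r, ('k, 'g) universe, 'g) gmodule" where L: "projective_BDF K R L"
      "graded_iso R (zero_gmodule :: ('r, unit, 'g) gmodule) L"
      "graded_iso R L (zero_gmodule :: ('r, unit, 'g) gmodule)"
      "K_series K R L = \<zero>\<^bsub>Q.S\<^esub>"
    using universe_zero by (elim exE conjE) (rule that)
  show ?thesis
    using iso_class_cong[OF L(2,3)] iso_class_eq[OF L(1)] by (simp add: L(4) iso_class_monoid_def)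
qed

lemma positive_series_add:
  "a \<in> positive_series \<Longrightarrow> b \<in> positive_series \<Longrightarrow> a \<oplus>\<^bsub>Q.S\<^esub> b \<in> positive_series"
  using Q.S_add_closed[of a b] by (simp add: positive_series_def Q.S_add)

lemma positive_series_zero: "\<zero>\<^bsub>Q.S\<^esub> \<in> positive_series"
  using Q.S_zero_closed by (simp add: positive_series_def series_ring_def)

text \<open>The witnesses are the positive and the negative part of \<open>c\<close>, whose supports
  lie in that of \<open>c\<close>.\<close>

lemma positive_series_diff:
  assumes c: "c \<in> carrier (Q.S)"
  shows "\<exists>a\<in>positive_series. \<exists>b\<in>positive_series. a = c \<oplus>\<^bsub>Q.S\<^esub> b"
proof (rule bexI[of _ "\<lambda>g. max 0 (c g)"], rule bexI[of _ "\<lambda>g. max 0 (- c g)"])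
  have "admissible (Supp R) {g. max 0 (s * c g) \<noteq> 0}" for s
    by (rule Q.admissible_subset[OF c[unfolded Q.S_carrier]]) auto
  then have *: "(\<lambda>g. max 0 (s * c g)) \<in> positive_series" for s
    by (simp add: positive_series_def Q.S_carrier)
  show "(\<lambda>g. max 0 (c g)) \<in> positive_series" using *[of 1] by simp
  show "(\<lambda>g. max 0 (- c g)) \<in> positive_series" using *[of "-1"] by simp
  show "(\<lambda>g. max 0 (c g)) = c \<oplus>\<^bsub>Q.S\<^esub> (\<lambda>g. max 0 (- c g))"
    by (auto simp: Q.S_add fun_eq_iff max_def)
qed

end

section \<open>Group completion\<close>

text \<open>An injective homomorphism \<open>\<psi>\<close> into an abelian group makes a pair
  equivalent to exactly the pairs with the same difference of \<open>\<psi>\<close>-values. The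
  classes are thus indexed by differences, which exhaust \<open>G\<close> by \<open>diff\<close>,
  and the group laws carry over from \<open>G\<close>.\<close>

lemma group_completion_iso:
  fixes A :: "('a, 'x) monoid_scheme" and G :: "('b, 'y) monoid_scheme" (structure)
  assumes G: "comm_group G"
    and \<psi>_closed: "\<And>a. a \<in> carrier A \<Longrightarrow> \<psi> a \<in> carrier G" and inj: "inj_on \<psi> (carrier A)"
    and closed: "\<And>a b. a \<in> carrier A \<Longrightarrow> b \<in> carrier A \<Longrightarrow> a \<otimes>\<^bsub>A\<^esub> b \<in> carrier A"
    and hom: "\<And>a b. a \<in> carrier A \<Longrightarrow> b \<in> carrier A \<Longrightarrow> \<psi> (a \<otimes>\<^bsub>A\<^esub> b) = \<psi> a \<otimes> \<psi> b"
    and one: "\<one>\<^bsub>A\<^esub> \<in> carrier A" "\<psi> \<one>\<^bsub>A\<^esub> = \<one>"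
    and diff: "\<And>g. g \<in> carrier G \<Longrightarrow> \<exists>a\<in>carrier A. \<exists>b\<in>carrier A. \<psi> a = g \<otimes> \<psi> b"
  shows "comm_group (group_completion A) \<and>
    (\<exists>\<phi>\<in>iso (group_completion A) G. \<forall>a\<in>carrier A.
       completion_class A a \<in> carrier (group_completion A) \<and> \<phi> (completion_class A a) = \<psi> a)"
proof -
  interpret G: comm_group G by fact
  let ?C = "group_completion A"
  \<comment> \<open>\<open>E g\<close> consists of the pairs with difference \<open>g\<close>. It is
    shown to be an equivalence class, and \<open>E\<close>, as a function of \<open>g\<close>, is
    the inverse of the isomorphism sought.\<close>
  define E where "E g = {(a, b). a \<in> carrier A \<and> b \<in> carrier A \<and> \<psi> a = g \<otimes> \<psi> b}" for g
  have rel: "completion_rel A `` {(a, b)} = E g"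
    if a: "a \<in> carrier A" and b: "b \<in> carrier A" and g: "g \<in> carrier G" "\<psi> a = g \<otimes> \<psi> b" for a b g
  proof -
    have "((a, b), (c, d)) \<in> completion_rel A \<longleftrightarrow> (c, d) \<in> E g" for c d
    proof (cases "c \<in> carrier A \<and> d \<in> carrier A")
      case True
      note cl = a b True[THEN conjunct1] True[THEN conjunct2]
      note \<psi>cl = cl[THEN \<psi>_closed]
      have "a \<otimes>\<^bsub>A\<^esub> d \<otimes>\<^bsub>A\<^esub> e = c \<otimes>\<^bsub>A\<^esub> b \<otimes>\<^bsub>A\<^esub> e \<longleftrightarrow> \<psi> c = g \<otimes> \<psi> d" if e: "e \<in> carrier A" for e
      proof -
        have "a \<otimes>\<^bsub>A\<^esub> d \<otimes>\<^bsub>A\<^esub> e = c \<otimes>\<^bsub>A\<^esub> b \<otimes>\<^bsub>A\<^esub> e \<longleftrightarrow>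
            \<psi> (a \<otimes>\<^bsub>A\<^esub> d \<otimes>\<^bsub>A\<^esub> e) = \<psi> (c \<otimes>\<^bsub>A\<^esub> b \<otimes>\<^bsub>A\<^esub> e)"
          by (rule inj_on_eq_iff[OF inj, symmetric]) (use cl e closed in auto)
        also have "\<dots> \<longleftrightarrow> \<psi> a \<otimes> \<psi> d \<otimes> \<psi> e = \<psi> c \<otimes> \<psi> b \<otimes> \<psi> e"
          using cl e closed by (simp add: hom)
        \<comment> \<open>The stabilizing element \<open>e\<close> cancels in \<open>G\<close>, so
          the equation in \<open>completion_rel\<close> holds for all \<open>e\<close> or for
          none.\<close>
        also have "\<dots> \<longleftrightarrow> \<psi> a \<otimes> \<psi> d = \<psi> c \<otimes> \<psi> b"
          using \<psi>cl \<psi>_closed[OF e] by (intro G.right_cancel) simp_all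
        also have "\<dots> \<longleftrightarrow> g \<otimes> \<psi> d \<otimes> \<psi> b = \<psi> c \<otimes> \<psi> b"
          using \<psi>cl g(1) by (simp add: g(2) G.m_ac)
        also have "\<dots> \<longleftrightarrow> g \<otimes> \<psi> d = \<psi> c"
          using \<psi>cl g(1) by (intro G.right_cancel) simp_all
        finally show ?thesis by auto
      qed
      then show ?thesis using cl one(1) by (auto simp: completion_rel_def E_def)
    qed (auto simp: completion_rel_def E_def)
    then show ?thesis by auto
  qed
  have E_ex: "\<exists>a b. (a, b) \<in> E g" if "g \<in> carrier G" for g
    using diff[OF that] by (auto simp: E_def)
  have carrier: "carrier ?C = E ` carrier G"
  proof
    show "carrier ?C \<subseteq> E ` carrier G"
    proof
      fix x assume "x \<in> carrier ?C"
      then obtain a b where ab: "a \<in> carrier A" "b \<in> carrier A" "x = completion_rel A `` {(a, b)}"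
        by (auto simp: group_completion_def quotient_def)
      let ?g = "\<psi> a \<otimes> inv (\<psi> b)"
      have "?g \<in> carrier G" "\<psi> a = ?g \<otimes> \<psi> b"
        using \<psi>_closed[OF ab(1)] \<psi>_closed[OF ab(2)] by (simp_all add: G.m_assoc)
      then show "x \<in> E ` carrier G" using rel[OF ab(1,2)] ab(3) by blast
    qed
    show "E ` carrier G \<subseteq> carrier ?C"
    proof clarify
      fix g assume g: "g \<in> carrier G"
      obtain a b where ab: "(a, b) \<in> E g" using E_ex[OF g] by blast
      then have "E g = completion_rel A `` {(a, b)}" using rel[OF _ _ g] by (simp add: E_def)
      then show "E g \<in> carrier ?C"
        using ab by (auto simp: group_completion_def E_def intro: quotientI)
    qed
  qed
  have mult: "E g \<otimes>\<^bsub>?C\<^esub> E h = E (g \<otimes> h)" if g: "g \<in> carrier G" and h: "h \<in> carrier G" for g h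
  proof -
    have step: "completion_rel A `` {(a \<otimes>\<^bsub>A\<^esub> c, b \<otimes>\<^bsub>A\<^esub> d)} = E (g \<otimes> h)"
      if "(a, b) \<in> E g" "(c, d) \<in> E h" for a b c d
    proof (rule rel)
      have cl: "a \<in> carrier A" "b \<in> carrier A" "c \<in> carrier A" "d \<in> carrier A"
        and eq: "\<psi> a = g \<otimes> \<psi> b" "\<psi> c = h \<otimes> \<psi> d"
        using that by (auto simp: E_def)
      show "a \<otimes>\<^bsub>A\<^esub> c \<in> carrier A" "b \<otimes>\<^bsub>A\<^esub> d \<in> carrier A" using cl closed by auto
      show "g \<otimes> h \<in> carrier G" using g h by simp
      show "\<psi> (a \<otimes>\<^bsub>A\<^esub> c) = g \<otimes> h \<otimes> \<psi> (b \<otimes>\<^bsub>A\<^esub> d)"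
        using g h cl[THEN \<psi>_closed] by (simp add: hom cl eq G.m_ac)
    qed
    have inner: "(\<Union>(c, d)\<in>E h. completion_rel A `` {(a \<otimes>\<^bsub>A\<^esub> c, b \<otimes>\<^bsub>A\<^esub> d)}) = E (g \<otimes> h)"
      if ab: "(a, b) \<in> E g" for a b
    proof -
      have "(\<Union>(c, d)\<in>E h. completion_rel A `` {(a \<otimes>\<^bsub>A\<^esub> c, b \<otimes>\<^bsub>A\<^esub> d)}) = (\<Union>q\<in>E h. E (g \<otimes> h))"
        by (rule SUP_cong[OF refl]) (clarsimp simp only: step[OF ab] prod.case)
      then show ?thesis using E_ex[OF h] by auto
    qed
    have "E g \<otimes>\<^bsub>?C\<^esub> E h = (\<Union>p\<in>E g. E (g \<otimes> h))"
      unfolding group_completion_def monoid.simps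
      by (rule SUP_cong[OF refl]) (clarsimp simp only: inner prod.case)
    also have "\<dots> = E (g \<otimes> h)" using E_ex[OF g] by auto
    finally show ?thesis .
  qed
  have one': "\<one>\<^bsub>?C\<^esub> = E \<one>"
    using rel[OF one(1) one(1), of "\<one>"] one(2) by (simp add: group_completion_def)
  have injE: "inj_on E (carrier G)"
  proof (rule inj_onI)
    fix g h assume gh: "g \<in> carrier G" "h \<in> carrier G" "E g = E h"
    obtain a b where ab: "(a, b) \<in> E g" using E_ex[OF gh(1)] by blast
    then have "(a, b) \<in> E h" using gh(3) by simp
    then have "g \<otimes> \<psi> b = h \<otimes> \<psi> b" "b \<in> carrier A" using ab by (auto simp: E_def)
    then show "g = h" using gh \<psi>_closed by simp
  qed
  have iso: "E \<in> iso G ?C"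
    by (rule isoI) (use injE carrier mult in \<open>auto simp: hom_def bij_betw_def\<close>)
  have comm: "comm_group ?C"
  proof (rule comm_groupI)
    fix x assume "x \<in> carrier ?C"
    then obtain g where g: "g \<in> carrier G" "x = E g" by (auto simp: carrier)
    then have "E (inv g) \<in> carrier ?C" "E (inv g) \<otimes>\<^bsub>?C\<^esub> x = \<one>\<^bsub>?C\<^esub>"
      by (auto simp: carrier mult one')
    then show "\<exists>y\<in>carrier ?C. y \<otimes>\<^bsub>?C\<^esub> x = \<one>\<^bsub>?C\<^esub>" by blast
  qed (auto simp: carrier mult one' G.m_ac)
  let ?\<phi> = "inv_into (carrier G) E"
  have "?\<phi> \<in> iso ?C G" by (rule G.iso_set_sym[OF iso])
  moreover have "completion_class A a \<in> carrier ?C \<and> ?\<phi> (completion_class A a) = \<psi> a"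
    if a: "a \<in> carrier A" for a
  proof -
    have "completion_class A a = E (\<psi> a)"
      unfolding completion_class_def
      by (rule rel[OF a one(1)]) (use \<psi>_closed[OF a] one(2) in simp_all)
    then show ?thesis using \<psi>_closed[OF a] injE by (simp add: carrier)
  qed
  ultimately show ?thesis using comm by blast
qed

section \<open>The Grothendieck group as the additive group of series\<close>

context pdcf_algebra
begin

text \<open>All members of a \<open>series_class\<close> share their \<open>K\<close>-series, so the
  choice does not matter; on nonnegative series this inverts \<open>series_class\<close>.\<close>

definition class_series :: "('r, ('k, 'g) universe, 'g) gmodule set \<Rightarrow> 'g \<Rightarrow> int" where
  "class_series X = K_series K R (SOME L. L \<in> X)"

lemma class_series:
  assumes "a \<in> positive_series"
  shows "class_series (series_class a) = a"
proof -
  have "(SOME L. L \<in> series_class a) \<in> series_class a"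
    using series_class_nonempty[OF assms] someI by metis
  then show ?thesis unfolding class_series_def series_class_def by blast
qed

lemma K0_iso:
  "comm_group (K0_BDF K R) \<and>
    (\<exists>\<phi>\<in>iso (K0_BDF K R) (add_monoid (Q.S)). \<forall>X\<in>carrier A.
       completion_class A X \<in> carrier (K0_BDF K R) \<and> \<phi> (completion_class A X) = class_series X)"
  unfolding K0_BDF_def
proof (rule group_completion_iso[OF Q.S_add_group])
  note defs = iso_class_monoid_carrier class_series
  show "class_series X \<in> carrier (add_monoid (Q.S))" if "X \<in> carrier A" for X
    using that by (auto simp: defs) (simp add: positive_series_def)
  show "inj_on class_series (carrier A)"
    by (rule inj_onI) (auto simp: defs)
  show "X \<otimes>\<^bsub>A\<^esub> Y \<in> carrier A" if "X \<in> carrier A" "Y \<in> carrier A" for X Y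
    using that by (auto simp: defs iso_class_monoid_mult positive_series_add)
  show "class_series (X \<otimes>\<^bsub>A\<^esub> Y) = class_series X \<otimes>\<^bsub>add_monoid (Q.S)\<^esub> class_series Y"
    if "X \<in> carrier A" "Y \<in> carrier A" for X Y
    using that by (auto simp: defs iso_class_monoid_mult positive_series_add)
  show "\<one>\<^bsub>A\<^esub> \<in> carrier A"
    by (simp add: defs iso_class_monoid_one positive_series_zero)
  show "class_series \<one>\<^bsub>A\<^esub> = \<one>\<^bsub>add_monoid (Q.S)\<^esub>"
    by (simp add: defs iso_class_monoid_one positive_series_zero)
  fix c assume "c \<in> carrier (add_monoid (Q.S))"
  then obtain a b where "a \<in> positive_series" "b \<in> positive_series"
      "a = c \<oplus>\<^bsub>Q.S\<^esub> b"
    using positive_series_diff[of c] by auto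
  then show "\<exists>X\<in>carrier A. \<exists>Y\<in>carrier A.
      class_series X = c \<otimes>\<^bsub>add_monoid (Q.S)\<^esub> class_series Y"
    by (intro bexI[of _ "series_class a"] bexI[of _ "series_class b"]) (simp_all add: defs)
qed

text \<open>Covers modules over every type, because \<open>iso_class\<close> collects the universe
  modules isomorphic to \<open>F\<close> whatever the type of \<open>F\<close>.\<close>

lemma K0_class_eq:
  assumes "projective_BDF K R F"
  shows "\<exists>X\<in>carrier A. K0_class K R F = completion_class A X \<and> class_series X = K_series K R F"
proof (intro bexI conjI)
  show "K0_class K R F = completion_class A (series_class (K_series K R F))"
    unfolding K0_class_def by (simp add: iso_class_eq[OF assms])
  show "class_series (series_class (K_series K R F)) = K_series K R F"
    by (rule class_series[OF K_series_positive[OF assms]])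
  show "series_class (K_series K R F) \<in> carrier A"
    unfolding iso_class_monoid_carrier by (rule imageI[OF K_series_positive[OF assms]])
qed

end

text \<open>The clause for the universe pins \<open>\<phi>\<close> down, since the classes of these
  modules generate the group; the other clause evaluates the same \<open>\<phi>\<close> on modules
  over an arbitrary type \<open>'m\<close>.\<close>

theorem theorem5:
  fixes K :: "'k ring" and R :: "('k, 'r, 'g::ab_group_add) gmodule"
  assumes "field K" and "graded_algebra K R" and "domain R" and "PDCF K R"
  shows "comm_group (K0_BDF K R) \<and>
    (\<exists>\<phi> \<in> iso (K0_BDF K R) (add_monoid (series_ring (Supp R))).
       (\<forall>F :: ('r, ('k, 'g) universe, 'g) gmodule. projective_BDF K R F \<longrightarrow>
          K0_class K R F \<in> carrier (K0_BDF K R) \<and> \<phi> (K0_class K R F) = K_series K R F) \<and>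
       (\<forall>F :: ('r, 'm, 'g) gmodule. projective_BDF K R F \<longrightarrow>
          K0_class K R F \<in> carrier (K0_BDF K R) \<and> \<phi> (K0_class K R F) = K_series K R F))"
proof -
  interpret pdcf_algebra K R by (rule pdcf_algebra.intro) (rule assms)+
  obtain \<phi> where \<phi>: "\<phi> \<in> iso (K0_BDF K R) (add_monoid (series_ring (Supp R)))"
    and classes: "\<And>X. X \<in> carrier A \<Longrightarrow>
      completion_class A X \<in> carrier (K0_BDF K R) \<and> \<phi> (completion_class A X) = class_series X"
    using K0_iso by blast
  have universe: "K0_class K R F \<in> carrier (K0_BDF K R) \<and> \<phi> (K0_class K R F) = K_series K R F"
    if "projective_BDF K R F" for F :: "('r, ('k, 'g) universe, 'g) gmodule"
    using K0_class_eq[OF that] classes by metis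
  have "K0_class K R F \<in> carrier (K0_BDF K R) \<and> \<phi> (K0_class K R F) = K_series K R F"
    if "projective_BDF K R F" for F :: "('r, 'm, 'g) gmodule"
    using K0_class_eq[OF that] classes by metis
  with universe show ?thesis using K0_iso \<phi> by blast
qed

end
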